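(* Over $\mathsf{RCA}_0$, $\mathsf{RT}(!\omega)$ implies $\forall X\,\exists Y\,(Y=X^{(\omega)})$.
   Context: A finite set $X\subseteq\mathbb{N}$ is exactly large if $|X|=\min(X)+1$; $[X]^{!\omega}$ is the set of exactly large subsets of $X$. $\mathsf{RT}(!\omega)$: for every infinite $M\subseteq\mathbb{N}$ and every $C:[\mathbb{N}]^{!\omega}\to 2$ there is an infinite $L\subseteq M$ with $C$ constant on $[L]^{!\omega}$. $X^{(\omega)}=\{(i,j):j\in X^{(i)}\}$ where $X^{(i)}$ is the $i$-th Turing jump; "$Y=X^{(\omega)}$" is formalized as: for every $n$ the $n$-th projection of $Y$ is $X^{(n)}$. *)

theory Defs
  imports Main
begin

section \<open>The language of second-order arithmetic\<close>

text \<open>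
  Both sorts of variables are de Bruijn indices, in two separate index spaces: a number quantifier
  binds number variable 0 and leaves set variables alone, and conversely.
\<close>

datatype tm =
    V nat
  | Zero
  | One
  | Plus tm tm  (infixl "\<^bold>+" 65)
  | Times tm tm  (infixl "\<^bold>*" 70)

datatype fm =
    Eq tm tm  (infix "\<^bold>=" 55)
  | Less tm tm  (infix "\<^bold><" 55)
  | Mem tm nat  (infix "\<^bold>\<in>" 55)
  | Neg fm  ("\<^bold>\<not> _" [54] 54)
  | Conj fm fm  (infixr "\<^bold>\<and>" 53)
  | Disj fm fm  (infixr "\<^bold>\<or>" 52)
  | Imp fm fm  (infixr "\<^bold>\<longrightarrow>" 51)
  | Iff fm fm  (infix "\<^bold>\<longleftrightarrow>" 50)
  | AllN fm
  | ExN fm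
  | AllS fm
  | ExS fm

primrec subst_tm :: "(nat \<Rightarrow> tm) \<Rightarrow> tm \<Rightarrow> tm" where
  "subst_tm f (V i) = f i"
| "subst_tm f Zero = Zero"
| "subst_tm f One = One"
| "subst_tm f (s \<^bold>+ t) = subst_tm f s \<^bold>+ subst_tm f t"
| "subst_tm f (s \<^bold>* t) = subst_tm f s \<^bold>* subst_tm f t"

text \<open>\<open>up k t\<close> is \<open>t\<close> as seen from below \<open>k\<close> further number quantifiers.\<close>

definition up :: "nat \<Rightarrow> tm \<Rightarrow> tm" where
  "up k = subst_tm (\<lambda>i. V (i + k))"

primrec substN :: "(nat \<Rightarrow> tm) \<Rightarrow> fm \<Rightarrow> fm" where
  "substN f (s \<^bold>= t) = (subst_tm f s \<^bold>= subst_tm f t)"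
| "substN f (s \<^bold>< t) = (subst_tm f s \<^bold>< subst_tm f t)"
| "substN f (t \<^bold>\<in> X) = (subst_tm f t \<^bold>\<in> X)"
| "substN f (\<^bold>\<not> p) = (\<^bold>\<not> substN f p)"
| "substN f (p \<^bold>\<and> q) = (substN f p \<^bold>\<and> substN f q)"
| "substN f (p \<^bold>\<or> q) = (substN f p \<^bold>\<or> substN f q)"
| "substN f (p \<^bold>\<longrightarrow> q) = (substN f p \<^bold>\<longrightarrow> substN f q)"
| "substN f (p \<^bold>\<longleftrightarrow> q) = (substN f p \<^bold>\<longleftrightarrow> substN f q)"
| "substN f (AllN p) = AllN (substN (case_nat (V 0) (\<lambda>i. up 1 (f i))) p)"
| "substN f (ExN p) = ExN (substN (case_nat (V 0) (\<lambda>i. up 1 (f i))) p)"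
| "substN f (AllS p) = AllS (substN f p)"
| "substN f (ExS p) = ExS (substN f p)"

primrec renameS :: "(nat \<Rightarrow> nat) \<Rightarrow> fm \<Rightarrow> fm" where
  "renameS g (s \<^bold>= t) = (s \<^bold>= t)"
| "renameS g (s \<^bold>< t) = (s \<^bold>< t)"
| "renameS g (t \<^bold>\<in> X) = (t \<^bold>\<in> g X)"
| "renameS g (\<^bold>\<not> p) = (\<^bold>\<not> renameS g p)"
| "renameS g (p \<^bold>\<and> q) = (renameS g p \<^bold>\<and> renameS g q)"
| "renameS g (p \<^bold>\<or> q) = (renameS g p \<^bold>\<or> renameS g q)"
| "renameS g (p \<^bold>\<longrightarrow> q) = (renameS g p \<^bold>\<longrightarrow> renameS g q)"
| "renameS g (p \<^bold>\<longleftrightarrow> q) = (renameS g p \<^bold>\<longleftrightarrow> renameS g q)"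
| "renameS g (AllN p) = AllN (renameS g p)"
| "renameS g (ExN p) = ExN (renameS g p)"
| "renameS g (AllS p) = AllS (renameS (case_nat 0 (\<lambda>i. Suc (g i))) p)"
| "renameS g (ExS p) = ExS (renameS (case_nat 0 (\<lambda>i. Suc (g i))) p)"


section \<open>Structures\<close>

text \<open>
  The number part of a structure is all of \<open>'a\<close>, the set part an arbitrary nonempty family of
  subsets of it (Henkin semantics; the number part need not be standard).
\<close>

record 'a l2_struct =
  zero :: 'a
  one :: 'a
  add :: "'a \<Rightarrow> 'a \<Rightarrow> 'a"
  mult :: "'a \<Rightarrow> 'a \<Rightarrow> 'a"
  less :: "'a \<Rightarrow> 'a \<Rightarrow> bool"
  sets :: "'a set set"

hide_const (open) zero one add mult less sets

definition l2_structure :: "'a l2_struct \<Rightarrow> bool" where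
  "l2_structure M \<longleftrightarrow> l2_struct.sets M \<noteq> {}"

primrec eval_tm :: "'a l2_struct \<Rightarrow> (nat \<Rightarrow> 'a) \<Rightarrow> tm \<Rightarrow> 'a" where
  "eval_tm M v (V i) = v i"
| "eval_tm M v Zero = l2_struct.zero M"
| "eval_tm M v One = l2_struct.one M"
| "eval_tm M v (s \<^bold>+ t) = l2_struct.add M (eval_tm M v s) (eval_tm M v t)"
| "eval_tm M v (s \<^bold>* t) = l2_struct.mult M (eval_tm M v s) (eval_tm M v t)"

primrec sat :: "'a l2_struct \<Rightarrow> (nat \<Rightarrow> 'a) \<Rightarrow> (nat \<Rightarrow> 'a set) \<Rightarrow> fm \<Rightarrow> bool" where
  "sat M v w (s \<^bold>= t) \<longleftrightarrow> eval_tm M v s = eval_tm M v t"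
| "sat M v w (s \<^bold>< t) \<longleftrightarrow> l2_struct.less M (eval_tm M v s) (eval_tm M v t)"
| "sat M v w (t \<^bold>\<in> X) \<longleftrightarrow> eval_tm M v t \<in> w X"
| "sat M v w (\<^bold>\<not> p) \<longleftrightarrow> \<not> sat M v w p"
| "sat M v w (p \<^bold>\<and> q) \<longleftrightarrow> sat M v w p \<and> sat M v w q"
| "sat M v w (p \<^bold>\<or> q) \<longleftrightarrow> sat M v w p \<or> sat M v w q"
| "sat M v w (p \<^bold>\<longrightarrow> q) \<longleftrightarrow> (sat M v w p \<longrightarrow> sat M v w q)"
| "sat M v w (p \<^bold>\<longleftrightarrow> q) \<longleftrightarrow> (sat M v w p \<longleftrightarrow> sat M v w q)"
| "sat M v w (AllN p) \<longleftrightarrow> (\<forall>x. sat M (case_nat x v) w p)"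
| "sat M v w (ExN p) \<longleftrightarrow> (\<exists>x. sat M (case_nat x v) w p)"
| "sat M v w (AllS p) \<longleftrightarrow> (\<forall>X\<in>l2_struct.sets M. sat M v (case_nat X w) p)"
| "sat M v w (ExS p) \<longleftrightarrow> (\<exists>X\<in>l2_struct.sets M. sat M v (case_nat X w) p)"

text \<open>Truth in a structure is truth of the universal closure.\<close>

definition models :: "'a l2_struct \<Rightarrow> fm \<Rightarrow> bool"  (infix "\<Turnstile>" 50) where
  "M \<Turnstile> p \<longleftrightarrow> (\<forall>v w. range w \<subseteq> l2_struct.sets M \<longrightarrow> sat M v w p)"


section \<open>The axioms of recursive comprehension\<close>

inductive bounded_fm :: "fm \<Rightarrow> bool" where
  "bounded_fm (s \<^bold>= t)"
| "bounded_fm (s \<^bold>< t)"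
| "bounded_fm (t \<^bold>\<in> X)"
| "bounded_fm p \<Longrightarrow> bounded_fm (\<^bold>\<not> p)"
| "bounded_fm p \<Longrightarrow> bounded_fm q \<Longrightarrow> bounded_fm (p \<^bold>\<and> q)"
| "bounded_fm p \<Longrightarrow> bounded_fm q \<Longrightarrow> bounded_fm (p \<^bold>\<or> q)"
| "bounded_fm p \<Longrightarrow> bounded_fm q \<Longrightarrow> bounded_fm (p \<^bold>\<longrightarrow> q)"
| "bounded_fm p \<Longrightarrow> bounded_fm q \<Longrightarrow> bounded_fm (p \<^bold>\<longleftrightarrow> q)"
| "bounded_fm p \<Longrightarrow> bounded_fm (AllN (V 0 \<^bold>< up 1 t \<^bold>\<longrightarrow> p))"
| "bounded_fm p \<Longrightarrow> bounded_fm (ExN (V 0 \<^bold>< up 1 t \<^bold>\<and> p))"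

definition Sigma01 :: "fm set" where
  "Sigma01 = {ExN p |p. bounded_fm p}"

definition Pi01 :: "fm set" where
  "Pi01 = {AllN p |p. bounded_fm p}"

definition basic_axioms :: "fm set" where
  "basic_axioms =
    {\<^bold>\<not> V 0 \<^bold>+ One \<^bold>= Zero,
     V 0 \<^bold>+ One \<^bold>= V 1 \<^bold>+ One \<^bold>\<longrightarrow> V 0 \<^bold>= V 1,
     V 0 \<^bold>+ Zero \<^bold>= V 0,
     V 0 \<^bold>+ (V 1 \<^bold>+ One) \<^bold>= (V 0 \<^bold>+ V 1) \<^bold>+ One,
     V 0 \<^bold>* Zero \<^bold>= Zero,
     V 0 \<^bold>* (V 1 \<^bold>+ One) \<^bold>= V 0 \<^bold>* V 1 \<^bold>+ V 0,
     \<^bold>\<not> V 0 \<^bold>< Zero,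
     V 0 \<^bold>< V 1 \<^bold>+ One \<^bold>\<longleftrightarrow> V 0 \<^bold>< V 1 \<^bold>\<or> V 0 \<^bold>= V 1}"

text \<open>In both schemes \<open>p\<close> may have further free number and set variables as parameters.\<close>

definition induction_axiom :: "fm \<Rightarrow> fm" where
  "induction_axiom p =
    (substN (case_nat Zero V) p \<^bold>\<and>
     AllN (p \<^bold>\<longrightarrow> substN (case_nat (V 0 \<^bold>+ One) (\<lambda>i. V (Suc i))) p) \<^bold>\<longrightarrow>
     AllN p)"

definition comprehension_axiom :: "fm \<Rightarrow> fm \<Rightarrow> fm" where
  "comprehension_axiom p q =
    (AllN (p \<^bold>\<longleftrightarrow> q) \<^bold>\<longrightarrow> ExS (AllN (V 0 \<^bold>\<in> 0 \<^bold>\<longleftrightarrow> renameS Suc p)))"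

definition RCA0 :: "fm set" where
  "RCA0 = basic_axioms
    \<union> {induction_axiom p |p. p \<in> Sigma01}
    \<union> {comprehension_axiom p q |p q. p \<in> Sigma01 \<and> q \<in> Pi01}"


section \<open>Coding of pairs and finite sets\<close>

text \<open>
  The coding is essentially that of Simpson's \<^emph>\<open>Subsystems of Second Order Arithmetic\<close>, Section II.2.
  In the formula-building functions below, set arguments are set variables (de Bruijn indices).
\<close>

definition pair :: "tm \<Rightarrow> tm \<Rightarrow> tm" where
  "pair s t = (s \<^bold>+ t) \<^bold>* (s \<^bold>+ t) \<^bold>+ s"

text \<open>
  A triple \<open>c = ((k, m), n)\<close> represents the finite set of all \<open>i < k\<close> such that \<open>m (i + 1) + 1\<close>
  divides \<open>n\<close>. Every finite set has such a triple; its \<^emph>\<open>code\<close> is the least one, so that finite sets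
  and codes correspond one to one.
\<close>

definition in_fin :: "tm \<Rightarrow> tm \<Rightarrow> fm"  (infix "\<^bold>\<epsilon>" 55) where
  "(i \<^bold>\<epsilon> c) =
    ExN (ExN (ExN (
      up 3 c \<^bold>= pair (pair (V 2) (V 1)) (V 0) \<^bold>\<and>
      up 3 i \<^bold>< V 2 \<^bold>\<and>
      ExN (V 1 \<^bold>= (V 2 \<^bold>* (up 4 i \<^bold>+ One) \<^bold>+ One) \<^bold>* V 0))))"

definition is_triple :: "tm \<Rightarrow> fm" where
  "is_triple c = ExN (ExN (ExN (up 3 c \<^bold>= pair (pair (V 2) (V 1)) (V 0))))"

definition fin_code :: "tm \<Rightarrow> fm" where
  "fin_code c =
    (is_triple c \<^bold>\<and>
     AllN (V 0 \<^bold>< up 1 c \<^bold>\<and> is_triple (V 0) \<^bold>\<longrightarrow> \<^bold>\<not> AllN (V 0 \<^bold>\<epsilon> V 1 \<^bold>\<longleftrightarrow> V 0 \<^bold>\<epsilon> up 2 c)))"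

text \<open>There is a finite bijection between the numbers below \<open>n\<close> and the set represented by \<open>c\<close>.\<close>

definition fin_card :: "tm \<Rightarrow> tm \<Rightarrow> fm" where
  "fin_card c n =
    ExN (
      AllN (V 0 \<^bold>\<epsilon> V 1 \<^bold>\<longrightarrow>
        ExN (ExN (V 1 \<^bold>< up 4 n \<^bold>\<and> V 0 \<^bold>\<epsilon> up 4 c \<^bold>\<and> V 2 \<^bold>= pair (V 1) (V 0)))) \<^bold>\<and>
      AllN (V 0 \<^bold>< up 2 n \<^bold>\<longrightarrow> ExN (pair (V 1) (V 0) \<^bold>\<epsilon> V 2)) \<^bold>\<and>
      AllN (AllN (AllN (
        pair (V 2) (V 1) \<^bold>\<epsilon> V 3 \<^bold>\<and> pair (V 2) (V 0) \<^bold>\<epsilon> V 3 \<^bold>\<longrightarrow> V 1 \<^bold>= V 0))) \<^bold>\<and>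
      AllN (V 0 \<^bold>\<epsilon> up 2 c \<^bold>\<longrightarrow> ExN (pair (V 0) (V 1) \<^bold>\<epsilon> V 2)) \<^bold>\<and>
      AllN (AllN (AllN (
        pair (V 2) (V 0) \<^bold>\<epsilon> V 3 \<^bold>\<and> pair (V 1) (V 0) \<^bold>\<epsilon> V 3 \<^bold>\<longrightarrow> V 2 \<^bold>= V 1))))"


section \<open>The principle for exactly large sets\<close>

definition exactly_large :: "tm \<Rightarrow> fm" where
  "exactly_large c =
    (fin_code c \<^bold>\<and>
     ExN (V 0 \<^bold>\<epsilon> up 1 c \<^bold>\<and> AllN (V 0 \<^bold>\<epsilon> up 2 c \<^bold>\<longrightarrow> \<^bold>\<not> V 0 \<^bold>< V 1) \<^bold>\<and>
          fin_card (up 1 c) (V 0 \<^bold>+ One)))"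

definition excl_omega_subset :: "tm \<Rightarrow> nat \<Rightarrow> fm" where
  "excl_omega_subset c X = (exactly_large c \<^bold>\<and> AllN (V 0 \<^bold>\<epsilon> up 1 c \<^bold>\<longrightarrow> V 0 \<^bold>\<in> X))"

text \<open>\<open>C\<close> is, as a set of pairs, a function from the exactly large sets to \<open>{0, 1}\<close>.\<close>

definition coloring :: "nat \<Rightarrow> fm" where
  "coloring C =
    (AllN (V 0 \<^bold>\<in> C \<^bold>\<longrightarrow>
       ExN (ExN (exactly_large (V 1) \<^bold>\<and> V 0 \<^bold>< One \<^bold>+ One \<^bold>\<and> V 2 \<^bold>= pair (V 1) (V 0)))) \<^bold>\<and>
     AllN (exactly_large (V 0) \<^bold>\<longrightarrow> ExN (pair (V 1) (V 0) \<^bold>\<in> C)) \<^bold>\<and>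
     AllN (AllN (AllN (
       pair (V 2) (V 1) \<^bold>\<in> C \<^bold>\<and> pair (V 2) (V 0) \<^bold>\<in> C \<^bold>\<longrightarrow> V 1 \<^bold>= V 0))))"

definition infinite_fm :: "nat \<Rightarrow> fm" where
  "infinite_fm X = AllN (ExN (V 1 \<^bold>< V 0 \<^bold>\<and> V 0 \<^bold>\<in> X))"

definition RT_excl_omega :: fm where
  "RT_excl_omega =
    AllS (infinite_fm 0 \<^bold>\<longrightarrow>
      AllS (coloring 0 \<^bold>\<longrightarrow>
        ExS (infinite_fm 0 \<^bold>\<and>
             AllN (V 0 \<^bold>\<in> 0 \<^bold>\<longrightarrow> V 0 \<^bold>\<in> 2) \<^bold>\<and>
             ExN (AllN (excl_omega_subset (V 0) 0 \<^bold>\<longrightarrow> pair (V 0) (V 1) \<^bold>\<in> 1)))))"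


section \<open>Turing jumps\<close>

text \<open>
  Oracle computations are those of register machines with an oracle. A program is a finite set \<open>e\<close> of
  instructions, at most one for each label \<open>p\<close>:
  \<^item> \<open>(p, (0, (r, q)))\<close>: increment register \<open>r\<close> and go to \<open>q\<close>;
  \<^item> \<open>(p, (1, (r, (q, q'))))\<close>: if register \<open>r\<close> is positive, decrement it and go to \<open>q\<close>, else go to \<open>q'\<close>;
  \<^item> \<open>(p, (2, (r, (q, q'))))\<close>: if the content of register \<open>r\<close> is in the oracle go to \<open>q\<close>, else go to \<open>q'\<close>.

  The machine starts at label 0 with its input in register 0 and all other registers 0, and it halts
  on reaching a label without instruction. Numbers that do not represent a functional set of
  instructions are indices of the nowhere defined function.

  A register state is a finite set \<open>d\<close> of pairs (register, content); registers not mentioned in \<open>d\<close>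
  contain 0.
\<close>

definition program :: "tm \<Rightarrow> fm" where
  "program e =
    AllN (AllN (AllN (
      pair (V 2) (V 1) \<^bold>\<epsilon> up 3 e \<^bold>\<and> pair (V 2) (V 0) \<^bold>\<epsilon> up 3 e \<^bold>\<longrightarrow> V 1 \<^bold>= V 0)))"

definition content :: "tm \<Rightarrow> tm \<Rightarrow> tm \<Rightarrow> fm" where
  "content d r x =
    (pair r x \<^bold>\<epsilon> d \<^bold>\<or> x \<^bold>= Zero \<^bold>\<and> \<^bold>\<not> ExN (pair (up 1 r) (V 0) \<^bold>\<epsilon> up 1 d))"

definition initial :: "tm \<Rightarrow> tm \<Rightarrow> fm" where
  "initial d x =
    AllN (AllN (content (up 2 d) (V 1) (V 0) \<^bold>\<longleftrightarrow>
      V 1 \<^bold>= Zero \<^bold>\<and> V 0 \<^bold>= up 2 x \<^bold>\<or> \<^bold>\<not> V 1 \<^bold>= Zero \<^bold>\<and> V 0 \<^bold>= Zero))"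

text \<open>\<open>d'\<close> arises from \<open>d\<close> by setting register \<open>r\<close> to \<open>x\<close>.\<close>

definition update :: "tm \<Rightarrow> tm \<Rightarrow> tm \<Rightarrow> tm \<Rightarrow> fm" where
  "update d r x d' =
    AllN (AllN (content (up 2 d') (V 1) (V 0) \<^bold>\<longleftrightarrow>
      V 1 \<^bold>= up 2 r \<^bold>\<and> V 0 \<^bold>= up 2 x \<^bold>\<or>
      \<^bold>\<not> V 1 \<^bold>= up 2 r \<^bold>\<and> content (up 2 d) (V 1) (V 0)))"

text \<open>
  One step of \<open>e\<close> with oracle \<open>X\<close> leads from label \<open>p\<close> and registers \<open>d\<close> to label \<open>p'\<close> and registers
  \<open>d'\<close>. In the outer scope \<open>V 1\<close> is the register acted upon and \<open>V 0\<close> its content.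
\<close>

definition step :: "nat \<Rightarrow> tm \<Rightarrow> tm \<Rightarrow> tm \<Rightarrow> tm \<Rightarrow> tm \<Rightarrow> fm" where
  "step X e p d p' d' =
    ExN (ExN (content (up 2 d) (V 1) (V 0) \<^bold>\<and>
      (pair (up 2 p) (pair Zero (pair (V 1) (up 2 p'))) \<^bold>\<epsilon> up 2 e \<^bold>\<and>
         update (up 2 d) (V 1) (V 0 \<^bold>+ One) (up 2 d') \<^bold>\<or>
       ExN (pair (up 3 p) (pair One (pair (V 2) (pair (up 3 p') (V 0)))) \<^bold>\<epsilon> up 3 e) \<^bold>\<and>
         ExN (V 1 \<^bold>= V 0 \<^bold>+ One \<^bold>\<and> update (up 3 d) (V 2) (V 0) (up 3 d')) \<^bold>\<or>
       ExN (pair (up 3 p) (pair One (pair (V 2) (pair (V 0) (up 3 p')))) \<^bold>\<epsilon> up 3 e) \<^bold>\<and>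
         V 0 \<^bold>= Zero \<^bold>\<and> up 2 d' \<^bold>= up 2 d \<^bold>\<or>
       ExN (pair (up 3 p) (pair (One \<^bold>+ One) (pair (V 2) (pair (up 3 p') (V 0)))) \<^bold>\<epsilon> up 3 e) \<^bold>\<and>
         V 0 \<^bold>\<in> X \<^bold>\<and> up 2 d' \<^bold>= up 2 d \<^bold>\<or>
       ExN (pair (up 3 p) (pair (One \<^bold>+ One) (pair (V 2) (pair (V 0) (up 3 p')))) \<^bold>\<epsilon> up 3 e) \<^bold>\<and>
         \<^bold>\<not> V 0 \<^bold>\<in> X \<^bold>\<and> up 2 d' \<^bold>= up 2 d)))"

text \<open>
  \<open>{e}\<^sup>X(x)\<close> converges: there are a time \<open>t\<close> (\<open>V 0\<close>) and a finite history \<open>h\<close> (\<open>V 1\<close>), a function from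
  times to pairs (label, registers), which is a halting computation.
\<close>

definition halts :: "nat \<Rightarrow> tm \<Rightarrow> tm \<Rightarrow> fm" where
  "halts X e x =
    (program e \<^bold>\<and> ExN (ExN (
      AllN (AllN (AllN (
        pair (V 2) (V 1) \<^bold>\<epsilon> V 4 \<^bold>\<and> pair (V 2) (V 0) \<^bold>\<epsilon> V 4 \<^bold>\<longrightarrow> V 1 \<^bold>= V 0))) \<^bold>\<and>
      ExN (pair Zero (pair Zero (V 0)) \<^bold>\<epsilon> V 2 \<^bold>\<and> initial (V 0) (up 3 x)) \<^bold>\<and>
      AllN (V 0 \<^bold>< V 1 \<^bold>\<longrightarrow> ExN (ExN (ExN (ExN (
        pair (V 4) (pair (V 3) (V 2)) \<^bold>\<epsilon> V 6 \<^bold>\<and>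
        pair (V 4 \<^bold>+ One) (pair (V 1) (V 0)) \<^bold>\<epsilon> V 6 \<^bold>\<and>
        step X (up 7 e) (V 3) (V 2) (V 1) (V 0)))))) \<^bold>\<and>
      ExN (ExN (pair (V 2) (pair (V 1) (V 0)) \<^bold>\<epsilon> V 3 \<^bold>\<and>
        \<^bold>\<not> ExN (pair (V 2) (V 0) \<^bold>\<epsilon> up 5 e))))))"

text \<open>\<open>Y = X'\<close>\<close>

definition jump :: "nat \<Rightarrow> nat \<Rightarrow> fm" where
  "jump X Y = AllN (V 0 \<^bold>\<in> Y \<^bold>\<longleftrightarrow> halts X (V 0) (V 0))"

text \<open>\<open>A\<close> is the \<open>i\<close>-th projection \<open>{j. (i, j) \<in> Y}\<close> of \<open>Y\<close>.\<close>

definition projection :: "nat \<Rightarrow> tm \<Rightarrow> nat \<Rightarrow> fm" where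
  "projection Y i A = AllN (V 0 \<^bold>\<in> A \<^bold>\<longleftrightarrow> pair (up 1 i) (V 0) \<^bold>\<in> Y)"

text \<open>
  \<open>A = X\<^sup>(\<^sup>n\<^sup>)\<close>, for a possibly nonstandard \<open>n\<close>: some \<open>Z\<close> has projections \<open>Z\<^sub>0 = X\<close>, \<open>Z\<^sub>i\<^sub>+\<^sub>1 = (Z\<^sub>i)'\<close> for
  \<open>i < n\<close>, and \<open>Z\<^sub>n = A\<close>.
\<close>

definition iter_jump :: "nat \<Rightarrow> tm \<Rightarrow> nat \<Rightarrow> fm" where
  "iter_jump X n A =
    ExS (projection 0 Zero (Suc X) \<^bold>\<and>
      AllN (V 0 \<^bold>< up 1 n \<^bold>\<longrightarrow>
        ExS (ExS (projection 2 (V 0) 1 \<^bold>\<and> projection 2 (V 0 \<^bold>+ One) 0 \<^bold>\<and> jump 1 0))) \<^bold>\<and>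
      projection 0 n (Suc A))"

text \<open>\<open>Y = X\<^sup>(\<^sup>\<omega>\<^sup>)\<close>\<close>

definition omega_jump :: "nat \<Rightarrow> nat \<Rightarrow> fm" where
  "omega_jump X Y =
    AllN (ExS (projection (Suc Y) (V 0) 0 \<^bold>\<and> iter_jump (Suc X) (V 0) 0))"

definition omega_jumps_exist :: fm where
  "omega_jumps_exist = AllS (ExS (omega_jump 1 0))"

section \<open>The sentences read in a structure\<close>

text \<open>
  As a check on the de Bruijn indices, the axiom schemes and the formulas above are shown
  to express the following over a structure.
\<close>

lemma up_0 [simp]: "up 0 t = t"
  by (induction t) (simp_all add: up_def)

lemma eval_up [simp]:
  "eval_tm M (case_nat x v) (up (Suc k) t) = eval_tm M v (up k t)"
  "eval_tm M (case_nat x v) (up (numeral n) t) = eval_tm M v (up (pred_numeral n) t)"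
  by (induction t) (simp_all add: up_def numeral_eq_Suc)

lemma eval_up_1 [simp]: "eval_tm M (case_nat x v) (up 1 t) = eval_tm M v t"
  using eval_up(1)[of M x v 0 t] by simp

lemma eval_subst_tm: "eval_tm M v (subst_tm f t) = eval_tm M (\<lambda>i. eval_tm M v (f i)) t"
  by (induction t) simp_all

lemma sat_substN: "sat M v w (substN f p) \<longleftrightarrow> sat M (\<lambda>i. eval_tm M v (f i)) w p"
proof (induction p arbitrary: f v w)
  case (AllN p)
  have "(\<lambda>i. eval_tm M (case_nat x v) (case_nat (V 0) (\<lambda>i. up 1 (f i)) i)) =
      case_nat x (\<lambda>i. eval_tm M v (f i))" for x
    by (rule ext) (simp split: nat.split del: One_nat_def)
  then show ?case by (simp only: substN.simps sat.simps AllN)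
next
  case (ExN p)
  have "(\<lambda>i. eval_tm M (case_nat x v) (case_nat (V 0) (\<lambda>i. up 1 (f i)) i)) =
      case_nat x (\<lambda>i. eval_tm M v (f i))" for x
    by (rule ext) (simp split: nat.split del: One_nat_def)
  then show ?case by (simp only: substN.simps sat.simps ExN)
qed (simp_all add: eval_subst_tm)

lemma sat_renameS: "sat M v w (renameS g p) \<longleftrightarrow> sat M v (\<lambda>i. w (g i)) p"
proof (induction p arbitrary: g v w)
  case (AllS p)
  have "(\<lambda>i. case_nat X w (case_nat 0 (\<lambda>i. Suc (g i)) i)) = case_nat X (\<lambda>i. w (g i))" for X
    by (rule ext) (simp split: nat.split)
  then show ?case by (simp only: renameS.simps sat.simps AllS)
next
  case (ExS p)
  have "(\<lambda>i. case_nat X w (case_nat 0 (\<lambda>i. Suc (g i)) i)) = case_nat X (\<lambda>i. w (g i))" for X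
    by (rule ext) (simp split: nat.split)
  then show ?case by (simp only: renameS.simps sat.simps ExS)
qed simp_all

lemma sat_induction_axiom:
  "sat M v w (induction_axiom p) \<longleftrightarrow>
    (sat M (case_nat (l2_struct.zero M) v) w p \<and>
     (\<forall>x. sat M (case_nat x v) w p \<longrightarrow>
        sat M (case_nat (l2_struct.add M x (l2_struct.one M)) v) w p) \<longrightarrow>
     (\<forall>x. sat M (case_nat x v) w p))"
proof -
  have "(\<lambda>i. eval_tm M v (case_nat Zero V i)) = case_nat (l2_struct.zero M) v"
    by (rule ext) (simp split: nat.split)
  moreover have
    "(\<lambda>i. eval_tm M (case_nat x v) (case_nat (V 0 \<^bold>+ One) (\<lambda>i. V (Suc i)) i)) =
      case_nat (l2_struct.add M x (l2_struct.one M)) v" for x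
    by (rule ext) (simp split: nat.split)
  ultimately show ?thesis
    by (simp add: induction_axiom_def sat_substN)
qed

lemma sat_comprehension_axiom:
  "sat M v w (comprehension_axiom p q) \<longleftrightarrow>
    ((\<forall>x. sat M (case_nat x v) w p \<longleftrightarrow> sat M (case_nat x v) w q) \<longrightarrow>
     (\<exists>X\<in>l2_struct.sets M. \<forall>x. x \<in> X \<longleftrightarrow> sat M (case_nat x v) w p))"
  by (simp add: comprehension_axiom_def sat_renameS)

context
  fixes M :: "'a l2_struct"
begin

private abbreviation zero' ("\<zero>") where "\<zero> \<equiv> l2_struct.zero M"
private abbreviation one' ("\<one>") where "\<one> \<equiv> l2_struct.one M"
private abbreviation plus' (infixl "\<oplus>" 65) where "x \<oplus> y \<equiv> l2_struct.add M x y"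
private abbreviation times' (infixl "\<otimes>" 70) where "x \<otimes> y \<equiv> l2_struct.mult M x y"
private abbreviation less' (infix "\<prec>" 50) where "x \<prec> y \<equiv> l2_struct.less M x y"
private abbreviation S where "S \<equiv> l2_struct.sets M"

definition pair_in :: "'a \<Rightarrow> 'a \<Rightarrow> 'a" where
  "pair_in x y = (x \<oplus> y) \<otimes> (x \<oplus> y) \<oplus> x"

private abbreviation pair' ("\<langle>_,/ _\<rangle>") where "\<langle>x, y\<rangle> \<equiv> pair_in x y"

lemma eval_pair [simp]: "eval_tm M v (pair s t) = \<langle>eval_tm M v s, eval_tm M v t\<rangle>"
  by (simp add: pair_def pair_in_def)

definition fin_set_in :: "'a \<Rightarrow> 'a set" where
  "fin_set_in c =
    {i. \<exists>k m n. c = \<langle>\<langle>k, m\<rangle>, n\<rangle> \<and> i \<prec> k \<and> (\<exists>q. n = (m \<otimes> (i \<oplus> \<one>) \<oplus> \<one>) \<otimes> q)}"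

private abbreviation D where "D \<equiv> fin_set_in"

lemma sat_in_fin [simp]: "sat M v w (i \<^bold>\<epsilon> c) \<longleftrightarrow> eval_tm M v i \<in> D (eval_tm M v c)"
  by (simp add: in_fin_def fin_set_in_def)

definition is_triple_in :: "'a \<Rightarrow> bool" where
  "is_triple_in c \<longleftrightarrow> (\<exists>k m n. c = \<langle>\<langle>k, m\<rangle>, n\<rangle>)"

lemma sat_is_triple [simp]: "sat M v w (is_triple c) \<longleftrightarrow> is_triple_in (eval_tm M v c)"
  by (simp add: is_triple_def is_triple_in_def)

definition fin_code_in :: "'a \<Rightarrow> bool" where
  "fin_code_in c \<longleftrightarrow> is_triple_in c \<and> (\<forall>d. d \<prec> c \<and> is_triple_in d \<longrightarrow> D d \<noteq> D c)"

lemma sat_fin_code [simp]: "sat M v w (fin_code c) \<longleftrightarrow> fin_code_in (eval_tm M v c)"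
  by (simp add: fin_code_def fin_code_in_def set_eq_iff)

definition fin_card_in :: "'a \<Rightarrow> 'a \<Rightarrow> bool" where
  "fin_card_in c n \<longleftrightarrow>
    (\<exists>f. (\<forall>p\<in>D f. \<exists>i j. i \<prec> n \<and> j \<in> D c \<and> p = \<langle>i, j\<rangle>) \<and>
         (\<forall>i. i \<prec> n \<longrightarrow> (\<exists>j. \<langle>i, j\<rangle> \<in> D f)) \<and>
         (\<forall>i j j'. \<langle>i, j\<rangle> \<in> D f \<and> \<langle>i, j'\<rangle> \<in> D f \<longrightarrow> j = j') \<and>
         (\<forall>j\<in>D c. \<exists>i. \<langle>i, j\<rangle> \<in> D f) \<and>
         (\<forall>i i' j. \<langle>i, j\<rangle> \<in> D f \<and> \<langle>i', j\<rangle> \<in> D f \<longrightarrow> i = i'))"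

lemma sat_fin_card [simp]:
  "sat M v w (fin_card c n) \<longleftrightarrow> fin_card_in (eval_tm M v c) (eval_tm M v n)"
  by (simp add: fin_card_def fin_card_in_def Ball_def)

definition exactly_large_in :: "'a \<Rightarrow> bool" where
  "exactly_large_in c \<longleftrightarrow>
    fin_code_in c \<and> (\<exists>m\<in>D c. (\<forall>i\<in>D c. \<not> i \<prec> m) \<and> fin_card_in c (m \<oplus> \<one>))"

lemma sat_exactly_large [simp]:
  "sat M v w (exactly_large c) \<longleftrightarrow> exactly_large_in (eval_tm M v c)"
  by (simp add: exactly_large_def exactly_large_in_def Ball_def Bex_def)

lemma sat_excl_omega_subset [simp]:
  "sat M v w (excl_omega_subset c X) \<longleftrightarrow>
    exactly_large_in (eval_tm M v c) \<and> D (eval_tm M v c) \<subseteq> w X"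
  by (auto simp add: excl_omega_subset_def)

definition coloring_in :: "'a set \<Rightarrow> bool" where
  "coloring_in C \<longleftrightarrow>
    (\<forall>p\<in>C. \<exists>c x. exactly_large_in c \<and> x \<prec> \<one> \<oplus> \<one> \<and> p = \<langle>c, x\<rangle>) \<and>
    (\<forall>c. exactly_large_in c \<longrightarrow> (\<exists>x. \<langle>c, x\<rangle> \<in> C)) \<and>
    (\<forall>c x y. \<langle>c, x\<rangle> \<in> C \<and> \<langle>c, y\<rangle> \<in> C \<longrightarrow> x = y)"

lemma sat_coloring [simp]: "sat M v w (coloring C) \<longleftrightarrow> coloring_in (w C)"
  by (simp add: coloring_def coloring_in_def Ball_def)

definition infinite_in :: "'a set \<Rightarrow> bool" where
  "infinite_in X \<longleftrightarrow> (\<forall>m. \<exists>n\<in>X. m \<prec> n)"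

lemma sat_infinite_fm [simp]: "sat M v w (infinite_fm X) \<longleftrightarrow> infinite_in (w X)"
  by (auto simp add: infinite_fm_def infinite_in_def)

lemma sat_RT_excl_omega:
  "sat M v w RT_excl_omega \<longleftrightarrow>
    (\<forall>N\<in>S. infinite_in N \<longrightarrow> (\<forall>C\<in>S. coloring_in C \<longrightarrow>
      (\<exists>L\<in>S. infinite_in L \<and> L \<subseteq> N \<and>
        (\<exists>x. \<forall>c. exactly_large_in c \<and> D c \<subseteq> L \<longrightarrow> \<langle>c, x\<rangle> \<in> C))))"
  by (simp add: RT_excl_omega_def subset_eq Ball_def)

definition program_in :: "'a \<Rightarrow> bool" where
  "program_in e \<longleftrightarrow> (\<forall>p i j. \<langle>p, i\<rangle> \<in> D e \<and> \<langle>p, j\<rangle> \<in> D e \<longrightarrow> i = j)"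

lemma sat_program [simp]: "sat M v w (program e) \<longleftrightarrow> program_in (eval_tm M v e)"
  by (simp add: program_def program_in_def)

definition content_in :: "'a \<Rightarrow> 'a \<Rightarrow> 'a \<Rightarrow> bool" where
  "content_in d r x \<longleftrightarrow> \<langle>r, x\<rangle> \<in> D d \<or> x = \<zero> \<and> (\<nexists>y. \<langle>r, y\<rangle> \<in> D d)"

lemma sat_content [simp]:
  "sat M v w (content d r x) \<longleftrightarrow> content_in (eval_tm M v d) (eval_tm M v r) (eval_tm M v x)"
  by (simp add: content_def content_in_def)

definition initial_in :: "'a \<Rightarrow> 'a \<Rightarrow> bool" where
  "initial_in d x \<longleftrightarrow> (\<forall>r y. content_in d r y \<longleftrightarrow> y = (if r = \<zero> then x else \<zero>))"

lemma sat_initial [simp]: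
  "sat M v w (initial d x) \<longleftrightarrow> initial_in (eval_tm M v d) (eval_tm M v x)"
  by (auto simp add: initial_def initial_in_def)

definition update_in :: "'a \<Rightarrow> 'a \<Rightarrow> 'a \<Rightarrow> 'a \<Rightarrow> bool" where
  "update_in d r x d' \<longleftrightarrow>
    (\<forall>s y. content_in d' s y \<longleftrightarrow> (if s = r then y = x else content_in d s y))"

lemma sat_update [simp]:
  "sat M v w (update d r x d') \<longleftrightarrow>
    update_in (eval_tm M v d) (eval_tm M v r) (eval_tm M v x) (eval_tm M v d')"
  by (auto simp add: update_def update_in_def)

definition step_in :: "'a set \<Rightarrow> 'a \<Rightarrow> 'a \<Rightarrow> 'a \<Rightarrow> 'a \<Rightarrow> 'a \<Rightarrow> bool" where
  "step_in X e p d p' d' \<longleftrightarrow>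
    (\<exists>r x. content_in d r x \<and>
      (\<langle>p, \<langle>\<zero>, \<langle>r, p'\<rangle>\<rangle>\<rangle> \<in> D e \<and> update_in d r (x \<oplus> \<one>) d' \<or>
       (\<exists>q. \<langle>p, \<langle>\<one>, \<langle>r, \<langle>p', q\<rangle>\<rangle>\<rangle>\<rangle> \<in> D e) \<and> (\<exists>y. x = y \<oplus> \<one> \<and> update_in d r y d') \<or>
       (\<exists>q. \<langle>p, \<langle>\<one>, \<langle>r, \<langle>q, p'\<rangle>\<rangle>\<rangle>\<rangle> \<in> D e) \<and> x = \<zero> \<and> d' = d \<or>
       (\<exists>q. \<langle>p, \<langle>\<one> \<oplus> \<one>, \<langle>r, \<langle>p', q\<rangle>\<rangle>\<rangle>\<rangle> \<in> D e) \<and> x \<in> X \<and> d' = d \<or>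
       (\<exists>q. \<langle>p, \<langle>\<one> \<oplus> \<one>, \<langle>r, \<langle>q, p'\<rangle>\<rangle>\<rangle>\<rangle> \<in> D e) \<and> x \<notin> X \<and> d' = d))"

lemma sat_step [simp]:
  "sat M v w (step X e p d p' d') \<longleftrightarrow>
    step_in (w X) (eval_tm M v e) (eval_tm M v p) (eval_tm M v d) (eval_tm M v p') (eval_tm M v d')"
  by (simp add: step_def step_in_def)

definition halts_in :: "'a set \<Rightarrow> 'a \<Rightarrow> 'a \<Rightarrow> bool" where
  "halts_in X e x \<longleftrightarrow> program_in e \<and>
    (\<exists>h t. (\<forall>s a b. \<langle>s, a\<rangle> \<in> D h \<and> \<langle>s, b\<rangle> \<in> D h \<longrightarrow> a = b) \<and>
      (\<exists>d. \<langle>\<zero>, \<langle>\<zero>, d\<rangle>\<rangle> \<in> D h \<and> initial_in d x) \<and>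
      (\<forall>s. s \<prec> t \<longrightarrow> (\<exists>p d p' d'. \<langle>s, \<langle>p, d\<rangle>\<rangle> \<in> D h \<and> \<langle>s \<oplus> \<one>, \<langle>p', d'\<rangle>\<rangle> \<in> D h \<and>
        step_in X e p d p' d')) \<and>
      (\<exists>p d. \<langle>t, \<langle>p, d\<rangle>\<rangle> \<in> D h \<and> (\<nexists>i. \<langle>p, i\<rangle> \<in> D e)))"

lemma sat_halts [simp]:
  "sat M v w (halts X e x) \<longleftrightarrow> halts_in (w X) (eval_tm M v e) (eval_tm M v x)"
  by (simp add: halts_def halts_in_def)

definition jump_in :: "'a set \<Rightarrow> 'a set" where
  "jump_in X = {e. halts_in X e e}"

lemma sat_jump [simp]: "sat M v w (jump X Y) \<longleftrightarrow> w Y = jump_in (w X)"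
  by (auto simp add: jump_def jump_in_def)

definition projection_in :: "'a set \<Rightarrow> 'a \<Rightarrow> 'a set" where
  "projection_in Y i = {j. \<langle>i, j\<rangle> \<in> Y}"

lemma sat_projection [simp]:
  "sat M v w (projection Y i A) \<longleftrightarrow> w A = projection_in (w Y) (eval_tm M v i)"
  by (auto simp add: projection_def projection_in_def)

definition iter_jump_in :: "'a set \<Rightarrow> 'a \<Rightarrow> 'a set \<Rightarrow> bool" where
  "iter_jump_in X n A \<longleftrightarrow>
    (\<exists>Z\<in>S. X = projection_in Z \<zero> \<and>
      (\<forall>i. i \<prec> n \<longrightarrow> (\<exists>B\<in>S. \<exists>B'\<in>S. B = projection_in Z i \<and> B' = projection_in Z (i \<oplus> \<one>) \<and>
        B' = jump_in B)) \<and>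
      A = projection_in Z n)"

lemma sat_iter_jump [simp]:
  "sat M v w (iter_jump X n A) \<longleftrightarrow> iter_jump_in (w X) (eval_tm M v n) (w A)"
  by (simp add: iter_jump_def iter_jump_in_def)

lemma sat_omega_jumps_exist:
  "sat M v w omega_jumps_exist \<longleftrightarrow>
    (\<forall>X\<in>S. \<exists>Y\<in>S. \<forall>n. \<exists>A\<in>S. A = projection_in Y n \<and> iter_jump_in X n A)"
  by (simp add: omega_jumps_exist_def omega_jump_def)

end

end

theory Submission
  imports Defs
begin

text \<open>
  The jump is obtained from a colouring that compares approximations. For an increasing sequence
  \<open>s\<^sub>1 < \<dots> < s\<^sub>k\<close> let \<open>J(s\<^sub>1, \<dots>, s\<^sub>k)\<close> be the set of all programs that halt with oracle
  \<open>J(s\<^sub>2, \<dots>, s\<^sub>k)\<close> and a history below \<open>s\<^sub>1\<close>, starting from \<open>J() = X\<close>. An exactly large set with minimum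
  \<open>a\<close> consists of \<open>a\<close>, two blocks of length \<open>n = a div 2\<close> and possibly one more element; its colour
  says whether for all \<open>k \<le> n\<close> the first \<open>k\<close> elements of both blocks give the same \<open>J\<close> below \<open>a\<close>. As
  there are only boundedly many possibilities below \<open>a\<close>, a homogeneous set \<open>L\<close> has the positive colour.
  Hence below \<open>a \<in> L\<close> the value of \<open>J\<close> does not depend on the block of length \<open>k \<le> a div 2\<close> chosen in \<open>L\<close>
  above \<open>a\<close>, and these common values form sets \<open>Y\<^sub>k\<close>. A computation with history \<open>h\<close> only asks the oracle
  about numbers below \<open>h\<close>, so \<open>Y\<^sub>k\<^sub>+\<^sub>1\<close> is the jump of \<open>Y\<^sub>k\<close>, for nonstandard \<open>k\<close> as well and without
  any induction along the jumps.

  All of this takes place over arithmetical comprehension, which follows from a simpler colouring: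
  a set \<open>a < b < \<dots>\<close> is positive if none of its elements bounds a witness of a \<open>\<Sigma>\<^sub>1\<close> fact about a
  number below \<open>a\<close> that has no witness below \<open>b\<close>.
\<close>

section \<open>Definability by bounded formulas\<close>

text \<open>At the outset only Sigma1 induction and Delta1 comprehension are available, and codes,
  cardinalities and lengths of blocks may be nonstandard. A colouring is therefore a set only once
  exact largeness is known to be Delta1, which rests on the existence and uniqueness of
  cardinalities of coded sets. The approximations J are defined by recursion and minimisation, so
  they can be used in a colouring only after arithmetical comprehension; this forces two colourings
  instead of one.

  The length a div 2 is the greatest for which a and two equal blocks fit into a + 1 elements. The
  negative colour is refuted by a pigeonhole argument inside the model: codes of subsets of a fixed
  initial segment have a uniform bound, so of the blocks starting further and further out in L two
  disjoint ones yield the same approximations. Colours compare disjoint blocks only; two arbitrary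
  blocks are both compared with a third one beyond them. All levels of the hierarchy come from one
  arithmetical formula in (k, x), which is why a nonstandard k causes no difficulty.\<close>

lemma subst_tm_up: "subst_tm (case_nat s (\<lambda>i. up 1 (f i))) (up 1 t) = up 1 (subst_tm f t)"
  by (induction t) (simp_all add: up_def)

lemma bounded_fm_substN: "bounded_fm p \<Longrightarrow> bounded_fm (substN f p)"
proof (induction arbitrary: f rule: bounded_fm.induct)
qed (simp_all add: bounded_fm.intros subst_tm_up del: One_nat_def)

lemma bounded_fm_renameS: "bounded_fm p \<Longrightarrow> bounded_fm (renameS g p)"
  by (induction rule: bounded_fm.induct) (simp_all add: bounded_fm.intros del: One_nat_def)

locale rca0 =
  fixes M :: "'a l2_struct"
  assumes nonempty: "l2_structure M"
    and axioms: "p \<in> RCA0 \<Longrightarrow> M \<Turnstile> p"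
begin

abbreviation zero' ("\<zero>") where "\<zero> \<equiv> l2_struct.zero M"
abbreviation one' ("\<one>") where "\<one> \<equiv> l2_struct.one M"
abbreviation plus' (infixl "\<oplus>" 65) where "x \<oplus> y \<equiv> l2_struct.add M x y"
abbreviation times' (infixl "\<otimes>" 70) where "x \<otimes> y \<equiv> l2_struct.mult M x y"
abbreviation less' (infix "\<prec>" 50) where "x \<prec> y \<equiv> l2_struct.less M x y"
abbreviation S where "S \<equiv> l2_struct.sets M"
abbreviation pair' ("\<langle>_,/ _\<rangle>") where "\<langle>x, y\<rangle> \<equiv> pair_in M x y"
abbreviation D where "D \<equiv> fin_set_in M"

text \<open>
  A predicate on environments is definable if a bounded formula defines it once each of its free
  number variables is read either as a parameter or as a position of the environment. Set
  parameters are implicit.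
\<close>

definition val :: "(nat \<Rightarrow> 'a + nat) \<Rightarrow> (nat \<Rightarrow> 'a) \<Rightarrow> nat \<Rightarrow> 'a" where
  "val f v i = case_sum (\<lambda>c. c) v (f i)"

definition term_definable :: "((nat \<Rightarrow> 'a) \<Rightarrow> 'a) \<Rightarrow> bool" where
  "term_definable t \<longleftrightarrow> (\<exists>s f. \<forall>v. t v = eval_tm M (val f v) s)"

definition definable :: "((nat \<Rightarrow> 'a) \<Rightarrow> bool) \<Rightarrow> bool" where
  "definable P \<longleftrightarrow> (\<exists>p f w. bounded_fm p \<and> range w \<subseteq> S \<and> (\<forall>v. P v \<longleftrightarrow> sat M (val f v) w p))"

definition sigma1 :: "((nat \<Rightarrow> 'a) \<Rightarrow> bool) \<Rightarrow> bool" where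
  "sigma1 P \<longleftrightarrow> (\<exists>Q. definable Q \<and> (\<forall>v. P v \<longleftrightarrow> (\<exists>x. Q (case_nat x v))))"

lemma sigma1E:
  assumes "sigma1 P" obtains Q where "definable Q" "\<And>v. P v \<longleftrightarrow> (\<exists>x. Q (case_nat x v))"
  using assms unfolding sigma1_def by metis

lemma sigma1I: assumes "definable Q" "\<And>v. P v \<longleftrightarrow> (\<exists>x. Q (case_nat x v))" shows "sigma1 P"
  unfolding sigma1_def by (intro exI[of _ Q] conjI allI assms)

lemma definableE:
  assumes "definable P" obtains p f w where "bounded_fm p" "range w \<subseteq> S" "\<And>v. P v \<longleftrightarrow> sat M (val f v) w p"
  using assms unfolding definable_def by metis

lemma definableI:
  assumes "bounded_fm p" "range w \<subseteq> S" "\<And>v. P v \<longleftrightarrow> sat M (val f v) w p" shows "definable P"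
  unfolding definable_def by (intro exI[of _ p] exI[of _ f] exI[of _ w] conjI allI assms)

text \<open>Two formulas come with separate readings and separate set parameters. Placing one family
  at the even and the other at the odd indices lets both be evaluated under a single reading and a
  single assignment.\<close>

definition interleave :: "(nat \<Rightarrow> 'c) \<Rightarrow> (nat \<Rightarrow> 'c) \<Rightarrow> nat \<Rightarrow> 'c" where
  "interleave f g i = (if even i then f (i div 2) else g (i div 2))"

lemma interleave_simps [simp]: "interleave f g (2 * i) = f i" "interleave f g (Suc (2 * i)) = g i"
  by (simp_all add: interleave_def)

lemma range_interleave: "range (interleave f g) \<subseteq> A \<longleftrightarrow> range f \<subseteq> A \<and> range g \<subseteq> A"
proof -
  have "range (interleave f g) = range f \<union> range g"
  proof
    show "range (interleave f g) \<subseteq> range f \<union> range g" by (auto simp: interleave_def)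
    show "range f \<union> range g \<subseteq> range (interleave f g)"
      by (auto, metis interleave_simps(1) rangeI, metis interleave_simps(2) rangeI)
  qed
  then show ?thesis by simp
qed

lemma S_ne: "\<exists>A. A \<in> S" using nonempty by (auto simp: l2_structure_def)

lemma val_interleave [simp]: "val (interleave f g) v (2 * i) = val f v i" "val (interleave f g) v (Suc (2 * i)) = val g v i"
  by (simp_all add: val_def)

lemma term_definable_merge:
  assumes "term_definable s" "term_definable t"
  obtains s' t' f where "\<And>v. s v = eval_tm M (val f v) s'" "\<And>v. t v = eval_tm M (val f v) t'"
proof -
  obtain s' f where s: "\<And>v. s v = eval_tm M (val f v) s'" using assms(1) by (auto simp: term_definable_def)
  obtain t' g where t: "\<And>v. t v = eval_tm M (val g v) t'" using assms(2) by (auto simp: term_definable_def)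
  show thesis
    by (rule that[of "interleave f g" "subst_tm (\<lambda>i. V (2 * i)) s'" "subst_tm (\<lambda>i. V (Suc (2 * i))) t'"])
      (simp_all add: s t eval_subst_tm)
qed

lemma definable_merge:
  assumes "definable P" "definable Q"
  obtains p q f w where "bounded_fm p" "bounded_fm q" "range w \<subseteq> S"
    "\<And>v. P v \<longleftrightarrow> sat M (val f v) w p" "\<And>v. Q v \<longleftrightarrow> sat M (val f v) w q"
proof -
  obtain p f w where p: "bounded_fm p" "range w \<subseteq> S" "\<And>v. P v \<longleftrightarrow> sat M (val f v) w p"
    using assms(1) by (auto simp: definable_def)
  obtain q g u where q: "bounded_fm q" "range u \<subseteq> S" "\<And>v. Q v \<longleftrightarrow> sat M (val g v) u q"
    using assms(2) by (auto simp: definable_def)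
  show thesis
    by (rule that[of "substN (\<lambda>i. V (2 * i)) (renameS (\<lambda>i. 2 * i) p)"
          "substN (\<lambda>i. V (Suc (2 * i))) (renameS (\<lambda>i. Suc (2 * i)) q)" "interleave w u" "interleave f g"])
      (use p q in \<open>simp_all add: bounded_fm_substN bounded_fm_renameS range_interleave sat_substN sat_renameS\<close>)
qed

section \<open>Closure of definability under terms, connectives and bounded quantifiers\<close>

named_theorems bounded_intros

lemma term_definable_var [bounded_intros]: "term_definable (\<lambda>v. v i)"
  unfolding term_definable_def by (rule exI[of _ "V 0"], rule exI[of _ "\<lambda>_. Inr i"]) (simp add: val_def)

lemma term_definable_const [bounded_intros]: "term_definable (\<lambda>v. c)"
  unfolding term_definable_def by (rule exI[of _ "V 0"], rule exI[of _ "\<lambda>_. Inl c"]) (simp add: val_def)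

lemma term_definable_add [bounded_intros]: assumes "term_definable s" "term_definable t" shows "term_definable (\<lambda>v. s v \<oplus> t v)"
proof -
  obtain s' t' f where "\<And>v. s v = eval_tm M (val f v) s'" "\<And>v. t v = eval_tm M (val f v) t'"
    by (rule term_definable_merge[OF assms]) (rule that)
  then show ?thesis unfolding term_definable_def by (intro exI[of _ "s' \<^bold>+ t'"] exI[of _ f]) simp
qed

lemma term_definable_mult [bounded_intros]: assumes "term_definable s" "term_definable t" shows "term_definable (\<lambda>v. s v \<otimes> t v)"
proof -
  obtain s' t' f where "\<And>v. s v = eval_tm M (val f v) s'" "\<And>v. t v = eval_tm M (val f v) t'"
    by (rule term_definable_merge[OF assms]) (rule that)
  then show ?thesis unfolding term_definable_def by (intro exI[of _ "s' \<^bold>* t'"] exI[of _ f]) simp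
qed

lemma term_definable_pair [bounded_intros]: assumes "term_definable s" "term_definable t" shows "term_definable (\<lambda>v. \<langle>s v, t v\<rangle>)"
  unfolding pair_in_def by (intro bounded_intros assms)

lemma definable_atom [bounded_intros]:
  assumes "term_definable s" "term_definable t"
  shows "definable (\<lambda>v. s v = t v)" "definable (\<lambda>v. s v \<prec> t v)"
proof -
  obtain A where A: "A \<in> S" using S_ne by blast
  obtain s' t' f where st: "\<And>v. s v = eval_tm M (val f v) s'" "\<And>v. t v = eval_tm M (val f v) t'"
    by (rule term_definable_merge[OF assms]) (rule that)
  show "definable (\<lambda>v. s v = t v)" unfolding definable_def
    by (intro exI[of _ "s' \<^bold>= t'"] exI[of _ f] exI[of _ "\<lambda>_. A"])
      (use A st in \<open>auto intro: bounded_fm.intros\<close>)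
  show "definable (\<lambda>v. s v \<prec> t v)" unfolding definable_def
    by (intro exI[of _ "s' \<^bold>< t'"] exI[of _ f] exI[of _ "\<lambda>_. A"])
      (use A st in \<open>auto intro: bounded_fm.intros\<close>)
qed

lemma definable_mem [bounded_intros]: assumes "A \<in> S" "term_definable t" shows "definable (\<lambda>v. t v \<in> A)"
proof -
  obtain t' f where "\<And>v. t v = eval_tm M (val f v) t'" using assms(2) by (auto simp: term_definable_def)
  then show ?thesis unfolding definable_def
    by (intro exI[of _ "t' \<^bold>\<in> 0"] exI[of _ f] exI[of _ "\<lambda>_. A"])
      (use assms in \<open>auto intro: bounded_fm.intros\<close>)
qed

lemma definable_not [bounded_intros]: assumes "definable P" shows "definable (\<lambda>v. \<not> P v)"
proof -
  obtain p f w where "bounded_fm p" "range w \<subseteq> S" "\<And>v. P v \<longleftrightarrow> sat M (val f v) w p"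
    using assms by (auto simp: definable_def)
  then show ?thesis unfolding definable_def
    by (intro exI[of _ "\<^bold>\<not> p"] exI[of _ f] exI[of _ w]) (auto intro: bounded_fm.intros)
qed

lemma definable_conj [bounded_intros]: assumes "definable P" "definable Q" shows "definable (\<lambda>v. P v \<and> Q v)"
proof -
  obtain p q f w where "bounded_fm p" "bounded_fm q" "range w \<subseteq> S"
    "\<And>v. P v \<longleftrightarrow> sat M (val f v) w p" "\<And>v. Q v \<longleftrightarrow> sat M (val f v) w q"
    by (rule definable_merge[OF assms]) (rule that)
  then show ?thesis unfolding definable_def
    by (intro exI[of _ "p \<^bold>\<and> q"] exI[of _ f] exI[of _ w]) (auto intro: bounded_fm.intros)
qed

lemma definable_cong: assumes "definable P" "\<And>v. Q v \<longleftrightarrow> P v" shows "definable Q"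
proof -
  have "Q = P" using assms(2) by (rule ext)
  with assms(1) show ?thesis by simp
qed

lemma sigma1_cong: assumes "sigma1 P" "\<And>v. Q v \<longleftrightarrow> P v" shows "sigma1 Q"
proof -
  have "Q = P" using assms(2) by (rule ext)
  with assms(1) show ?thesis by simp
qed

lemma definable_disj [bounded_intros]: assumes "definable P" "definable Q" shows "definable (\<lambda>v. P v \<or> Q v)"
  by (rule definable_cong[of "\<lambda>v. \<not> (\<not> P v \<and> \<not> Q v)"]) (intro bounded_intros assms, simp)

lemma definable_imp [bounded_intros]: assumes "definable P" "definable Q" shows "definable (\<lambda>v. P v \<longrightarrow> Q v)"
  by (rule definable_cong[of "\<lambda>v. \<not> P v \<or> Q v"]) (intro bounded_intros assms, simp)

lemma definable_iff [bounded_intros]: assumes "definable P" "definable Q" shows "definable (\<lambda>v. P v \<longleftrightarrow> Q v)"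
  by (rule definable_cong[of "\<lambda>v. (P v \<longrightarrow> Q v) \<and> (Q v \<longrightarrow> P v)"]) (intro bounded_intros assms, blast)

lemma definable_bool [bounded_intros]: "definable (\<lambda>v. b)"
proof -
  have "definable (\<lambda>v. \<zero> = \<zero>)" "definable (\<lambda>v. \<not> \<zero> = \<zero>)" by (intro bounded_intros definable_atom)+
  then show ?thesis by (cases b) simp_all
qed

text \<open>The reading that remains outside a number quantifier: position 0 is captured and the
  others move down. The default \<open>\<zero>\<close> for position 0 is never looked up, since
  variables read there are substituted away.\<close>

definition drop_var :: "(nat \<Rightarrow> 'a + nat) \<Rightarrow> nat \<Rightarrow> 'a + nat" where
  "drop_var f i = (case f i of Inl c \<Rightarrow> Inl c | Inr 0 \<Rightarrow> Inl \<zero> | Inr (Suc j) \<Rightarrow> Inr j)"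

lemma val_case_nat:
  "val f (case_nat x v) i = (if f i = Inr 0 then x else val (drop_var f) v i)"
  by (auto simp: val_def drop_var_def split: sum.split nat.split)

text \<open>The pattern \<open>P (v 0) (\<lambda>i. v (Suc i))\<close> mirrors a de Bruijn binder:
  the bound number is position 0 and the outer environment is shifted. The bound \<open>t\<close>
  sees the outer environment only, as \<open>bounded_fm\<close> demands.\<close>

lemma definable_bex [bounded_intros]:
  assumes "definable (\<lambda>v. P (v 0) (\<lambda>i. v (Suc i)))" "term_definable t"
  shows "definable (\<lambda>v. \<exists>x. x \<prec> t v \<and> P x v)"
proof -
  obtain p f w where p: "bounded_fm p" "range w \<subseteq> S"
    "\<And>v. P (v 0) (\<lambda>i. v (Suc i)) \<longleftrightarrow> sat M (val f v) w p"
    by (rule definableE[OF assms(1)]) (rule that)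
  obtain s g where s: "\<And>v. t v = eval_tm M (val g v) s" using assms(2) by (auto simp: term_definable_def)
  \<comment> \<open>Below the new binder the even outer variable \<open>2 * i\<close> has index
    \<open>Suc (2 * i)\<close>; the odd outer variables belong to the bound.\<close>
  define \<sigma> where "\<sigma> i = (if f i = Inr 0 then V 0 else V (Suc (2 * i)))" for i
  let ?f = "interleave (drop_var f) g"
  have P: "P x v \<longleftrightarrow> sat M (case_nat x (val ?f v)) w (substN \<sigma> p)" for x v
  proof -
    have "(\<lambda>i. eval_tm M (case_nat x (val ?f v)) (\<sigma> i)) = val f (case_nat x v)"
      by (rule ext) (simp add: \<sigma>_def val_case_nat)
    then show ?thesis using p(3)[of "case_nat x v"] by (simp add: sat_substN)
  qed
  have b: "bounded_fm (ExN (V 0 \<^bold>< up 1 (subst_tm (\<lambda>i. V (Suc (2 * i))) s) \<^bold>\<and> substN \<sigma> p))"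
    by (intro bounded_fm.intros bounded_fm_substN p)
  have "(\<exists>x. x \<prec> t v \<and> P x v) \<longleftrightarrow>
      sat M (val ?f v) w (ExN (V 0 \<^bold>< up 1 (subst_tm (\<lambda>i. V (Suc (2 * i))) s) \<^bold>\<and> substN \<sigma> p))" for v
    by (simp add: eval_subst_tm P s del: One_nat_def)
  then show ?thesis by (rule definableI[where f = "interleave (drop_var f) g", OF b p(2)])
qed

lemma definable_ball [bounded_intros]:
  assumes "definable (\<lambda>v. P (v 0) (\<lambda>i. v (Suc i)))" "term_definable t"
  shows "definable (\<lambda>v. \<forall>x. x \<prec> t v \<longrightarrow> P x v)"
  by (rule definable_cong[of "\<lambda>v. \<not> (\<exists>x. x \<prec> t v \<and> \<not> P x v)"]) (intro bounded_intros assms, blast)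

section \<open>Renaming and substitution in definable predicates\<close>

lemma definable_val: assumes "definable P" shows "definable (\<lambda>v. P (val g v))"
proof -
  obtain p f w where p: "bounded_fm p" "range w \<subseteq> S" "\<And>v. P v \<longleftrightarrow> sat M (val f v) w p"
    using assms by (auto simp: definable_def)
  define h where "h i = (case f i of Inl c \<Rightarrow> Inl c | Inr j \<Rightarrow> g j)" for i
  have "val f (val g v) = val h v" for v
    by (rule ext) (simp add: val_def h_def split: sum.split)
  with p(3) show ?thesis by (intro definableI[where f = h, OF p(1,2)]) simp
qed

lemma term_definable_val: assumes "term_definable t" shows "term_definable (\<lambda>v. t (val g v))"
proof -
  obtain p f where p: "\<And>v. t v = eval_tm M (val f v) p"
    using assms by (auto simp: term_definable_def)
  define h where "h i = (case f i of Inl c \<Rightarrow> Inl c | Inr j \<Rightarrow> g j)" for i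
  have "val f (val g v) = val h v" for v
    by (rule ext) (simp add: val_def h_def split: sum.split)
  with p show ?thesis unfolding term_definable_def by auto
qed

lemma val_Inr: "val (\<lambda>i. Inr (g i)) = (\<lambda>v i. v (g i))" by (simp add: val_def fun_eq_iff)

lemmas definable_ren = definable_val[where g = "\<lambda>i. Inr (g i)" for g, unfolded val_Inr]
lemmas term_definable_ren = term_definable_val[where g = "\<lambda>i. Inr (g i)" for g, unfolded val_Inr]

lemma definable_subst:
  assumes "definable (\<lambda>v. P (v 0) (\<lambda>i. v (Suc i)))" "term_definable t"
  shows "definable (\<lambda>v. P (t v) v)"
proof -
  obtain p f w where p: "bounded_fm p" "range w \<subseteq> S"
    "\<And>v. P (v 0) (\<lambda>i. v (Suc i)) \<longleftrightarrow> sat M (val f v) w p"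
    by (rule definableE[OF assms(1)]) (rule that)
  obtain s g where s: "\<And>v. t v = eval_tm M (val g v) s" using assms(2) by (auto simp: term_definable_def)
  define \<sigma> where "\<sigma> i = (if f i = Inr 0 then subst_tm (\<lambda>i. V (Suc (2 * i))) s else V (2 * i))" for i
  let ?f = "interleave (drop_var f) g"
  have *: "\<forall>v. P (t v) v \<longleftrightarrow> sat M (val ?f v) w (substN \<sigma> p)"
  proof
    fix v
    have "(\<lambda>i. eval_tm M (val ?f v) (\<sigma> i)) = val f (case_nat (t v) v)"
      by (rule ext) (simp add: \<sigma>_def val_case_nat eval_subst_tm s)
    then show "P (t v) v \<longleftrightarrow> sat M (val ?f v) w (substN \<sigma> p)"
      using p(3)[of "case_nat (t v) v"] by (simp add: sat_substN)
  qed
  show ?thesis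
    by (rule definableI[where f = "interleave (drop_var f) g", OF bounded_fm_substN[OF p(1)] p(2)]) (rule *[rule_format])
qed

lemma definable_subst1: assumes "definable (\<lambda>v. R (v 0))" "term_definable s" shows "definable (\<lambda>v. R (s v))"
  using definable_subst[of "\<lambda>x v. R x"] assms by simp

lemma definable_subst2:
  assumes "definable (\<lambda>v. R (v 0) (v 1))" "term_definable s" "term_definable t" shows "definable (\<lambda>v. R (s v) (t v))"
proof -
  have "definable (\<lambda>v. R (s (\<lambda>i. v (Suc i))) (v 0))"
    by (rule definable_subst[where P = "\<lambda>x v. R x (v 0)"])
      (use assms(1) term_definable_ren[OF assms(2)] in simp_all)
  from definable_subst[where P = "\<lambda>x v. R (s v) x", OF this assms(3)] show ?thesis .
qed

lemma definable_subst3: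
  assumes "definable (\<lambda>v. R (v 0) (v 1) (v 2))" "term_definable s" "term_definable t" "term_definable u"
  shows "definable (\<lambda>v. R (s v) (t v) (u v))"
proof -
  have "definable (\<lambda>v. R (s (\<lambda>i. v (Suc (Suc i)))) (v 0) (v 1))"
    by (rule definable_subst[where P = "\<lambda>x v. R x (v 0) (v 1)"])
      (use assms(1) term_definable_ren[OF assms(2)] in \<open>simp_all add: numeral_2_eq_2\<close>)
  then have "definable (\<lambda>v. R (s (\<lambda>i. v (Suc i))) (t (\<lambda>i. v (Suc i))) (v 0))"
    by (intro definable_subst[where P = "\<lambda>x v. R (s (\<lambda>i. v (Suc i))) x (v 0)"])
      (use term_definable_ren[OF assms(3)] in simp_all)
  from definable_subst[where P = "\<lambda>x v. R (s v) (t v) x", OF this assms(4)] show ?thesis .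
qed

lemma sigma1_definable: assumes "definable P" shows "sigma1 P"
proof -
  have "definable (\<lambda>v. P (\<lambda>i. v (Suc i)))" by (rule definable_ren[OF assms])
  then show ?thesis by (rule sigma1I) simp
qed

lemma sigma1_ex_definable:
  assumes "definable (\<lambda>v. P (v 0) (\<lambda>i. v (Suc i)))" shows "sigma1 (\<lambda>v. \<exists>x. P x v)"
  by (rule sigma1I[OF assms]) simp

text \<open>The axiom schemes need a genuine formula with its argument at one fixed variable,
  whereas \<open>f\<close> may read many variables as the same position. The substitution merges
  them into \<open>V 0\<close> (witness) and \<open>V 1\<close> (argument) and leaves every other
  variable as a parameter.\<close>

lemma sat_witness_argument:
  fixes f :: "nat \<Rightarrow> 'a + nat"
  obtains \<tau> u where "\<And>x y w p. sat M (case_nat y (case_nat x u)) w (substN \<tau> p) =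
    sat M (val f (case_nat y (case_nat x (\<lambda>_. \<zero>)))) w p"
proof
  let ?\<tau> = "\<lambda>i. if f i = Inr 0 then V 0 else if f i = Inr 1 then V 1 else V (Suc (Suc i))"
  let ?u = "val f (\<lambda>_. \<zero>)"
  fix x y w p
  have "(\<lambda>i. eval_tm M (case_nat y (case_nat x ?u)) (?\<tau> i)) =
      val f (case_nat y (case_nat x (\<lambda>_. \<zero>)))"
    by (rule ext) (auto simp: val_def split: sum.split nat.split)
  then show "sat M (case_nat y (case_nat x ?u)) w (substN ?\<tau> p) =
    sat M (val f (case_nat y (case_nat x (\<lambda>_. \<zero>)))) w p"
    by (simp only: sat_substN)
qed

lemma sigma1_induct:
  assumes "sigma1 (\<lambda>v. P (v 0))" "P \<zero>" "\<And>x. P x \<Longrightarrow> P (x \<oplus> \<one>)"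
  shows "P x"
proof -
  obtain Q where Q: "definable Q" "\<And>v. P (v 0) \<longleftrightarrow> (\<exists>x. Q (case_nat x v))"
    by (rule sigma1E[OF assms(1)]) (rule that)
  obtain p f w where p: "bounded_fm p" "range w \<subseteq> S" "\<And>v. Q v \<longleftrightarrow> sat M (val f v) w p"
    by (rule definableE[OF Q(1)]) (rule that)
  obtain \<tau> u where \<tau>: "\<And>x y w p. sat M (case_nat y (case_nat x u)) w (substN \<tau> p) =
    sat M (val f (case_nat y (case_nat x (\<lambda>_. \<zero>)))) w p"
    by (rule sat_witness_argument[of f]) (rule that)
  let ?p = "ExN (substN \<tau> p)"
  have P: "P x \<longleftrightarrow> sat M (case_nat x u) w ?p" for x
    using Q(2)[of "case_nat x (\<lambda>_. \<zero>)"] by (simp add: \<tau> p(3))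
  have "induction_axiom ?p \<in> RCA0"
    using p(1) by (auto simp: RCA0_def Sigma01_def bounded_fm_substN)
  from axioms[OF this] p(2) have "sat M u w (induction_axiom ?p)" by (auto simp: models_def)
  with assms(2,3) show ?thesis unfolding sat_induction_axiom P by blast
qed

lemmas definable_induct = sigma1_induct[OF sigma1_definable]

text \<open>The set and its complement are both given in Sigma1 form; negating the matrix of the
  second yields the Pi1 formula of the axiom.\<close>

lemma comprehension:
  assumes "sigma1 (\<lambda>v. P (v 0))" "sigma1 (\<lambda>v. \<not> P (v 0))"
  shows "{x. P x} \<in> S"
proof -
  obtain Q where Q: "definable Q" "\<And>v. P (v 0) \<longleftrightarrow> (\<exists>x. Q (case_nat x v))"
    by (rule sigma1E[OF assms(1)]) (rule that)
  obtain R where R: "definable R" "\<And>v. \<not> P (v 0) \<longleftrightarrow> (\<exists>x. R (case_nat x v))"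
    by (rule sigma1E[OF assms(2)]) (rule that)
  obtain p q f w where p: "bounded_fm p" "bounded_fm q" "range w \<subseteq> S"
    "\<And>v. Q v \<longleftrightarrow> sat M (val f v) w p" "\<And>v. R v \<longleftrightarrow> sat M (val f v) w q"
    by (rule definable_merge[OF Q(1) R(1)]) (rule that)
  obtain \<tau> u where \<tau>: "\<And>x y w p. sat M (case_nat y (case_nat x u)) w (substN \<tau> p) =
    sat M (val f (case_nat y (case_nat x (\<lambda>_. \<zero>)))) w p"
    by (rule sat_witness_argument[of f]) (rule that)
  let ?p = "ExN (substN \<tau> p)" and ?q = "AllN (\<^bold>\<not> substN \<tau> q)"
  have P: "P x \<longleftrightarrow> sat M (case_nat x u) w ?p" for x
    using Q(2)[of "case_nat x (\<lambda>_. \<zero>)"] by (simp add: \<tau> p)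
  have nP: "P x \<longleftrightarrow> sat M (case_nat x u) w ?q" for x
    using R(2)[of "case_nat x (\<lambda>_. \<zero>)"] by (auto simp add: \<tau> p)
  have "comprehension_axiom ?p ?q \<in> RCA0"
    unfolding RCA0_def Sigma01_def Pi01_def
    using bounded_fm_substN[OF p(1)] bounded_fm.intros(4)[OF bounded_fm_substN[OF p(2)]] by blast
  from axioms[OF this] p(3) have "sat M u w (comprehension_axiom ?p ?q)" by (auto simp: models_def)
  then obtain X where "X \<in> S" "\<forall>x. x \<in> X \<longleftrightarrow> P x"
    unfolding sat_comprehension_axiom P[symmetric] nP[symmetric] by auto
  moreover from this have "{x. P x} = X" by auto
  ultimately show ?thesis by simp
qed

lemma definable_comprehension: "definable (\<lambda>v. P (v 0)) \<Longrightarrow> {x. P x} \<in> S"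
  by (intro comprehension sigma1_definable definable_not)

end

section \<open>Arithmetic in a model\<close>

context rca0 begin

lemma basic:
  "x \<oplus> \<one> \<noteq> \<zero>" "x \<oplus> \<one> = y \<oplus> \<one> \<Longrightarrow> x = y" "x \<oplus> \<zero> = x" "x \<oplus> (y \<oplus> \<one>) = x \<oplus> y \<oplus> \<one>"
  "x \<otimes> \<zero> = \<zero>" "x \<otimes> (y \<oplus> \<one>) = x \<otimes> y \<oplus> x" "\<not> x \<prec> \<zero>" "x \<prec> y \<oplus> \<one> \<longleftrightarrow> x \<prec> y \<or> x = y"
proof -
  obtain A where A: "A \<in> S" using S_ne by blast
  have *: "sat M (case_nat x (\<lambda>_. y)) (\<lambda>_. A) p" if "p \<in> basic_axioms" for p
    using axioms[of p] that A by (auto simp: RCA0_def models_def)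
  note ** = *[unfolded basic_axioms_def]
  show "x \<oplus> \<one> \<noteq> \<zero>" using **[of "\<^bold>\<not> V 0 \<^bold>+ One \<^bold>= Zero"] by simp
  show "x \<oplus> \<one> = y \<oplus> \<one> \<Longrightarrow> x = y"
    using **[of "V 0 \<^bold>+ One \<^bold>= V 1 \<^bold>+ One \<^bold>\<longrightarrow> V 0 \<^bold>= V 1"] by simp
  show "x \<oplus> \<zero> = x" using **[of "V 0 \<^bold>+ Zero \<^bold>= V 0"] by simp
  show "x \<oplus> (y \<oplus> \<one>) = x \<oplus> y \<oplus> \<one>"
    using **[of "V 0 \<^bold>+ (V 1 \<^bold>+ One) \<^bold>= (V 0 \<^bold>+ V 1) \<^bold>+ One"] by simp
  show "x \<otimes> \<zero> = \<zero>" using **[of "V 0 \<^bold>* Zero \<^bold>= Zero"] by simp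
  show "x \<otimes> (y \<oplus> \<one>) = x \<otimes> y \<oplus> x"
    using **[of "V 0 \<^bold>* (V 1 \<^bold>+ One) \<^bold>= V 0 \<^bold>* V 1 \<^bold>+ V 0"] by simp
  show "\<not> x \<prec> \<zero>" using **[of "\<^bold>\<not> V 0 \<^bold>< Zero"] by simp
  show "x \<prec> y \<oplus> \<one> \<longleftrightarrow> x \<prec> y \<or> x = y"
    using **[of "V 0 \<^bold>< V 1 \<^bold>+ One \<^bold>\<longleftrightarrow> V 0 \<^bold>< V 1 \<^bold>\<or> V 0 \<^bold>= V 1"] by simp
qed

section \<open>Ordered semiring laws by induction\<close>

lemma plus_assoc: "x \<oplus> y \<oplus> z = x \<oplus> (y \<oplus> z)"
  by (rule definable_induct[where P = "\<lambda>z. x \<oplus> y \<oplus> z = x \<oplus> (y \<oplus> z)"]) (intro bounded_intros, simp_all add: basic(3,4))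

lemma zero_plus: "\<zero> \<oplus> x = x"
  by (rule definable_induct[where P = "\<lambda>x. \<zero> \<oplus> x = x"]) (intro bounded_intros, simp_all add: basic)

lemma suc_plus: "x \<oplus> \<one> \<oplus> y = x \<oplus> y \<oplus> \<one>"
  by (rule definable_induct[where P = "\<lambda>y. x \<oplus> \<one> \<oplus> y = x \<oplus> y \<oplus> \<one>"]) (intro bounded_intros, simp_all add: basic)

lemma plus_commute: "x \<oplus> y = y \<oplus> x"
  by (rule definable_induct[where P = "\<lambda>y. x \<oplus> y = y \<oplus> x"]) (intro bounded_intros, simp add: basic zero_plus, metis basic(4) suc_plus)

lemma mult_plus: "x \<otimes> (y \<oplus> z) = x \<otimes> y \<oplus> x \<otimes> z"
  by (rule definable_induct[where P = "\<lambda>z. x \<otimes> (y \<oplus> z) = x \<otimes> y \<oplus> x \<otimes> z"])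
    (intro bounded_intros, simp add: basic, metis basic(4,6) plus_assoc)

lemma mult_one: "x \<otimes> \<one> = x"
  using basic(6)[of x \<zero>] by (simp add: basic zero_plus)

lemma mult_assoc: "x \<otimes> y \<otimes> z = x \<otimes> (y \<otimes> z)"
  by (rule definable_induct[where P = "\<lambda>z. x \<otimes> y \<otimes> z = x \<otimes> (y \<otimes> z)"])
    (intro bounded_intros, simp_all add: basic(3,5) mult_plus mult_one)

lemma zero_mult: "\<zero> \<otimes> x = \<zero>"
  by (rule definable_induct[where P = "\<lambda>x. \<zero> \<otimes> x = \<zero>"]) (intro bounded_intros, simp_all add: basic)

lemma suc_mult: "(x \<oplus> \<one>) \<otimes> y = x \<otimes> y \<oplus> y"
proof (rule definable_induct[where P = "\<lambda>y. (x \<oplus> \<one>) \<otimes> y = x \<otimes> y \<oplus> y"])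
  fix y assume "(x \<oplus> \<one>) \<otimes> y = x \<otimes> y \<oplus> y"
  then have "(x \<oplus> \<one>) \<otimes> (y \<oplus> \<one>) = x \<otimes> y \<oplus> y \<oplus> (x \<oplus> \<one>)" by (simp only: basic)
  also have "\<dots> = x \<otimes> y \<oplus> x \<oplus> (y \<oplus> \<one>)" by (simp only: basic plus_assoc plus_commute[of y])
  finally show "(x \<oplus> \<one>) \<otimes> (y \<oplus> \<one>) = x \<otimes> (y \<oplus> \<one>) \<oplus> (y \<oplus> \<one>)" by (simp only: basic)
qed (intro bounded_intros, simp add: basic)

lemma mult_commute: "x \<otimes> y = y \<otimes> x"
  by (rule definable_induct[where P = "\<lambda>y. x \<otimes> y = y \<otimes> x"]) (intro bounded_intros, simp_all add: basic zero_mult suc_mult)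

lemma one_mult: "\<one> \<otimes> x = x"
  using suc_mult[of \<zero> x] by (simp add: zero_mult zero_plus)

lemma less_Suc: "x \<prec> x \<oplus> \<one>" by (simp add: basic)

lemma less_trans: "x \<prec> y \<Longrightarrow> y \<prec> z \<Longrightarrow> x \<prec> z"
  by (rule definable_induct[where P = "\<lambda>z. x \<prec> y \<and> y \<prec> z \<longrightarrow> x \<prec> z", THEN mp])
    (intro bounded_intros, auto simp: basic)

lemma less_Suc_mono: "x \<prec> y \<Longrightarrow> x \<oplus> \<one> \<prec> y \<oplus> \<one>"
  by (rule definable_induct[where P = "\<lambda>y. x \<prec> y \<longrightarrow> x \<oplus> \<one> \<prec> y \<oplus> \<one>", THEN mp])
    (intro bounded_intros, auto simp: basic)

lemma less_irrefl: "\<not> x \<prec> x"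
proof (rule definable_induct[where P = "\<lambda>x. \<not> x \<prec> x"])
  fix x assume "\<not> x \<prec> x"
  then show "\<not> x \<oplus> \<one> \<prec> x \<oplus> \<one>" using less_Suc[of x] less_trans by (metis basic(8))
qed (intro bounded_intros, simp add: basic)

lemma zero_or_pos: "x = \<zero> \<or> \<zero> \<prec> x"
  by (rule definable_induct[where P = "\<lambda>x. x = \<zero> \<or> \<zero> \<prec> x"]) (intro bounded_intros, auto simp add: basic)

lemma less_linear: "x \<prec> y \<or> x = y \<or> y \<prec> x"
proof (rule definable_induct[where P = "\<lambda>y. x \<prec> y \<or> x = y \<or> y \<prec> x"])
  fix y assume "x \<prec> y \<or> x = y \<or> y \<prec> x"
  then show "x \<prec> y \<oplus> \<one> \<or> x = y \<oplus> \<one> \<or> y \<oplus> \<one> \<prec> x"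
    using less_Suc_mono[of y x] by (auto simp: basic)
qed (intro bounded_intros, use zero_or_pos in auto)

lemma plus_less_mono: assumes "x \<prec> y" shows "z \<oplus> x \<prec> z \<oplus> y"
proof -
  have "x \<oplus> z \<prec> y \<oplus> z"
  proof (rule definable_induct[where P = "\<lambda>z. x \<oplus> z \<prec> y \<oplus> z"])
    show "x \<oplus> z \<prec> y \<oplus> z \<Longrightarrow> x \<oplus> (z \<oplus> \<one>) \<prec> y \<oplus> (z \<oplus> \<one>)" for z
      unfolding basic(4) by (rule less_Suc_mono)
  qed (intro bounded_intros, simp add: basic assms)
  then show ?thesis by (simp only: plus_commute)
qed

lemma plus_cancel: "x \<oplus> y = x \<oplus> z \<Longrightarrow> y = z"
  by (metis less_linear less_irrefl plus_less_mono)

lemma less_imp_ex: "x \<prec> y \<Longrightarrow> \<exists>z. x \<oplus> z = y"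
proof -
  \<comment> \<open>The premise is moved under the quantifier so that the induction predicate is
    visibly Sigma1.\<close>
  have "sigma1 (\<lambda>v. \<exists>z. x \<prec> v 0 \<longrightarrow> x \<oplus> z = v 0)" by (rule sigma1_ex_definable) (intro bounded_intros)
  then have "\<exists>z. x \<prec> y \<longrightarrow> x \<oplus> z = y"
    by (rule sigma1_induct) (metis basic(3,4,7,8))+
  then show "x \<prec> y \<Longrightarrow> \<exists>z. x \<oplus> z = y" by blast
qed

lemma mult_less_mono: "x \<prec> y \<Longrightarrow> \<zero> \<prec> z \<Longrightarrow> z \<otimes> x \<prec> z \<otimes> y"
proof -
  assume "x \<prec> y"
  have "\<zero> \<prec> z \<longrightarrow> z \<otimes> x \<prec> z \<otimes> y"
  proof (rule definable_induct[where P = "\<lambda>z. \<zero> \<prec> z \<longrightarrow> z \<otimes> x \<prec> z \<otimes> y"])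
    fix z assume z: "\<zero> \<prec> z \<longrightarrow> z \<otimes> x \<prec> z \<otimes> y"
    show "\<zero> \<prec> z \<oplus> \<one> \<longrightarrow> (z \<oplus> \<one>) \<otimes> x \<prec> (z \<oplus> \<one>) \<otimes> y"
    proof (cases "z = \<zero>")
      case True then show ?thesis using \<open>x \<prec> y\<close> by (simp add: zero_plus one_mult)
    next
      case False
      then have "z \<otimes> x \<prec> z \<otimes> y" using z zero_or_pos by blast
      then have "x \<oplus> z \<otimes> x \<prec> x \<oplus> z \<otimes> y" by (rule plus_less_mono)
      moreover have "z \<otimes> y \<oplus> x \<prec> z \<otimes> y \<oplus> y" using \<open>x \<prec> y\<close> by (rule plus_less_mono)
      ultimately show ?thesis by (metis less_trans suc_mult plus_commute)
    qed
  qed (intro bounded_intros, simp add: basic)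
  then show "\<zero> \<prec> z \<Longrightarrow> z \<otimes> x \<prec> z \<otimes> y" by blast
qed

definition le (infix "\<preceq>" 50) where "x \<preceq> y \<longleftrightarrow> x \<prec> y \<or> x = y"

definition minus' (infixl "\<ominus>" 65) where "x \<ominus> y = (if y \<preceq> x then THE z. y \<oplus> z = x else \<zero>)"

lemma le_iff: "x \<preceq> y \<longleftrightarrow> (\<exists>z. x \<oplus> z = y)"
proof
  show "x \<preceq> y \<Longrightarrow> \<exists>z. x \<oplus> z = y" unfolding le_def using less_imp_ex basic(3) by blast
  show "\<exists>z. x \<oplus> z = y \<Longrightarrow> x \<preceq> y"
    unfolding le_def using zero_or_pos plus_less_mono basic(3) by metis
qed

lemma plus_minus: "x \<oplus> y \<ominus> x = y"
proof -
  have "x \<preceq> x \<oplus> y" using le_iff by metis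
  then show ?thesis unfolding minus'_def by (auto dest: plus_cancel)
qed

lemma minus_zero: "\<not> y \<preceq> x \<Longrightarrow> x \<ominus> y = \<zero>" by (simp add: minus'_def)

lemma le_cases: "x \<preceq> y \<or> y \<preceq> x" using less_linear by (auto simp: le_def)

lemma minus_zero': "x \<preceq> y \<Longrightarrow> x \<ominus> y = \<zero>"
  using minus_zero plus_minus[of x \<zero>] less_trans less_irrefl unfolding le_def
  by (metis basic(3))

text \<open>From here on the numbers of the model inherit the general laws of ordered semirings and
  of divisibility. The class asks for a subtraction, hence the truncated
  \<open>\<ominus>\<close>.\<close>

sublocale N: linordered_semidom where plus = "(\<oplus>)" and minus = "(\<ominus>)" and zero = \<zero> and
  times = "(\<otimes>)" and less_eq = "(\<preceq>)" and less = "(\<prec>)" and one = \<one>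
proof
  fix a b c :: 'a
  show "a \<oplus> b \<oplus> c = a \<oplus> (b \<oplus> c)" by (rule plus_assoc)
  show "a \<oplus> b = b \<oplus> a" by (rule plus_commute)
  show "\<zero> \<oplus> a = a" by (rule zero_plus)
  show "a \<oplus> b \<ominus> a = b" by (rule plus_minus)
  show "a \<ominus> b \<ominus> c = a \<ominus> (b \<oplus> c)"
  proof (cases "b \<preceq> a")
    case True
    then obtain e where e: "a = b \<oplus> e" using le_iff by metis
    show ?thesis
    proof (cases "c \<preceq> e")
      case True
      then obtain d where "e = c \<oplus> d" using le_iff by metis
      then show ?thesis using e by (metis plus_minus plus_assoc)
    next
      case False
      then have "\<not> b \<oplus> c \<preceq> b \<oplus> e" unfolding le_iff by (metis plus_assoc plus_cancel)
      then show ?thesis using e False by (simp add: plus_minus minus_zero)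
    qed
  next
    case False
    then have "\<not> b \<oplus> c \<preceq> a" unfolding le_iff by (metis plus_assoc)
    moreover have "\<zero> \<preceq> c" using zero_or_pos[of c] by (auto simp: le_def)
    ultimately show ?thesis using False by (simp add: minus_zero minus_zero')
  qed
  show "a \<otimes> b \<otimes> c = a \<otimes> (b \<otimes> c)" by (rule mult_assoc)
  show "a \<otimes> b = b \<otimes> a" by (rule mult_commute)
  show "\<one> \<otimes> a = a" by (rule one_mult)
  show "(a \<oplus> b) \<otimes> c = a \<otimes> c \<oplus> b \<otimes> c" by (metis mult_plus mult_commute)
  show "a \<otimes> (b \<oplus> c) = a \<otimes> b \<oplus> a \<otimes> c" by (rule mult_plus)
  show "\<zero> \<noteq> \<one>" using basic(1)[of \<zero>] zero_plus by metis
  show "\<zero> \<prec> \<one>" using less_Suc[of \<zero>] zero_plus by metis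
  show "a \<otimes> (b \<ominus> c) = a \<otimes> b \<ominus> a \<otimes> c"
  proof (cases "c \<preceq> b")
    case True
    then obtain d where "b = c \<oplus> d" using le_iff by metis
    then show ?thesis by (simp add: plus_minus mult_plus)
  next
    case False
    then have "b \<preceq> c" using le_cases by blast
    then have "a \<otimes> b \<preceq> a \<otimes> c" unfolding le_iff by (metis mult_plus)
    with False show ?thesis by (simp add: minus_zero minus_zero' basic)
  qed
  show "a \<prec> b \<longleftrightarrow> a \<preceq> b \<and> \<not> b \<preceq> a" unfolding le_def by (metis less_irrefl less_trans)
  show "a \<preceq> a" by (simp add: le_def)
  show "a \<preceq> b \<Longrightarrow> b \<preceq> c \<Longrightarrow> a \<preceq> c" unfolding le_def by (metis less_trans)
  show "a \<preceq> b \<Longrightarrow> b \<preceq> a \<Longrightarrow> a = b" unfolding le_def by (metis less_trans less_irrefl)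
  show "a \<preceq> b \<or> b \<preceq> a" by (rule le_cases)
  show "a \<preceq> b \<Longrightarrow> c \<oplus> a \<preceq> c \<oplus> b" unfolding le_iff by (metis plus_assoc)
  show "a \<prec> b \<Longrightarrow> \<zero> \<prec> c \<Longrightarrow> c \<otimes> a \<prec> c \<otimes> b" by (rule mult_less_mono)
  show "b \<preceq> a \<Longrightarrow> a \<ominus> b \<oplus> b = a" unfolding le_iff using plus_minus plus_commute by metis
  show "a \<otimes> \<zero> = \<zero>" by (rule basic)
  show "\<zero> \<otimes> a = \<zero>" by (rule zero_mult)
  show "a \<noteq> \<zero> \<Longrightarrow> b \<noteq> \<zero> \<Longrightarrow> a \<otimes> b \<noteq> \<zero>"
    by (metis basic(5) less_irrefl mult_less_mono zero_or_pos)
qed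

declare N.one_add_one [simp del]

lemmas semiring_simps = N.distrib_left N.distrib_right N.add_ac N.mult_ac one_mult mult_one

lemma zero_le [simp]: "\<zero> \<preceq> x" using zero_or_pos[of x] by (auto simp: le_def)

lemma le_zero [simp]: "x \<preceq> \<zero> \<longleftrightarrow> x = \<zero>" by (auto simp: le_def basic)

lemma not_less_zero [simp]: "\<not> x \<prec> \<zero>" by (rule basic)

lemma Suc_ne_zero [simp]: "x \<oplus> \<one> \<noteq> \<zero>" by (rule basic)

lemma less_Suc_le: "x \<prec> y \<oplus> \<one> \<longleftrightarrow> x \<preceq> y" by (simp add: basic le_def)

lemma Suc_le: "x \<oplus> \<one> \<preceq> y \<longleftrightarrow> x \<prec> y"
  by (metis N.add_less_cancel_right N.not_less less_Suc_le)

lemma le_add [simp]: "x \<preceq> x \<oplus> y" "y \<preceq> x \<oplus> y" by simp_all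

lemma pos_iff: "\<zero> \<prec> x \<longleftrightarrow> x \<noteq> \<zero>" using zero_or_pos by auto

lemma le_mult: "x \<noteq> \<zero> \<Longrightarrow> y \<preceq> x \<otimes> y"
  using N.mult_right_mono[of \<one> x y] Suc_le[of \<zero> x] zero_or_pos[of x] by (simp add: zero_plus)

lemma add_eq_zero [simp]: "x \<oplus> y = \<zero> \<longleftrightarrow> x = \<zero> \<and> y = \<zero>"
  by (metis N.add_0 N.add_0_right le_add(1) le_zero)

lemma nonzero_Suc: "x \<noteq> \<zero> \<Longrightarrow> \<exists>y. x = y \<oplus> \<one>"
  by (metis N.add_diff_cancel_left' less_imp_ex N.add.commute Suc_le pos_iff zero_plus le_iff)

section \<open>Monotonicity and injectivity of pairing\<close>

lemma pair_le: "x \<preceq> \<langle>x, y\<rangle>" "y \<preceq> \<langle>x, y\<rangle>"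
proof -
  show "x \<preceq> \<langle>x, y\<rangle>" by (simp add: pair_in_def)
  have "x \<oplus> y \<preceq> (x \<oplus> y) \<otimes> (x \<oplus> y)" by (cases "x \<oplus> y = \<zero>") (auto intro: le_mult)
  then show "y \<preceq> \<langle>x, y\<rangle>" unfolding pair_in_def by (meson N.order_trans le_add)
qed

text \<open>Since the first component is at most the sum s, the code lies between s^2 and s^2 + s,
  hence below (s + 1)^2. Codes for different sums therefore fall into disjoint intervals, and within
  one sum the code determines the first component.\<close>

lemma pair_less_aux: assumes "x \<oplus> y \<prec> x' \<oplus> y'" shows "\<langle>x, y\<rangle> \<prec> \<langle>x', y'\<rangle>"
proof -
  let ?s = "x \<oplus> y" and ?t = "x' \<oplus> y'"
  have "?s \<oplus> \<one> \<preceq> ?t" using assms Suc_le by blast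
  then have "(?s \<oplus> \<one>) \<otimes> (?s \<oplus> \<one>) \<preceq> ?t \<otimes> ?t" by (intro N.mult_mono) auto
  moreover have "?s \<otimes> ?s \<oplus> ?s \<prec> (?s \<oplus> \<one>) \<otimes> (?s \<oplus> \<one>)"
    by (simp only: basic(4,6) suc_mult less_Suc_le le_add)
  moreover have "\<langle>x, y\<rangle> \<preceq> ?s \<otimes> ?s \<oplus> ?s" "?t \<otimes> ?t \<preceq> \<langle>x', y'\<rangle>" unfolding pair_in_def by simp_all
  ultimately show ?thesis by order
qed

lemma pair_inject [simp]: "\<langle>x, y\<rangle> = \<langle>x', y'\<rangle> \<longleftrightarrow> x = x' \<and> y = y'"
proof
  assume *: "\<langle>x, y\<rangle> = \<langle>x', y'\<rangle>"
  then have "x \<oplus> y = x' \<oplus> y'"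
    using pair_less_aux less_linear less_irrefl by metis
  with * show "x = x' \<and> y = y'" unfolding pair_in_def using N.add_left_cancel by metis
qed simp

lemma pair_mono: "x \<preceq> x' \<Longrightarrow> y \<preceq> y' \<Longrightarrow> \<langle>x, y\<rangle> \<preceq> \<langle>x', y'\<rangle>"
  unfolding pair_in_def by (intro N.add_mono N.mult_mono) auto

text \<open>Two unbounded witnesses are contracted into one number \<open>z\<close> that bounds
  both; the witnesses themselves are then found by bounded quantifiers.\<close>

lemma sigma1_ex [bounded_intros]:
  assumes "sigma1 (\<lambda>v. P (v 0) (\<lambda>i. v (Suc i)))" shows "sigma1 (\<lambda>v. \<exists>x. P x v)"
proof -
  obtain Q where Q: "definable Q" "\<And>v. P (v 0) (\<lambda>i. v (Suc i)) \<longleftrightarrow> (\<exists>y. Q (case_nat y v))"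
    by (rule sigma1E[OF assms]) (rule that)
  have P: "P x v \<longleftrightarrow> (\<exists>y. Q (case_nat y (case_nat x v)))" for x v
    using Q(2)[of "case_nat x v"] by simp
  have "definable (\<lambda>v. Q (case_nat (v 0) (case_nat (v 1) (\<lambda>i. v (Suc (Suc (Suc i)))))))"
  proof -
    have "case_nat (v 0) (case_nat (v 1) (\<lambda>i. v (Suc (Suc (Suc i))))) =
        (\<lambda>i. v (case_nat 0 (case_nat 1 (\<lambda>i. Suc (Suc (Suc i)))) i))" for v :: "nat \<Rightarrow> 'a"
      by (rule ext) (simp split: nat.split)
    then show ?thesis using definable_ren[OF Q(1)] by simp
  qed
  then have "definable (\<lambda>v. \<exists>x. x \<prec> v 0 \<oplus> \<one> \<and> (\<exists>y. y \<prec> v 0 \<oplus> \<one> \<and> Q (case_nat y (case_nat x (\<lambda>i. v (Suc i))))))"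
    by (intro bounded_intros) (simp_all add: eval_nat_numeral)
  then have "sigma1 (\<lambda>v. \<exists>z. \<exists>x. x \<prec> z \<oplus> \<one> \<and> (\<exists>y. y \<prec> z \<oplus> \<one> \<and> Q (case_nat y (case_nat x v))))"
    by (intro sigma1_ex_definable)
  then show ?thesis
    by (rule sigma1_cong) (unfold P less_Suc_le, metis le_add)
qed

lemma sigma1_conj [bounded_intros]: assumes "sigma1 P" "sigma1 Q" shows "sigma1 (\<lambda>v. P v \<and> Q v)"
proof -
  obtain P' where P: "definable P'" "\<And>v. P v \<longleftrightarrow> (\<exists>y. P' (case_nat y v))"
    by (rule sigma1E[OF assms(1)]) (rule that)
  obtain Q' where Q: "definable Q'" "\<And>v. Q v \<longleftrightarrow> (\<exists>y. Q' (case_nat y v))"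
    by (rule sigma1E[OF assms(2)]) (rule that)
  have 1: "definable (\<lambda>v. P' (case_nat (v 0) (\<lambda>i. v (Suc (Suc i)))))"
  proof -
    have "case_nat (v 0) (\<lambda>i. v (Suc (Suc i))) = (\<lambda>i. v (case_nat 0 (\<lambda>i. Suc (Suc i)) i))"
      for v :: "nat \<Rightarrow> 'a" by (rule ext) (simp split: nat.split)
    then show ?thesis using definable_ren[OF P(1)] by simp
  qed
  have 2: "definable (\<lambda>v. Q' (case_nat (v 1) (\<lambda>i. v (Suc (Suc i)))))"
  proof -
    have "case_nat (v 1) (\<lambda>i. v (Suc (Suc i))) = (\<lambda>i. v (case_nat 1 (\<lambda>i. Suc (Suc i)) i))"
      for v :: "nat \<Rightarrow> 'a" by (rule ext) (simp split: nat.split)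
    then show ?thesis using definable_ren[OF Q(1)] by simp
  qed
  have "sigma1 (\<lambda>v. \<exists>x y. P' (case_nat y v) \<and> Q' (case_nat x v))"
    by (rule sigma1_ex, rule sigma1_ex_definable, rule definable_conj) (use 1 2 in simp_all)
  then show ?thesis by (rule sigma1_cong) (auto simp: P(2) Q(2))
qed

lemma sigma1_disj [bounded_intros]: assumes "sigma1 P" "sigma1 Q" shows "sigma1 (\<lambda>v. P v \<or> Q v)"
proof -
  obtain P' where P: "definable P'" "\<And>v. P v \<longleftrightarrow> (\<exists>y. P' (case_nat y v))"
    by (rule sigma1E[OF assms(1)]) (rule that)
  obtain Q' where Q: "definable Q'" "\<And>v. Q v \<longleftrightarrow> (\<exists>y. Q' (case_nat y v))"
    by (rule sigma1E[OF assms(2)]) (rule that)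
  have "sigma1 (\<lambda>v. \<exists>y. P' (case_nat y v) \<or> Q' (case_nat y v))"
    by (rule sigma1I[OF definable_disj[OF P(1) Q(1)]]) simp
  then show ?thesis by (rule sigma1_cong) (auto simp: P(2) Q(2))
qed

abbreviation divides_in (infix "divides" 50) where "x divides y \<equiv> dvd.dvd (\<otimes>) x y"

lemma divides_iff: "x divides y \<longleftrightarrow> (\<exists>q. y = x \<otimes> q)" by (simp add: N.dvd_def)

lemma D_triple: "D \<langle>\<langle>k, m\<rangle>, n\<rangle> = {i. i \<prec> k \<and> m \<otimes> (i \<oplus> \<one>) \<oplus> \<one> divides n}"
  by (auto simp: fin_set_in_def divides_iff)

lemma definable_divides [bounded_intros]: assumes "term_definable s" "term_definable t" shows "definable (\<lambda>v. s v divides t v)"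
proof -
  have "x divides y \<longleftrightarrow> (\<exists>q. q \<prec> y \<oplus> \<one> \<and> y = x \<otimes> q)" for x y
    unfolding divides_iff less_Suc_le by (metis le_mult N.mult_zero_left N.order_refl N.mult_zero_right)
  moreover have "definable (\<lambda>v. \<exists>q. q \<prec> v 1 \<oplus> \<one> \<and> v 1 = v 0 \<otimes> q)" by (intro bounded_intros)
  ultimately have "definable (\<lambda>v. v 0 divides v 1)" by (simp only:)
  from definable_subst2[OF this assms] show ?thesis .
qed

text \<open>Elements lie below the first component of the triple, and components do not exceed their
  pair. Quantifiers over a coded set can thus be bounded by its code, which is what makes the later
  predicates on codes definable.\<close>

lemma D_less: "i \<in> D c \<Longrightarrow> i \<prec> c"
  unfolding fin_set_in_def using pair_le by (clarsimp, metis N.less_le_trans)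

lemma D_bounds:
  "i \<in> D c \<longleftrightarrow> (\<exists>k. k \<prec> c \<oplus> \<one> \<and> (\<exists>m. m \<prec> c \<oplus> \<one> \<and> (\<exists>n. n \<prec> c \<oplus> \<one> \<and>
    c = \<langle>\<langle>k, m\<rangle>, n\<rangle> \<and> i \<prec> k \<and> m \<otimes> (i \<oplus> \<one>) \<oplus> \<one> divides n)))"
proof -
  have "k \<preceq> \<langle>\<langle>k, m\<rangle>, n\<rangle>" "m \<preceq> \<langle>\<langle>k, m\<rangle>, n\<rangle>" "n \<preceq> \<langle>\<langle>k, m\<rangle>, n\<rangle>" for k m n
    using pair_le N.order_trans by blast+
  then show ?thesis unfolding fin_set_in_def less_Suc_le divides_iff by blast
qed

lemma definable_D [bounded_intros]: assumes "term_definable s" "term_definable t" shows "definable (\<lambda>v. s v \<in> D (t v))"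
proof -
  have "definable (\<lambda>v. v 0 \<in> D (v 1))" unfolding D_bounds by (intro bounded_intros)
  from definable_subst2[OF this assms] show ?thesis .
qed

end

section \<open>Codes of finite sets\<close>

context rca0 begin

text \<open>The predicate ignores all positions but 0, so the others may be fixed to
  \<open>\<zero>\<close> in the matrix. What remains is a binary predicate into which arbitrary
  terms can be substituted.\<close>

lemma sigma1E2:
  assumes "sigma1 (\<lambda>v. \<phi> (v 0))"
  obtains \<theta> where "\<And>s t. term_definable s \<Longrightarrow> term_definable t \<Longrightarrow> definable (\<lambda>v. \<theta> (s v) (t v))" "\<And>i. \<phi> i \<longleftrightarrow> (\<exists>y. \<theta> i y)"
proof -
  obtain Q where Q: "definable Q" "\<And>v. \<phi> (v 0) \<longleftrightarrow> (\<exists>y. Q (case_nat y v))"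
    by (rule sigma1E[OF assms]) (rule that)
  let ?\<theta> = "\<lambda>i y. Q (case_nat y (case_nat i (\<lambda>_. \<zero>)))"
  have "val (case_nat (Inr 1) (case_nat (Inr 0) (\<lambda>_. Inl \<zero>))) v =
      case_nat (v 1) (case_nat (v 0) (\<lambda>_. \<zero>))" for v
    by (rule ext) (simp add: val_def split: nat.split)
  then have "definable (\<lambda>v. ?\<theta> (v 0) (v 1))"
    using definable_val[OF Q(1), of "case_nat (Inr 1) (case_nat (Inr 0) (\<lambda>_. Inl \<zero>))"] by simp
  from that[OF definable_subst2[OF this]] show thesis
    using Q(2)[of "case_nat i (\<lambda>_. \<zero>)" for i] by simp
qed

lemma sigma1_subst1: assumes "sigma1 (\<lambda>v. \<phi> (v 0))" "term_definable t" shows "sigma1 (\<lambda>v. \<phi> (t v))"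
proof -
  obtain \<theta> where \<theta>: "\<And>s t. term_definable s \<Longrightarrow> term_definable t \<Longrightarrow> definable (\<lambda>v. \<theta> (s v) (t v))" "\<And>i. \<phi> i \<longleftrightarrow> (\<exists>y. \<theta> i y)"
    by (rule sigma1E2[OF assms(1)]) (rule that)
  show ?thesis unfolding \<theta>(2) by (intro sigma1_ex_definable \<theta>(1) term_definable_ren[OF assms(2)] bounded_intros)
qed

text \<open>Without a greatest element, Sigma1 induction would produce members of \<open>R\<close>
  above every number, in particular above \<open>N\<close>.\<close>

lemma sigma1_max:
  assumes "sigma1 (\<lambda>v. R (v 0))" "R n" "\<And>n. R n \<Longrightarrow> n \<preceq> N"
  shows "\<exists>n. R n \<and> (\<forall>n'. R n' \<longrightarrow> n' \<preceq> n)"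
proof (rule ccontr)
  assume "\<not> ?thesis"
  then have *: "R n \<Longrightarrow> \<exists>n'. R n' \<and> n \<oplus> \<one> \<preceq> n'" for n by (metis N.not_le Suc_le)
  have "sigma1 (\<lambda>v. \<exists>n. R n \<and> v 0 \<preceq> n)"
    unfolding less_Suc_le[symmetric] by (intro sigma1_ex sigma1_conj sigma1_subst1[OF assms(1)] sigma1_definable bounded_intros)
  then have "\<exists>n. R n \<and> N \<oplus> \<one> \<preceq> n"
    by (rule sigma1_induct) (use assms(2) * N.add_right_mono N.order_trans in \<open>blast intro: zero_le\<close>)+
  with assms(3) show False by (metis N.not_le Suc_le)
qed

text \<open>Stands in for a factorial or a product over an initial segment, neither of which is a
  term of the language.\<close>

lemma common_multiple:
  assumes "\<And>t. term_definable t \<Longrightarrow> term_definable (\<lambda>v. f (t v))" "\<And>i. f i \<noteq> \<zero>"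
  shows "\<exists>N. N \<noteq> \<zero> \<and> (\<forall>i. i \<prec> a \<longrightarrow> f i divides N)"
proof -
  have "sigma1 (\<lambda>v. \<exists>N. N \<noteq> \<zero> \<and> (\<forall>i. i \<prec> v 0 \<longrightarrow> f i divides N))"
    by (intro sigma1_ex_definable bounded_intros assms(1))
  then show ?thesis
  proof (rule sigma1_induct)
    show "\<exists>N. N \<noteq> \<zero> \<and> (\<forall>i. i \<prec> \<zero> \<longrightarrow> f i divides N)" by (intro exI[of _ \<one>]) auto
    fix a assume "\<exists>N. N \<noteq> \<zero> \<and> (\<forall>i. i \<prec> a \<longrightarrow> f i divides N)"
    then obtain N where "N \<noteq> \<zero>" "\<forall>i. i \<prec> a \<longrightarrow> f i divides N" by blast
    then have "N \<otimes> f a \<noteq> \<zero> \<and> (\<forall>i. i \<prec> a \<oplus> \<one> \<longrightarrow> f i divides N \<otimes> f a)"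
      using assms(2) by (auto simp: basic(8))
    then show "\<exists>N. N \<noteq> \<zero> \<and> (\<forall>i. i \<prec> a \<oplus> \<one> \<longrightarrow> f i divides N)" by blast
  qed
qed

text \<open>Modulo \<open>m (i + 1) + 1\<close> the factor \<open>m (x + 1) + 1\<close> is \<open>m (x - i)\<close>; both \<open>m\<close> and its divisor
  \<open>x - i\<close> are invertible there, as \<open>m (i + 1)\<close> is \<open>-1\<close>.\<close>

lemma beta_coprime:
  assumes m: "\<And>j. j \<prec> a \<Longrightarrow> j \<oplus> \<one> divides m" and "i \<prec> a" "x \<prec> a" "i \<noteq> x"
    and divides_in: "m \<otimes> (i \<oplus> \<one>) \<oplus> \<one> divides (m \<otimes> (x \<oplus> \<one>) \<oplus> \<one>) \<otimes> n"
  shows "m \<otimes> (i \<oplus> \<one>) \<oplus> \<one> divides n"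
proof -
  define u where "u = m \<otimes> (i \<oplus> \<one>)"
  have "\<exists>d. d divides m \<and> u \<oplus> \<one> divides m \<otimes> d \<otimes> n"
  proof (cases "i \<prec> x")
    case True
    then obtain d where d: "x = i \<oplus> (d \<oplus> \<one>)"
      using less_imp_ex nonzero_Suc by (metis basic(3) less_irrefl)
    then have "d \<prec> a" using assms(3) by (metis N.le_less_trans Suc_le le_add(2) N.le_less)
    moreover have "(m \<otimes> (x \<oplus> \<one>) \<oplus> \<one>) \<otimes> n = (u \<oplus> \<one>) \<otimes> n \<oplus> m \<otimes> (d \<oplus> \<one>) \<otimes> n"
      unfolding d u_def by (simp only: semiring_simps)
    ultimately show ?thesis using divides_in m unfolding u_def by (metis N.dvd_add_right_iff N.dvd_triv_left)
  next
    case False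
    then obtain d where d: "i = x \<oplus> (d \<oplus> \<one>)"
      using less_imp_ex nonzero_Suc less_linear assms(4) by (metis basic(3))
    then have "d \<prec> a" using assms(2) by (metis N.le_less_trans Suc_le le_add(2) N.le_less)
    moreover have "(m \<otimes> (x \<oplus> \<one>) \<oplus> \<one>) \<otimes> n \<oplus> m \<otimes> (d \<oplus> \<one>) \<otimes> n = (u \<oplus> \<one>) \<otimes> n"
      unfolding d u_def by (simp only: semiring_simps)
    ultimately show ?thesis using divides_in m unfolding u_def by (metis N.dvd_add_right_iff N.dvd_triv_left)
  qed
  then obtain d e where "m = d \<otimes> e" and d: "u \<oplus> \<one> divides m \<otimes> d \<otimes> n" by (auto simp: divides_iff)
  then have "u \<otimes> u \<otimes> n = m \<otimes> d \<otimes> n \<otimes> (e \<otimes> (i \<oplus> \<one>) \<otimes> (i \<oplus> \<one>))"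
    unfolding u_def by (simp only: N.mult_ac)
  with d have "u \<oplus> \<one> divides u \<otimes> u \<otimes> n" by (metis N.dvd_mult2)
  moreover have "u \<otimes> u \<otimes> n \<oplus> u \<otimes> n = (u \<oplus> \<one>) \<otimes> (u \<otimes> n)"
    by (simp only: semiring_simps)
  ultimately have "u \<oplus> \<one> divides u \<otimes> n" by (metis N.dvd_add_right_iff N.dvd_triv_left)
  moreover have "u \<otimes> n \<oplus> n = (u \<oplus> \<one>) \<otimes> n" by (simp only: semiring_simps)
  ultimately show ?thesis unfolding u_def by (metis N.dvd_add_right_iff N.dvd_triv_left)
qed

text \<open>The code is found by maximising a product of moduli whose indices are known to satisfy
  \<open>\<phi>\<close>: a missing index would allow a larger product. The bound \<open>K\<close> depends only on \<open>a\<close>.\<close>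

theorem bounded_comprehension:
  "\<exists>K. \<forall>\<phi>. sigma1 (\<lambda>v. \<phi> (v 0)) \<longrightarrow> (\<exists>c. c \<preceq> K \<and> D c = {i. i \<prec> a \<and> \<phi> i})"
proof -
  have "\<exists>m. m \<noteq> \<zero> \<and> (\<forall>j. j \<prec> a \<longrightarrow> j \<oplus> \<one> divides m)"
    by (rule common_multiple) (rule term_definable_add[OF _ term_definable_const], assumption, rule Suc_ne_zero)
  then obtain m where "m \<noteq> \<zero>" and m: "\<forall>j. j \<prec> a \<longrightarrow> j \<oplus> \<one> divides m" by blast
  define q where "q i = m \<otimes> (i \<oplus> \<one>) \<oplus> \<one>" for i
  have term_q: "term_definable t \<Longrightarrow> term_definable (\<lambda>v. q (t v))" for t unfolding q_def by (intro bounded_intros)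
  have "\<exists>N. N \<noteq> \<zero> \<and> (\<forall>i. i \<prec> a \<longrightarrow> q i divides N)"
    by (rule common_multiple[OF term_q]) (simp_all add: q_def)
  then obtain N where "N \<noteq> \<zero>" and N: "\<forall>i. i \<prec> a \<longrightarrow> q i divides N" by blast
  have coprime: "q i divides n" if "i \<prec> a" "x \<prec> a" "i \<noteq> x" "q i divides q x \<otimes> n" for i x n
    using beta_coprime[of a m i x n] m that unfolding q_def by blast
  have q1: "\<not> q i divides \<one>" for i
  proof
    assume "q i divides \<one>"
    then obtain r where "\<one> = q i \<otimes> r" by (auto simp: divides_iff)
    moreover from this have "r \<noteq> \<zero>" using basic(1)[of \<zero>] by (auto simp: zero_plus)
    ultimately have "q i \<preceq> \<one>" by (metis le_mult mult_commute)
    then have "m \<otimes> (i \<oplus> \<one>) = \<zero>" by (metis N.add_le_same_cancel2 le_zero q_def)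
    with \<open>m \<noteq> \<zero>\<close> show False by simp
  qed
  have "\<exists>c. c \<preceq> \<langle>\<langle>a, m\<rangle>, N\<rangle> \<and> D c = {i. i \<prec> a \<and> \<phi> i}" if \<phi>: "sigma1 (\<lambda>v. \<phi> (v 0))" for \<phi>
  proof -
    obtain \<theta> where \<theta>: "\<And>s t. term_definable s \<Longrightarrow> term_definable t \<Longrightarrow> definable (\<lambda>v. \<theta> (s v) (t v))" "\<And>i. \<phi> i \<longleftrightarrow> (\<exists>y. \<theta> i y)"
      by (rule sigma1E2[OF \<phi>]) (rule that)
    \<comment> \<open>A candidate \<open>n\<close> divides \<open>N\<close>, has each modulus below
      \<open>a\<close> either as a divisor or coprime to it, and comes with one bound
      \<open>b\<close> on the witnesses for all indices whose moduli divide it. Placing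
      \<open>b\<close> outside the quantifier over \<open>i\<close> keeps \<open>R\<close> Sigma1;
      bounding \<open>r\<close> keeps coprimality a bounded formula.\<close>
    define R where "R n \<longleftrightarrow> n divides N \<and>
      (\<forall>i. i \<prec> a \<longrightarrow> q i divides n \<or> (\<forall>r. r \<prec> N \<oplus> \<one> \<longrightarrow> q i divides n \<otimes> r \<longrightarrow> q i divides r)) \<and>
      (\<exists>b. \<forall>i. i \<prec> a \<longrightarrow> q i divides n \<longrightarrow> (\<exists>y. y \<prec> b \<and> \<theta> i y))" for n
    have R_le: "n \<preceq> N" if "R n" for n
      using that \<open>N \<noteq> \<zero>\<close> unfolding R_def divides_iff by (metis le_mult mult_commute N.mult_zero_right)
    have "sigma1 (\<lambda>v. R (v 0))" unfolding R_def
      by (rule sigma1_conj, rule sigma1_definable, intro bounded_intros term_q, rule sigma1_conj, rule sigma1_definable, intro bounded_intros term_q,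
          rule sigma1_ex_definable, intro bounded_intros term_q \<theta>(1))
    moreover have "R \<one>" unfolding R_def using q1 by (auto simp: divides_iff one_mult)
    ultimately obtain n where n: "R n" "\<And>n'. R n' \<Longrightarrow> n' \<preceq> n" using sigma1_max R_le by metis
    have "q x divides n" if x: "x \<prec> a" "\<theta> x y" for x y
    proof (rule ccontr)
      \<comment> \<open>As \<open>q x\<close> divides \<open>N = n \<otimes> r\<close> and is
        coprime to \<open>n\<close>, it divides \<open>r\<close>. So \<open>n \<otimes> q x\<close>
        is again a candidate, and a larger one because \<open>q x\<close> exceeds 1.\<close>
      assume nd: "\<not> q x divides n"
      have "n \<noteq> \<zero>" using n(1) \<open>N \<noteq> \<zero>\<close> unfolding R_def by (auto simp: divides_iff)
      obtain r where r: "N = n \<otimes> r" using n(1) unfolding R_def divides_iff by blast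
      have "r \<preceq> N" using le_mult[OF \<open>n \<noteq> \<zero>\<close>] r by simp
      then have "q x divides r"
        using n(1) x N nd r unfolding R_def less_Suc_le by metis
      then have 1: "n \<otimes> q x divides N" unfolding r by (rule N.mult_dvd_mono[OF N.dvd_refl])
      have 2: "q i divides n \<otimes> q x \<or> (\<forall>r. r \<prec> N \<oplus> \<one> \<longrightarrow> q i divides n \<otimes> q x \<otimes> r \<longrightarrow> q i divides r)"
        if i: "i \<prec> a" for i
      proof (cases "i = x")
        case False
        have "q i divides r" if "\<not> q i divides n" "r \<prec> N \<oplus> \<one>" "q i divides n \<otimes> q x \<otimes> r" for r
        proof -
          have "q i divides q x \<otimes> (n \<otimes> r)" using that(3) by (simp only: N.mult_ac)
          then have "q i divides n \<otimes> r" using coprime i x(1) False by blast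
          then show ?thesis using n(1) i that unfolding R_def by blast
        qed
        then show ?thesis by (metis N.dvd_mult2)
      qed simp
      obtain b where b: "\<And>i. i \<prec> a \<Longrightarrow> q i divides n \<Longrightarrow> \<exists>y. y \<prec> b \<and> \<theta> i y"
        using n(1) unfolding R_def by blast
      have 3: "\<exists>z. z \<prec> b \<oplus> (y \<oplus> \<one>) \<and> \<theta> i z" if i: "i \<prec> a" "q i divides n \<otimes> q x" for i
      proof (cases "i = x")
        case True
        then show ?thesis using x less_Suc by (metis N.less_le_trans le_add(2))
      next
        case False
        then have "q i divides n" using coprime i x(1) by (metis mult_commute)
        then show ?thesis using b i by (metis N.less_le_trans le_add(1))
      qed
      have "R (n \<otimes> q x)" unfolding R_def using 1 2 3 by blast
      then have "n \<otimes> q x \<preceq> n" using n(2) by blast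
      then have "q x \<preceq> \<one>"
        using mult_less_mono[of \<one> "q x" n] \<open>n \<noteq> \<zero>\<close> by (metis N.not_le mult_one pos_iff)
      then have "m \<otimes> (x \<oplus> \<one>) = \<zero>" by (metis N.add_le_same_cancel2 le_zero q_def)
      with \<open>m \<noteq> \<zero>\<close> show False by simp
    qed
    moreover have "\<phi> i" if "i \<prec> a" "q i divides n" for i
      using n(1) that unfolding R_def \<theta>(2) by blast
    ultimately have "D \<langle>\<langle>a, m\<rangle>, n\<rangle> = {i. i \<prec> a \<and> \<phi> i}"
      unfolding D_triple \<theta>(2) q_def by blast
    moreover have "\<langle>\<langle>a, m\<rangle>, n\<rangle> \<preceq> \<langle>\<langle>a, m\<rangle>, N\<rangle>" using R_le[OF n(1)] by (intro pair_mono) auto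
    ultimately show ?thesis by blast
  qed
  then show ?thesis by blast
qed

lemma sigma1_finite_below:
  assumes "sigma1 (\<lambda>v. \<phi> (v 0))" shows "\<exists>c. D c = {i. i \<prec> a \<and> \<phi> i}"
  using bounded_comprehension[of a] assms by blast

lemma sigma1_finite_set:
  assumes "sigma1 (\<lambda>v. \<phi> (v 0))" "\<And>i. \<phi> i \<Longrightarrow> i \<prec> a" shows "\<exists>c. D c = {i. \<phi> i}"
proof -
  obtain c where "D c = {i. i \<prec> a \<and> \<phi> i}" using sigma1_finite_below[OF assms(1)] ..
  with assms(2) show ?thesis by (intro exI[of _ c]) auto
qed

end

section \<open>Cardinalities and exactly large sets\<close>

context rca0 begin

lemma definable_least:
  assumes "definable (\<lambda>v. P (v 0))" "P x"
  shows "\<exists>x. P x \<and> (\<forall>y. y \<prec> x \<longrightarrow> \<not> P y)"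
proof (rule ccontr)
  assume *: "\<not> ?thesis"
  have P: "definable (\<lambda>v. P (t v))" if "term_definable t" for t using definable_subst1[OF assms(1) that] .
  have "definable (\<lambda>v. \<forall>y. y \<prec> v 0 \<longrightarrow> \<not> P y)" by (intro bounded_intros P)
  then have "\<forall>y. y \<prec> x \<oplus> \<one> \<longrightarrow> \<not> P y" by (rule definable_induct) (use * basic(8) in auto)
  with assms(2) less_Suc show False by blast
qed

text \<open>Upward induction on the negation of \<open>U\<close> would be Pi1 induction. Counting
  downwards from \<open>n\<close> instead, the claim that \<open>U\<close> holds at n - x is Sigma1
  and would survive up to x = n + 1.\<close>

lemma sigma1_downward:
  assumes "sigma1 (\<lambda>v. U (v 0))" "\<And>n. U (n \<oplus> \<one>) \<Longrightarrow> U n" "\<not> U \<zero>" shows "\<not> U n"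
proof
  assume "U n"
  have "sigma1 (\<lambda>v. \<exists>y. v 0 \<oplus> y = n \<and> U y)"
    by (intro sigma1_ex sigma1_conj sigma1_subst1[OF assms(1)] sigma1_definable bounded_intros)
  then have "\<exists>y. (n \<oplus> \<one>) \<oplus> y = n \<and> U y"
  proof (rule sigma1_induct)
    show "\<exists>y. \<zero> \<oplus> y = n \<and> U y" using \<open>U n\<close> zero_plus by blast
    fix x assume "\<exists>y. x \<oplus> y = n \<and> U y"
    then obtain y where y: "x \<oplus> y = n" "U y" by blast
    with assms(3) obtain z where z: "y = z \<oplus> \<one>" using nonzero_Suc by metis
    with y have "x \<oplus> \<one> \<oplus> z = n" by (simp only: N.add_ac)
    with y z assms(2) show "\<exists>y. x \<oplus> \<one> \<oplus> y = n \<and> U y" by blast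
  qed
  then show False by (metis less_irrefl Suc_le le_add(1))
qed

lemma pair_in_D: "\<langle>i, j\<rangle> \<in> D f \<Longrightarrow> i \<prec> f" "\<langle>i, j\<rangle> \<in> D f \<Longrightarrow> j \<prec> f"
  using D_less pair_le N.le_less_trans by blast+

lemma pair_less: "i \<prec> a \<Longrightarrow> j \<prec> b \<Longrightarrow> \<langle>i, j\<rangle> \<prec> \<langle>a, b\<rangle>"
  by (intro pair_less_aux N.add_strict_mono)

lemma D_less_add: "i \<in> D c \<Longrightarrow> i \<prec> c \<oplus> d" "i \<in> D c \<Longrightarrow> i \<prec> d \<oplus> c"
  by (meson D_less N.less_le_trans le_add)+

section \<open>Cardinalities of coded sets\<close>

definition enumeration :: "'a \<Rightarrow> 'a \<Rightarrow> 'a \<Rightarrow> bool" where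
  "enumeration f c n \<longleftrightarrow>
    (\<forall>p\<in>D f. \<exists>i j. i \<prec> n \<and> j \<in> D c \<and> p = \<langle>i, j\<rangle>) \<and>
    (\<forall>i. i \<prec> n \<longrightarrow> (\<exists>j. \<langle>i, j\<rangle> \<in> D f)) \<and>
    (\<forall>i j j'. \<langle>i, j\<rangle> \<in> D f \<and> \<langle>i, j'\<rangle> \<in> D f \<longrightarrow> j = j') \<and>
    (\<forall>j\<in>D c. \<exists>i. \<langle>i, j\<rangle> \<in> D f) \<and>
    (\<forall>i i' j. \<langle>i, j\<rangle> \<in> D f \<and> \<langle>i', j\<rangle> \<in> D f \<longrightarrow> i = i')"

lemma fin_card_enumeration: "fin_card_in M c n \<longleftrightarrow> (\<exists>f. enumeration f c n)"
  by (simp only: fin_card_in_def enumeration_def)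

lemma enumeration_bounded:
  "enumeration f c n \<longleftrightarrow>
    (\<forall>p. p \<prec> f \<longrightarrow> p \<in> D f \<longrightarrow> (\<exists>i. i \<prec> n \<and> (\<exists>j. j \<prec> c \<and> j \<in> D c \<and> p = \<langle>i, j\<rangle>))) \<and>
    (\<forall>i. i \<prec> n \<longrightarrow> (\<exists>j. j \<prec> f \<and> \<langle>i, j\<rangle> \<in> D f)) \<and>
    (\<forall>i. i \<prec> f \<longrightarrow> (\<forall>j. j \<prec> f \<longrightarrow> (\<forall>j'. j' \<prec> f \<longrightarrow> \<langle>i, j\<rangle> \<in> D f \<and> \<langle>i, j'\<rangle> \<in> D f \<longrightarrow> j = j'))) \<and>
    (\<forall>j. j \<prec> c \<longrightarrow> j \<in> D c \<longrightarrow> (\<exists>i. i \<prec> f \<and> \<langle>i, j\<rangle> \<in> D f)) \<and>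
    (\<forall>i. i \<prec> f \<longrightarrow> (\<forall>i'. i' \<prec> f \<longrightarrow> (\<forall>j. j \<prec> f \<longrightarrow> \<langle>i, j\<rangle> \<in> D f \<and> \<langle>i', j\<rangle> \<in> D f \<longrightarrow> i = i')))"
proof -
  have 1: "(\<exists>i j. i \<prec> n \<and> j \<in> D c \<and> p = \<langle>i, j\<rangle>) \<longleftrightarrow>
      (\<exists>i. i \<prec> n \<and> (\<exists>j. j \<prec> c \<and> j \<in> D c \<and> p = \<langle>i, j\<rangle>))" for p using D_less by blast
  have 2: "(\<exists>j. \<langle>i, j\<rangle> \<in> D f) \<longleftrightarrow> (\<exists>j. j \<prec> f \<and> \<langle>i, j\<rangle> \<in> D f)" for i using pair_in_D by blast
  have 3: "(\<exists>i. \<langle>i, j\<rangle> \<in> D f) \<longleftrightarrow> (\<exists>i. i \<prec> f \<and> \<langle>i, j\<rangle> \<in> D f)" for j using pair_in_D by blast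
  have 4: "(\<forall>i j j'. \<langle>i, j\<rangle> \<in> D f \<and> \<langle>i, j'\<rangle> \<in> D f \<longrightarrow> j = j') \<longleftrightarrow> (\<forall>i. i \<prec> f \<longrightarrow> (\<forall>j. j \<prec> f \<longrightarrow>
      (\<forall>j'. j' \<prec> f \<longrightarrow> \<langle>i, j\<rangle> \<in> D f \<and> \<langle>i, j'\<rangle> \<in> D f \<longrightarrow> j = j')))" by (metis pair_in_D)
  have 5: "(\<forall>i i' j. \<langle>i, j\<rangle> \<in> D f \<and> \<langle>i', j\<rangle> \<in> D f \<longrightarrow> i = i') \<longleftrightarrow> (\<forall>i. i \<prec> f \<longrightarrow> (\<forall>i'. i' \<prec> f \<longrightarrow>
      (\<forall>j. j \<prec> f \<longrightarrow> \<langle>i, j\<rangle> \<in> D f \<and> \<langle>i', j\<rangle> \<in> D f \<longrightarrow> i = i')))" by (metis pair_in_D)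
  have 6: "(\<forall>p\<in>D f. P p) \<longleftrightarrow> (\<forall>p. p \<prec> f \<longrightarrow> p \<in> D f \<longrightarrow> P p)" for P f using D_less by blast
  show ?thesis unfolding enumeration_def 1 2 3 4 5 6 ..
qed

lemma sigma1_fin_card [bounded_intros]: assumes "term_definable s" "term_definable t" shows "sigma1 (\<lambda>v. fin_card_in M (s v) (t v))"
proof -
  have "definable (\<lambda>v. enumeration (v 0) (v 1) (v 2))" unfolding enumeration_bounded by (intro bounded_intros)
  note e = definable_subst3[OF this]
  show ?thesis unfolding fin_card_enumeration
    by (intro sigma1_ex_definable e bounded_intros term_definable_ren[OF assms(1)] term_definable_ren[OF assms(2)])
qed

lemma enumeration_cong: "D c = D c' \<Longrightarrow> enumeration f c n \<longleftrightarrow> enumeration f c' n" by (simp add: enumeration_def)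

lemma fin_card_insert:
  assumes "fin_card_in M c n" "x \<notin> D c"
  shows "\<exists>c'. D c' = insert x (D c) \<and> fin_card_in M c' (n \<oplus> \<one>)"
proof -
  obtain f where f: "enumeration f c n" using assms(1) fin_card_enumeration by blast
  have "\<exists>c'. D c' = {i. i = x \<or> i \<in> D c}"
    by (rule sigma1_finite_set[where a = "x \<oplus> \<one> \<oplus> c"], rule sigma1_definable, intro bounded_intros)
      (use D_less less_Suc N.less_le_trans le_add in blast)
  then obtain c' where c': "D c' = insert x (D c)" by auto
  have "\<exists>g. D g = {i. i = \<langle>n, x\<rangle> \<or> i \<in> D f}"
    by (rule sigma1_finite_set[where a = "\<langle>n, x\<rangle> \<oplus> \<one> \<oplus> f"], rule sigma1_definable, intro bounded_intros)
      (use D_less less_Suc N.less_le_trans le_add in blast)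
  then obtain g where g: "D g = insert \<langle>n, x\<rangle> (D f)" by auto
  have n: "\<langle>n, j\<rangle> \<notin> D f" for j using f less_irrefl unfolding enumeration_def by fastforce
  have x: "\<langle>i, x\<rangle> \<notin> D f" for i using f assms(2) unfolding enumeration_def by fastforce
  have "enumeration g c' (n \<oplus> \<one>)"
    unfolding enumeration_def g c'
  proof (intro conjI)
    show "\<forall>p\<in>insert \<langle>n, x\<rangle> (D f). \<exists>i j. i \<prec> n \<oplus> \<one> \<and> j \<in> insert x (D c) \<and> p = \<langle>i, j\<rangle>"
      using f unfolding enumeration_def basic(8) by blast
    show "\<forall>i. i \<prec> n \<oplus> \<one> \<longrightarrow> (\<exists>j. \<langle>i, j\<rangle> \<in> insert \<langle>n, x\<rangle> (D f))"
      using f unfolding enumeration_def basic(8) by blast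
    show "\<forall>i j j'. \<langle>i, j\<rangle> \<in> insert \<langle>n, x\<rangle> (D f) \<and> \<langle>i, j'\<rangle> \<in> insert \<langle>n, x\<rangle> (D f) \<longrightarrow> j = j'"
      using f n unfolding enumeration_def by auto
    show "\<forall>j\<in>insert x (D c). \<exists>i. \<langle>i, j\<rangle> \<in> insert \<langle>n, x\<rangle> (D f)"
      using f unfolding enumeration_def by blast
    show "\<forall>i i' j. \<langle>i, j\<rangle> \<in> insert \<langle>n, x\<rangle> (D f) \<and> \<langle>i', j\<rangle> \<in> insert \<langle>n, x\<rangle> (D f) \<longrightarrow> i = i'"
      using f x unfolding enumeration_def insert_iff pair_inject by metis
  qed
  with c' fin_card_enumeration show ?thesis by blast
qed

lemma fin_card_empty: "D c = {} \<Longrightarrow> fin_card_in M c \<zero>"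
proof -
  have "\<exists>f. D f = {i. False}" by (rule sigma1_finite_set, rule sigma1_definable, intro bounded_intros) auto
  then show "D c = {} \<Longrightarrow> fin_card_in M c \<zero>" unfolding fin_card_enumeration enumeration_def by auto
qed

lemma fin_card_cong: "D c = D c' \<Longrightarrow> fin_card_in M c n \<longleftrightarrow> fin_card_in M c' n"
  unfolding fin_card_enumeration using enumeration_cong by blast

text \<open>Induction over the initial segments of \<open>D c\<close>. That \<open>D d\<close>
  equals such a segment is tested only below \<open>c \<oplus> d\<close>, which exceeds all elements
  of both sets and keeps the predicate Sigma1.\<close>

lemma fin_card_exists: "\<exists>n. fin_card_in M c n"
proof -
  let ?P = "\<lambda>k. \<exists>d n. fin_card_in M d n \<and> (\<forall>i. i \<prec> c \<oplus> d \<longrightarrow> (i \<in> D d \<longleftrightarrow> i \<in> D c \<and> i \<prec> k))"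
  have iff: "(\<forall>i. i \<prec> c \<oplus> d \<longrightarrow> (i \<in> D d \<longleftrightarrow> i \<in> D c \<and> i \<prec> k)) \<longleftrightarrow> D d = {i \<in> D c. i \<prec> k}" for d k
    using D_less_add by blast
  have "sigma1 (\<lambda>v. ?P (v 0))"
    by (intro sigma1_ex sigma1_conj sigma1_fin_card bounded_intros, rule sigma1_definable, intro bounded_intros)
  then have "?P c"
  proof (rule sigma1_induct)
    obtain d where "D d = {}"
      using sigma1_finite_set[of "\<lambda>_. False" \<zero>, OF sigma1_definable[OF definable_bool]] by auto
    then show "?P \<zero>" unfolding iff using fin_card_empty by auto
  next
    fix k assume "?P k"
    then obtain d n where d: "fin_card_in M d n" "D d = {i \<in> D c. i \<prec> k}" unfolding iff by blast
    show "?P (k \<oplus> \<one>)"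
    proof (cases "k \<in> D c")
      case True
      have "k \<notin> D d" using d(2) less_irrefl by blast
      with d fin_card_insert obtain d' where "D d' = insert k (D d)" "fin_card_in M d' (n \<oplus> \<one>)" by blast
      moreover from this d(2) True have "D d' = {i \<in> D c. i \<prec> k \<oplus> \<one>}" by (auto simp: basic(8))
      ultimately show ?thesis unfolding iff by blast
    next
      case False
      then have "D d = {i \<in> D c. i \<prec> k \<oplus> \<one>}" by (auto simp: d(2) basic(8))
      with d(1) show ?thesis unfolding iff by blast
    qed
  qed
  then obtain d n where d: "fin_card_in M d n" "D d = {i \<in> D c. i \<prec> c}" unfolding iff by blast
  moreover have "{i \<in> D c. i \<prec> c} = D c" using D_less by blast
  ultimately show ?thesis using fin_card_cong by metis
qed

text \<open>The existence of a coded counterexample is Sigma1, so \<open>sigma1_downward\<close>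
  applies: removing the argument with value \<open>n\<close> and closing the gap gives a
  counterexample one size smaller.\<close>

lemma pigeonhole:
  assumes "\<And>i. i \<prec> n \<oplus> \<one> \<Longrightarrow> \<exists>j. j \<prec> n \<and> \<langle>i, j\<rangle> \<in> D f"
    and "\<And>i i' j. \<langle>i, j\<rangle> \<in> D f \<Longrightarrow> \<langle>i', j\<rangle> \<in> D f \<Longrightarrow> i = i'"
  shows False
proof -
  define U where "U n \<longleftrightarrow> (\<exists>f. (\<forall>i. i \<prec> n \<oplus> \<one> \<longrightarrow> (\<exists>j. j \<prec> n \<and> \<langle>i, j\<rangle> \<in> D f)) \<and>
    (\<forall>i. i \<prec> f \<longrightarrow> (\<forall>i'. i' \<prec> f \<longrightarrow> (\<forall>j. j \<prec> f \<longrightarrow> \<langle>i, j\<rangle> \<in> D f \<and> \<langle>i', j\<rangle> \<in> D f \<longrightarrow> i = i'))))" for n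
  have "\<not> U n"
  proof (rule sigma1_downward[of U])
    show "sigma1 (\<lambda>v. U (v 0))" unfolding U_def by (intro sigma1_ex_definable bounded_intros)
    show "\<not> U \<zero>" unfolding U_def using less_Suc not_less_zero by blast
    fix n assume "U (n \<oplus> \<one>)"
    then obtain f where f: "\<And>i. i \<prec> n \<oplus> \<one> \<oplus> \<one> \<Longrightarrow> \<exists>j. j \<prec> n \<oplus> \<one> \<and> \<langle>i, j\<rangle> \<in> D f"
      and inj: "\<And>i i' j. \<langle>i, j\<rangle> \<in> D f \<Longrightarrow> \<langle>i', j\<rangle> \<in> D f \<Longrightarrow> i = i'"
      unfolding U_def by (metis pair_in_D)
    \<comment> \<open>The only possible argument with value \<open>n\<close>; any argument will do
      if that value is not attained.\<close>
    obtain k where k: "\<And>i. \<langle>i, n\<rangle> \<in> D f \<Longrightarrow> i \<prec> n \<oplus> \<one> \<oplus> \<one> \<Longrightarrow> i = k" "k \<prec> n \<oplus> \<one> \<oplus> \<one>"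
      using inj less_Suc by metis
    have "\<exists>g. D g = {p. \<exists>i j. p = \<langle>i, j\<rangle> \<and> i \<prec> n \<oplus> \<one> \<and> j \<prec> n \<and>
        (i \<prec> k \<and> p \<in> D f \<or> \<not> i \<prec> k \<and> \<langle>i \<oplus> \<one>, j\<rangle> \<in> D f)}"
      by (rule sigma1_finite_set[where a = "\<langle>n \<oplus> \<one>, n\<rangle>"], intro sigma1_ex, rule sigma1_definable, intro bounded_intros)
        (auto intro: pair_less)
    then obtain g where "D g = {p. \<exists>i j. p = \<langle>i, j\<rangle> \<and> i \<prec> n \<oplus> \<one> \<and> j \<prec> n \<and>
        (i \<prec> k \<and> p \<in> D f \<or> \<not> i \<prec> k \<and> \<langle>i \<oplus> \<one>, j\<rangle> \<in> D f)}" by blast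
    then have g: "\<langle>i, j\<rangle> \<in> D g \<longleftrightarrow> i \<prec> n \<oplus> \<one> \<and> j \<prec> n \<and>
        (i \<prec> k \<and> \<langle>i, j\<rangle> \<in> D f \<or> \<not> i \<prec> k \<and> \<langle>i \<oplus> \<one>, j\<rangle> \<in> D f)" for i j by auto
    have "\<exists>j. j \<prec> n \<and> \<langle>i, j\<rangle> \<in> D g" if i: "i \<prec> n \<oplus> \<one>" for i
    proof -
      define i' where "i' = (if i \<prec> k then i else i \<oplus> \<one>)"
      have i': "i' \<prec> n \<oplus> \<one> \<oplus> \<one>" "i' \<noteq> k"
        using i less_Suc_mono less_trans less_Suc less_irrefl unfolding i'_def
        by (auto simp: basic(8))
      then obtain j where j: "j \<prec> n \<oplus> \<one>" "\<langle>i', j\<rangle> \<in> D f" using f by blast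
      with k i' have "j \<prec> n" unfolding basic(8) by blast
      with i j show ?thesis unfolding g i'_def by (metis (full_types))
    qed
    moreover have "i = i'" if "\<langle>i, j\<rangle> \<in> D g" "\<langle>i', j\<rangle> \<in> D g" for i i' j
      using that inj unfolding g by (metis basic(2) less_trans less_Suc)
    ultimately show "U n" unfolding U_def by blast
  qed
  then show False unfolding U_def using assms by blast
qed

text \<open>Following the longer enumeration by the inverse of the shorter one would inject n + 1
  indices into n.\<close>

lemma fin_card_unique: assumes "fin_card_in M c n" "fin_card_in M c n'" shows "n = n'"
proof -
  have False if c: "fin_card_in M c n" "fin_card_in M c n'" "n \<prec> n'" for n n'
  proof -
    obtain f g where f: "enumeration f c n" and g: "enumeration g c n'" using c fin_card_enumeration by blast
    have "\<exists>h. D h = {p. \<exists>i j. p = \<langle>i, j\<rangle> \<and> i \<prec> n \<oplus> \<one> \<and> j \<prec> n \<and> (\<exists>y. \<langle>i, y\<rangle> \<in> D g \<and> \<langle>j, y\<rangle> \<in> D f)}"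
      by (rule sigma1_finite_set[where a = "\<langle>n \<oplus> \<one>, n\<rangle>"], intro sigma1_ex sigma1_conj; (rule sigma1_definable, intro bounded_intros)?)
        (auto intro: pair_less)
    then obtain h where "D h = {p. \<exists>i j. p = \<langle>i, j\<rangle> \<and> i \<prec> n \<oplus> \<one> \<and> j \<prec> n \<and> (\<exists>y. \<langle>i, y\<rangle> \<in> D g \<and> \<langle>j, y\<rangle> \<in> D f)}"
      by blast
    then have h: "\<langle>i, j\<rangle> \<in> D h \<longleftrightarrow> i \<prec> n \<oplus> \<one> \<and> j \<prec> n \<and> (\<exists>y. \<langle>i, y\<rangle> \<in> D g \<and> \<langle>j, y\<rangle> \<in> D f)" for i j
      by auto
    show False
    proof (rule pigeonhole[of n h])
      fix i assume i: "i \<prec> n \<oplus> \<one>"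
      then have "i \<prec> n'" using c(3) unfolding less_Suc_le by order
      then obtain y where y: "\<langle>i, y\<rangle> \<in> D g" using g unfolding enumeration_def by blast
      then have "y \<in> D c" using g unfolding enumeration_def by fastforce
      then obtain j where j: "\<langle>j, y\<rangle> \<in> D f" using f unfolding enumeration_def by blast
      then have "j \<prec> n" using f unfolding enumeration_def by fastforce
      with i y j show "\<exists>j. j \<prec> n \<and> \<langle>i, j\<rangle> \<in> D h" unfolding h by blast
    next
      fix i i' j assume "\<langle>i, j\<rangle> \<in> D h" "\<langle>i', j\<rangle> \<in> D h"
      then obtain y y' where "\<langle>i, y\<rangle> \<in> D g" "\<langle>j, y\<rangle> \<in> D f" "\<langle>i', y'\<rangle> \<in> D g" "\<langle>j, y'\<rangle> \<in> D f"
        unfolding h by blast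
      moreover from this(2,4) f have "y = y'" unfolding enumeration_def by blast
      ultimately show "i = i'" using g unfolding enumeration_def by blast
    qed
  qed
  then show ?thesis using assms less_linear by blast
qed

section \<open>Canonical codes and the decidability of exact largeness\<close>

lemma definable_triple: "definable (\<lambda>v. is_triple_in M (v 0))"
proof -
  have "is_triple_in M c \<longleftrightarrow> (\<exists>k. k \<prec> c \<oplus> \<one> \<and> (\<exists>m. m \<prec> c \<oplus> \<one> \<and> (\<exists>n. n \<prec> c \<oplus> \<one> \<and>
    c = \<langle>\<langle>k, m\<rangle>, n\<rangle>)))" for c
    unfolding is_triple_in_def less_Suc_le using pair_le N.order_trans by metis
  then show ?thesis by (simp only:) (intro bounded_intros)
qed

lemma definable_fin_code [bounded_intros]: assumes "term_definable t" shows "definable (\<lambda>v. fin_code_in M (t v))"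
proof -
  have "fin_code_in M c \<longleftrightarrow> is_triple_in M c \<and> (\<forall>d. d \<prec> c \<longrightarrow> is_triple_in M d \<longrightarrow>
      \<not> (\<forall>i. i \<prec> d \<oplus> c \<longrightarrow> (i \<in> D d \<longleftrightarrow> i \<in> D c)))" for c
    unfolding fin_code_in_def using D_less_add by blast
  then have "definable (\<lambda>v. fin_code_in M (v 0))" by (simp only:) (intro bounded_intros definable_subst1[OF definable_triple])
  from definable_subst1[OF this assms] show ?thesis .
qed

text \<open>Least number principle for bounded formulas. A number that is no triple represents the
  empty set, and so does the triple of zeros, so some triple always exists.\<close>

lemma fin_code_exists: "\<exists>c. fin_code_in M c \<and> D c = D z"
proof -
  let ?P = "\<lambda>c. is_triple_in M c \<and> (\<forall>i. i \<prec> c \<oplus> z \<longrightarrow> (i \<in> D c \<longleftrightarrow> i \<in> D z))"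
  have iff: "(\<forall>i. i \<prec> c \<oplus> d \<longrightarrow> (i \<in> D c \<longleftrightarrow> i \<in> D d)) \<longleftrightarrow> D c = D d" for c d
    using D_less_add by blast
  have "\<exists>x. ?P x"
  proof (cases "is_triple_in M z")
    case False
    then have "D z = {}" unfolding fin_set_in_def is_triple_in_def by blast
    moreover have "D \<langle>\<langle>\<zero>, \<zero>\<rangle>, \<zero>\<rangle> = {}" unfolding D_triple by simp
    ultimately show ?thesis unfolding iff is_triple_in_def by blast
  qed blast
  moreover have "definable (\<lambda>v. ?P (v 0))"
    by (intro bounded_intros definable_subst1[OF definable_triple])
  ultimately obtain c where c: "?P c" "\<And>d. d \<prec> c \<Longrightarrow> \<not> ?P d" using definable_least[of ?P] by blast
  then have "fin_code_in M c" unfolding fin_code_in_def iff by metis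
  with c(1) show ?thesis unfolding iff by blast
qed

lemma D_least: "D c \<noteq> {} \<Longrightarrow> \<exists>m\<in>D c. \<forall>i\<in>D c. \<not> i \<prec> m"
proof -
  assume "D c \<noteq> {}"
  then obtain x where "x \<in> D c" by blast
  have "definable (\<lambda>v. v 0 \<in> D c)" by (intro bounded_intros)
  from definable_least[OF this \<open>x \<in> D c\<close>] show ?thesis by blast
qed

text \<open>Having a given cardinality is Sigma1 by form. Its failure is Sigma1 too, because a
  cardinality exists and is unique: some other \<open>n\<close> is the cardinality. This brings
  colourings of exactly large sets within reach of recursive comprehension.\<close>

lemma sigma1_exactly_large: assumes "term_definable t"
  shows "sigma1 (\<lambda>v. exactly_large_in M (t v))" "sigma1 (\<lambda>v. \<not> exactly_large_in M (t v))"
proof -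
  have iff: "exactly_large_in M c \<longleftrightarrow> fin_code_in M c \<and>
      (\<exists>m. (m \<in> D c \<and> (\<forall>i. i \<prec> c \<longrightarrow> i \<in> D c \<longrightarrow> \<not> i \<prec> m)) \<and> fin_card_in M c (m \<oplus> \<one>))" for c
    unfolding exactly_large_in_def using D_less by blast
  have niff: "\<not> exactly_large_in M c \<longleftrightarrow> (\<not> fin_code_in M c \<or> (\<forall>i. i \<prec> c \<longrightarrow> i \<notin> D c)) \<or>
      (\<exists>m n. (n \<noteq> m \<oplus> \<one> \<and> m \<in> D c \<and> (\<forall>i. i \<prec> c \<longrightarrow> i \<in> D c \<longrightarrow> \<not> i \<prec> m)) \<and> fin_card_in M c n)"
    (is "?L \<longleftrightarrow> ?A \<or> ?B") for c
  proof
    assume ?L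
    show "?A \<or> ?B"
    proof (cases ?A)
      case False
      then obtain m where m: "m \<in> D c" "\<forall>i\<in>D c. \<not> i \<prec> m" using D_least by blast
      obtain n where n: "fin_card_in M c n" using fin_card_exists by blast
      then have "n \<noteq> m \<oplus> \<one>" using m False \<open>?L\<close> unfolding exactly_large_in_def by blast
      with m n show ?thesis by blast
    qed blast
  next
    assume "?A \<or> ?B"
    then show ?L
    proof
      show "?A \<Longrightarrow> ?L" unfolding exactly_large_in_def using D_less by blast
      assume ?B
      then obtain m n where m: "n \<noteq> m \<oplus> \<one>" "m \<in> D c" "\<forall>i\<in>D c. \<not> i \<prec> m" "fin_card_in M c n"
        using D_less by blast
      have "m' = m" if "m' \<in> D c" "\<forall>i\<in>D c. \<not> i \<prec> m'" for m' using that m less_linear by blast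
      with m show ?L unfolding exactly_large_in_def using fin_card_unique by blast
    qed
  qed
  have "sigma1 (\<lambda>v. exactly_large_in M (v 0))" unfolding iff
    by (rule sigma1_conj, rule sigma1_definable, intro bounded_intros, rule sigma1_ex, rule sigma1_conj, rule sigma1_definable, intro bounded_intros, intro bounded_intros)
  then show "sigma1 (\<lambda>v. exactly_large_in M (t v))" using assms by (rule sigma1_subst1)
  have "sigma1 (\<lambda>v. \<not> exactly_large_in M (v 0))" unfolding niff
    by (rule sigma1_disj, rule sigma1_definable, intro bounded_intros, intro sigma1_ex, rule sigma1_conj, rule sigma1_definable, intro bounded_intros, intro bounded_intros)
  then show "sigma1 (\<lambda>v. \<not> exactly_large_in M (t v))"
    using assms by (rule sigma1_subst1[of "\<lambda>x. \<not> exactly_large_in M x"])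
qed

lemma exactly_large_exists:
  assumes "fin_card_in M z (m \<oplus> \<one>)" "m \<in> D z" "\<And>i. i \<in> D z \<Longrightarrow> \<not> i \<prec> m"
  shows "\<exists>c. exactly_large_in M c \<and> D c = D z"
proof -
  obtain c where "fin_code_in M c" "D c = D z" using fin_code_exists by blast
  with assms show ?thesis unfolding exactly_large_in_def using fin_card_cong by metis
qed

text \<open>New elements are taken beyond the code \<open>z\<close>, hence above all old elements;
  prescribed least elements survive the extension.\<close>

lemma extend_in_infinite:
  assumes L: "L \<in> S" "infinite_in M L" and "fin_card_in M z n"
  shows "\<exists>z'. fin_card_in M z' (n \<oplus> k) \<and> D z \<subseteq> D z' \<and> (\<forall>i\<in>D z'. i \<in> D z \<or> i \<in> L \<and> \<not> i \<prec> z)"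
proof -
  let ?P = "\<lambda>k. \<exists>z'. fin_card_in M z' (n \<oplus> k) \<and> (\<forall>i. i \<prec> z \<longrightarrow> i \<in> D z \<longrightarrow> i \<in> D z') \<and>
    (\<forall>i. i \<prec> z' \<longrightarrow> i \<in> D z' \<longrightarrow> i \<in> D z \<or> i \<in> L \<and> \<not> i \<prec> z)"
  have "sigma1 (\<lambda>v. ?P (v 0))"
    by (intro sigma1_ex sigma1_conj sigma1_fin_card bounded_intros, (rule sigma1_definable, intro bounded_intros L)+)
  then have "?P k"
  proof (rule sigma1_induct)
    show "?P \<zero>" using assms(3) by auto
    fix k assume "?P k"
    then obtain z' where z': "fin_card_in M z' (n \<oplus> k)" "\<forall>i. i \<prec> z \<longrightarrow> i \<in> D z \<longrightarrow> i \<in> D z'"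
      "\<forall>i. i \<prec> z' \<longrightarrow> i \<in> D z' \<longrightarrow> i \<in> D z \<or> i \<in> L \<and> \<not> i \<prec> z" by blast
    obtain e where e: "e \<in> L" "z' \<oplus> z \<prec> e" using L(2) by (auto simp: infinite_in_def)
    then have "e \<notin> D z'" "\<not> e \<prec> z" using D_less_add less_irrefl
      by (meson N.less_trans, meson N.le_less_trans N.less_imp_le le_add(2) N.not_less)
    with fin_card_insert[OF z'(1)] obtain z'' where
      "D z'' = insert e (D z')" "fin_card_in M z'' (n \<oplus> k \<oplus> \<one>)" by blast
    then show "?P (k \<oplus> \<one>)" using z' e \<open>\<not> e \<prec> z\<close> D_less unfolding basic(4)
      by (intro exI[of _ z'']) auto
  qed
  then show ?thesis using D_less by blast
qed

text \<open>Induction on the implication itself would exceed Sigma1, as its premise is unbounded.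
  Collecting the \<open>x\<close> that have a witness in a code \<open>c\<close> beforehand turns
  the premise into a bounded one.\<close>

lemma strong_bounding:
  assumes "sigma1 (\<lambda>v. \<exists>y. \<theta> (v 0) y)" "\<And>s t. term_definable s \<Longrightarrow> term_definable t \<Longrightarrow> definable (\<lambda>v. \<theta> (s v) (t v))"
  shows "\<exists>b. \<forall>x. x \<prec> a \<longrightarrow> (\<exists>y. \<theta> x y) \<longrightarrow> (\<exists>y. y \<prec> b \<and> \<theta> x y)"
proof -
  obtain c where c: "D c = {x. x \<prec> a \<and> (\<exists>y. \<theta> x y)}"
    using sigma1_finite_below[OF assms(1)] ..
  have "sigma1 (\<lambda>v. \<exists>b. \<forall>x. x \<prec> v 0 \<longrightarrow> x \<in> D c \<longrightarrow> (\<exists>y. y \<prec> b \<and> \<theta> x y))"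
    by (intro sigma1_ex_definable bounded_intros assms(2))
  then have "\<exists>b. \<forall>x. x \<prec> a \<longrightarrow> x \<in> D c \<longrightarrow> (\<exists>y. y \<prec> b \<and> \<theta> x y)"
  proof (rule sigma1_induct)
    fix k assume "\<exists>b. \<forall>x. x \<prec> k \<longrightarrow> x \<in> D c \<longrightarrow> (\<exists>y. y \<prec> b \<and> \<theta> x y)"
    then obtain b where b: "\<And>x. x \<prec> k \<Longrightarrow> x \<in> D c \<Longrightarrow> \<exists>y. y \<prec> b \<and> \<theta> x y" by blast
    obtain y where y: "k \<in> D c \<Longrightarrow> \<theta> k y" using c by blast
    have "\<exists>y'. y' \<prec> b \<oplus> (y \<oplus> \<one>) \<and> \<theta> x y'" if "x \<prec> k \<oplus> \<one>" "x \<in> D c" for x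
    proof (cases "x = k")
      case True
      with that y have "\<theta> x y" by blast
      moreover have "y \<prec> b \<oplus> (y \<oplus> \<one>)" using less_Suc[of y] N.less_le_trans le_add(2) by blast
      ultimately show ?thesis by blast
    next
      case False
      with that b obtain y' where "y' \<prec> b" "\<theta> x y'" unfolding basic(8) by blast
      then show ?thesis using N.less_le_trans[OF _ le_add(1)] by blast
    qed
    then show "\<exists>b. \<forall>x. x \<prec> k \<oplus> \<one> \<longrightarrow> x \<in> D c \<longrightarrow> (\<exists>y. y \<prec> b \<and> \<theta> x y)" by blast
  qed simp
  then show ?thesis unfolding c by blast
qed

end

section \<open>Homogeneous sets and arithmetical comprehension\<close>

locale rca0_rt = rca0 +
  assumes RT: "N \<in> S \<Longrightarrow> infinite_in M N \<Longrightarrow> C \<in> S \<Longrightarrow> coloring_in M C \<Longrightarrow>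
    \<exists>L\<in>S. infinite_in M L \<and> L \<subseteq> N \<and>
      (\<exists>x. \<forall>c. exactly_large_in M c \<and> D c \<subseteq> L \<longrightarrow> \<langle>c, x\<rangle> \<in> C)"
begin

text \<open>Any bounded property of the code acts as a colouring, with 1 for true. Its graph is
  Delta1 by both halves of \<open>sigma1_exactly_large\<close>, a number that codes no pair being
  recognised by bounded search.\<close>

lemma homogeneous:
  assumes "definable (\<lambda>v. \<psi> (v 0))"
  obtains L b where "L \<in> S" "infinite_in M L"
    "\<And>c. exactly_large_in M c \<Longrightarrow> D c \<subseteq> L \<Longrightarrow> \<psi> c \<longleftrightarrow> b"
proof -
  have \<psi>: "definable (\<lambda>v. \<psi> (t v))" if "term_definable t" for t using definable_subst1[OF assms that] .
  define C where "C = {p. \<exists>c x. p = \<langle>c, x\<rangle> \<and> exactly_large_in M c \<and> (\<psi> c \<and> x = \<one> \<or> \<not> \<psi> c \<and> x = \<zero>)}"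
  have C: "\<langle>c, x\<rangle> \<in> C \<longleftrightarrow> exactly_large_in M c \<and> (\<psi> c \<and> x = \<one> \<or> \<not> \<psi> c \<and> x = \<zero>)" for c x
    unfolding C_def by simp
  have "C \<in> S" unfolding C_def
  proof (rule comprehension)
    show "sigma1 (\<lambda>v. \<exists>c x. v 0 = \<langle>c, x\<rangle> \<and> exactly_large_in M c \<and> (\<psi> c \<and> x = \<one> \<or> \<not> \<psi> c \<and> x = \<zero>))"
      by (intro sigma1_ex sigma1_conj sigma1_exactly_large bounded_intros; rule sigma1_definable; intro bounded_intros \<psi>)
    have "(\<not> (\<exists>c x. p = \<langle>c, x\<rangle> \<and> exactly_large_in M c \<and> (\<psi> c \<and> x = \<one> \<or> \<not> \<psi> c \<and> x = \<zero>))) \<longleftrightarrow>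
      (\<forall>c. c \<prec> p \<oplus> \<one> \<longrightarrow> (\<forall>x. x \<prec> p \<oplus> \<one> \<longrightarrow> p \<noteq> \<langle>c, x\<rangle>)) \<or>
      (\<exists>c x. p = \<langle>c, x\<rangle> \<and> (\<not> exactly_large_in M c \<or> \<not> (\<psi> c \<and> x = \<one> \<or> \<not> \<psi> c \<and> x = \<zero>)))" for p
    proof (cases "\<exists>c x. p = \<langle>c, x\<rangle>")
      case True
      then obtain c x where p: "p = \<langle>c, x\<rangle>" by blast
      show ?thesis using pair_le(1)[of c x] pair_le(2)[of x c] by (simp add: p less_Suc_le) blast
    qed blast
    then show "sigma1 (\<lambda>v. \<not> (\<exists>c x. v 0 = \<langle>c, x\<rangle> \<and> exactly_large_in M c \<and> (\<psi> c \<and> x = \<one> \<or> \<not> \<psi> c \<and> x = \<zero>)))"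
      by (simp only:) (intro sigma1_disj sigma1_ex sigma1_conj sigma1_exactly_large bounded_intros; rule sigma1_definable; intro bounded_intros \<psi>)
  qed
  moreover have "coloring_in M C"
    unfolding coloring_in_def
  proof (intro conjI)
    show "\<forall>p\<in>C. \<exists>c x. exactly_large_in M c \<and> x \<prec> \<one> \<oplus> \<one> \<and> p = \<langle>c, x\<rangle>"
      unfolding C_def less_Suc_le by auto
    show "\<forall>c. exactly_large_in M c \<longrightarrow> (\<exists>x. \<langle>c, x\<rangle> \<in> C)" unfolding C by blast
    show "\<forall>c x y. \<langle>c, x\<rangle> \<in> C \<and> \<langle>c, y\<rangle> \<in> C \<longrightarrow> x = y" unfolding C by blast
  qed
  moreover have "UNIV \<in> S" using definable_comprehension[of "\<lambda>_. True", OF definable_bool] by simp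
  moreover have "infinite_in M UNIV" unfolding infinite_in_def using less_Suc by blast
  ultimately obtain L x where L: "L \<in> S" "infinite_in M L"
    "\<forall>c. exactly_large_in M c \<and> D c \<subseteq> L \<longrightarrow> \<langle>c, x\<rangle> \<in> C" using RT by blast
  have "\<psi> c \<longleftrightarrow> x = \<one>" if "exactly_large_in M c" "D c \<subseteq> L" for c
    using L(3) that N.zero_neq_one unfolding C by metis
  then show thesis by (rule that[OF L(1,2)])
qed

text \<open>The colour is positive because, for a given \<open>a\<close>,
  \<open>strong_bounding\<close> allows a second element \<open>b\<close> beyond all witnesses
  required below \<open>a\<close>. Given the positive colour, any \<open>b\<close> above
  \<open>a\<close> in \<open>L\<close> decides all \<open>x\<close> below \<open>a\<close>: a third
  element \<open>d\<close> beyond a given witness shows that one exists below \<open>b\<close>.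
  Hence the complement is Sigma1 as well.\<close>

theorem arithmetical_comprehension:
  assumes "definable (\<lambda>v. \<theta> (v 0) (v 1))"
  shows "{x. \<exists>y. \<theta> x y} \<in> S"
proof -
  note \<theta> = definable_subst2[OF assms]
  define \<psi> where "\<psi> c \<longleftrightarrow> (\<exists>a. a \<prec> c \<and> a \<in> D c \<and> (\<exists>b. b \<prec> c \<and> b \<in> D c \<and> a \<prec> b \<and>
    (\<forall>i. i \<prec> c \<longrightarrow> i \<in> D c \<longrightarrow> i = a \<or> \<not> i \<prec> b) \<and>
    (\<forall>d. d \<prec> c \<longrightarrow> d \<in> D c \<longrightarrow> (\<forall>x. x \<prec> a \<longrightarrow> (\<exists>y. y \<prec> d \<and> \<theta> x y) \<longrightarrow> (\<exists>y. y \<prec> b \<and> \<theta> x y)))))" for c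
  have "definable (\<lambda>v. \<psi> (v 0))" unfolding \<psi>_def by (intro bounded_intros \<theta>)
  then obtain L col where L: "L \<in> S" "infinite_in M L"
    and hom: "\<And>c. exactly_large_in M c \<Longrightarrow> D c \<subseteq> L \<Longrightarrow> \<psi> c \<longleftrightarrow> col" by (rule homogeneous) (rule that)
  have big: "\<exists>x\<in>L. m \<prec> x" for m using L(2) by (auto simp: infinite_in_def)
  \<comment> \<open>With \<open>a\<close> above 1, the \<open>a \<oplus> \<one>\<close> elements
    leave room for \<open>a\<close>, \<open>b\<close> and \<open>d\<close>. The other a - 2 are
    taken beyond these, so \<open>a\<close> and \<open>b\<close> are the two least elements.\<close>
  have large: "\<exists>c. exactly_large_in M c \<and> D c \<subseteq> L \<and> a \<in> D c \<and> b \<in> D c \<and> d \<in> D c \<and>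
      (\<forall>i\<in>D c. i = a \<or> \<not> i \<prec> b)"
    if abd: "a \<in> L" "b \<in> L" "d \<in> L" "\<one> \<prec> a" "a \<prec> b" "b \<prec> d" for a b d
  proof -
    obtain z0 where z0: "D z0 = {}" "fin_card_in M z0 \<zero>"
      using sigma1_finite_set[of "\<lambda>_. False" \<zero>, OF sigma1_definable[OF definable_bool]] fin_card_empty by auto
    obtain z1 where z1: "D z1 = {a}" "fin_card_in M z1 \<one>"
      using fin_card_insert[OF z0(2), of a] z0(1) zero_plus by auto
    obtain z2 where z2: "D z2 = {a, b}" "fin_card_in M z2 (\<one> \<oplus> \<one>)"
      using fin_card_insert[OF z1(2), of b] z1(1) abd less_irrefl by (auto simp: insert_commute)
    have "d \<notin> D z2" using abd less_irrefl less_trans unfolding z2 by blast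
    then obtain z3 where z3: "D z3 = {a, b, d}" "fin_card_in M z3 (\<one> \<oplus> \<one> \<oplus> \<one>)"
      using fin_card_insert[OF z2(2), of d] z2(1) by (auto simp: insert_commute)
    obtain k where "\<one> \<oplus> \<one> \<oplus> k = a"
      using abd(4) unfolding Suc_le[symmetric] le_iff by blast
    moreover have "\<one> \<oplus> \<one> \<oplus> k \<oplus> \<one> = \<one> \<oplus> \<one> \<oplus> \<one> \<oplus> k" by (simp only: N.add_ac)
    ultimately have "\<one> \<oplus> \<one> \<oplus> \<one> \<oplus> k = a \<oplus> \<one>" by simp
    with extend_in_infinite[OF L z3(2), of k] obtain z where z: "fin_card_in M z (a \<oplus> \<one>)"
      "D z3 \<subseteq> D z" "\<forall>i\<in>D z. i \<in> D z3 \<or> i \<in> L \<and> \<not> i \<prec> z3" by auto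
    have "b \<prec> z3" using D_less z3 by blast
    then have "i = a \<or> \<not> i \<prec> b" if "i \<in> D z" for i
      using that z(3) abd z3(1) less_trans less_irrefl by blast
    moreover from this have "\<not> i \<prec> a" if "i \<in> D z" for i
      using that abd(5) less_trans less_irrefl by blast
    moreover have "D z \<subseteq> L" using z(3) z3(1) abd by auto
    ultimately show ?thesis using exactly_large_exists[OF z(1)] z z3(1) by (metis insert_subset)
  qed
  \<comment> \<open>The elements quantified in \<open>\<psi>\<close> are forced to be the two least
    ones of \<open>D c\<close>, so the colour speaks about the given \<open>a\<close> and
    \<open>b\<close>.\<close>
  have unique: "(\<exists>y. y \<prec> d \<and> \<theta> x y) \<longrightarrow> (\<exists>y. y \<prec> b \<and> \<theta> x y)"
    if asm: "\<psi> c" "a \<in> D c" "b \<in> D c" "d \<in> D c" "\<forall>i\<in>D c. i = a \<or> \<not> i \<prec> b" "a \<prec> b" "x \<prec> a" for a b d c x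
  proof -
    obtain a' b' where ab': "a' \<in> D c" "b' \<in> D c" "a' \<prec> b'"
        "\<forall>i. i \<prec> c \<longrightarrow> i \<in> D c \<longrightarrow> i = a' \<or> \<not> i \<prec> b'"
      and *: "\<forall>d. d \<prec> c \<longrightarrow> d \<in> D c \<longrightarrow>
        (\<forall>x. x \<prec> a' \<longrightarrow> (\<exists>y. y \<prec> d \<and> \<theta> x y) \<longrightarrow> (\<exists>y. y \<prec> b' \<and> \<theta> x y))"
      using asm(1) unfolding \<psi>_def by (elim exE conjE) (rule that)
    then have ab: "a' \<in> D c" "b' \<in> D c" "a' \<prec> b'" "\<forall>i\<in>D c. i = a' \<or> \<not> i \<prec> b'"
      using D_less by auto
    have a: "a = a'"
      using ab(1,3,4) asm(2,5,6) by (metis less_irrefl less_linear less_trans)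
    have b: "b = b'"
      using ab(2,3,4) asm(3,5,6) a by (metis less_irrefl less_linear)
    show ?thesis using *[rule_format, OF D_less[OF asm(4)] asm(4)] asm(7) unfolding a b by blast
  qed
  obtain a0 where a0: "a0 \<in> L" "\<one> \<prec> a0" using big by blast
  have sigma1_range: "sigma1 (\<lambda>v. \<exists>y. \<theta> (v 0) y)" by (intro sigma1_ex_definable \<theta> bounded_intros)
  have col
  proof -
    obtain b0 where b0: "\<And>x y. x \<prec> a0 \<Longrightarrow> \<theta> x y \<Longrightarrow> \<exists>y. y \<prec> b0 \<and> \<theta> x y"
      using strong_bounding[OF sigma1_range \<theta>] by blast
    obtain b where b: "b \<in> L" "a0 \<oplus> b0 \<prec> b" using big by blast
    then have "a0 \<prec> b" "b0 \<prec> b" using N.le_less_trans le_add by blast+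
    obtain d where d: "d \<in> L" "b \<prec> d" using big by blast
    obtain c where c: "exactly_large_in M c" "D c \<subseteq> L" "a0 \<in> D c" "b \<in> D c" "d \<in> D c"
      "\<forall>i\<in>D c. i = a0 \<or> \<not> i \<prec> b" using large a0 b d \<open>a0 \<prec> b\<close> by metis
    have "\<exists>y. y \<prec> b \<and> \<theta> x y" if "x \<prec> a0" "\<theta> x y" for x y
      using b0[OF that] \<open>b0 \<prec> b\<close> less_trans by blast
    then have "\<psi> c" unfolding \<psi>_def
      using c(3,4,6) D_less[OF c(3)] D_less[OF c(4)] \<open>a0 \<prec> b\<close> by (intro exI[of _ a0] conjI exI[of _ b]) auto
    with hom c show ?thesis by blast
  qed
  have iff: "(\<exists>y. \<theta> x y) \<longleftrightarrow>
      \<not> (\<exists>a b. a \<in> L \<and> b \<in> L \<and> \<one> \<prec> a \<and> x \<prec> a \<and> a \<prec> b \<and> \<not> (\<exists>y. y \<prec> b \<and> \<theta> x y))" for x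
  proof
    assume "\<exists>y. \<theta> x y"
    then obtain y where y: "\<theta> x y" by blast
    have "\<exists>y. y \<prec> b \<and> \<theta> x y" if ab: "a \<in> L" "b \<in> L" "\<one> \<prec> a" "x \<prec> a" "a \<prec> b" for a b
    proof -
      obtain d where "d \<in> L" "b \<oplus> y \<prec> d" using big by blast
      then have d: "d \<in> L" "b \<prec> d" "y \<prec> d" using N.le_less_trans le_add by blast+
      obtain c where c: "exactly_large_in M c" "D c \<subseteq> L" "a \<in> D c" "b \<in> D c" "d \<in> D c"
        "\<forall>i\<in>D c. i = a \<or> \<not> i \<prec> b" using large ab d by metis
      then have "\<psi> c" using hom \<open>col\<close> by blast
      with unique c ab d y show ?thesis by blast
    qed
    then show "\<not> (\<exists>a b. a \<in> L \<and> b \<in> L \<and> \<one> \<prec> a \<and> x \<prec> a \<and> a \<prec> b \<and> \<not> (\<exists>y. y \<prec> b \<and> \<theta> x y))" by blast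
  next
    assume *: "\<not> (\<exists>a b. a \<in> L \<and> b \<in> L \<and> \<one> \<prec> a \<and> x \<prec> a \<and> a \<prec> b \<and> \<not> (\<exists>y. y \<prec> b \<and> \<theta> x y))"
    obtain a where "a \<in> L" "\<one> \<oplus> x \<prec> a" using big by blast
    then have "a \<in> L" "\<one> \<prec> a" "x \<prec> a" using N.le_less_trans le_add by blast+
    moreover obtain b where "b \<in> L" "a \<prec> b" using big by blast
    ultimately show "\<exists>y. \<theta> x y" using * by blast
  qed
  have "sigma1 (\<lambda>v. \<not> (\<exists>y. \<theta> (v 0) y))" unfolding iff not_not
    by (intro sigma1_ex, rule sigma1_definable, intro bounded_intros L \<theta>)
  with sigma1_range show ?thesis by (rule comprehension)
qed

end

section \<open>Arithmetical definability\<close>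

lemma eval_tm_support: "\<exists>n. \<forall>v v'. (\<forall>i<n. v i = v' i) \<longrightarrow> eval_tm M v t = eval_tm M v' t"
proof (induction t)
  case (V i)
  show ?case by (rule exI[of _ "Suc i"]) simp
next
  case (Plus s t)
  then obtain m n where "\<And>v v'. (\<forall>i<m. v i = v' i) \<Longrightarrow> eval_tm M v s = eval_tm M v' s"
    "\<And>v v'. (\<forall>i<n. v i = v' i) \<Longrightarrow> eval_tm M v t = eval_tm M v' t" by blast
  note * = this
  show ?case
    by (rule exI[of _ "max m n"], intro allI impI, simp, intro arg_cong2[where f = "l2_struct.add M"] *) simp_all
next
  case (Times s t)
  then obtain m n where "\<And>v v'. (\<forall>i<m. v i = v' i) \<Longrightarrow> eval_tm M v s = eval_tm M v' s"
    "\<And>v v'. (\<forall>i<n. v i = v' i) \<Longrightarrow> eval_tm M v t = eval_tm M v' t" by blast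
  note * = this
  show ?case
    by (rule exI[of _ "max m n"], intro allI impI, simp, intro arg_cong2[where f = "l2_struct.mult M"] *) simp_all
qed simp_all

lemma sat_support: "\<exists>n. \<forall>v v' w. (\<forall>i<n. v i = v' i) \<longrightarrow> sat M v w p = sat M v' w p"
proof -
  have two: "\<exists>n. \<forall>v v'. (\<forall>i<n. v i = v' i) \<longrightarrow> eval_tm M v s = eval_tm M v' s \<and> eval_tm M v t = eval_tm M v' t"
    for s t
  proof -
    obtain m n where "\<forall>v v'. (\<forall>i<m. v i = v' i) \<longrightarrow> eval_tm M v s = eval_tm M v' s"
      "\<forall>v v'. (\<forall>i<n. v i = v' i) \<longrightarrow> eval_tm M v t = eval_tm M v' t"
      using eval_tm_support by metis
    then show ?thesis by (intro exI[of _ "max m n"]) (metis less_max_iff_disj)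
  qed
  have both: "\<exists>n. \<forall>v v' w. (\<forall>i<n. v i = v' i) \<longrightarrow> sat M v w p = sat M v' w p \<and> sat M v w q = sat M v' w q"
    if p: "\<exists>n. \<forall>v v' w. (\<forall>i<n. v i = v' i) \<longrightarrow> sat M v w p = sat M v' w p"
      and q: "\<exists>n. \<forall>v v' w. (\<forall>i<n. v i = v' i) \<longrightarrow> sat M v w q = sat M v' w q" for p q
  proof -
    obtain m where m: "\<And>v v' w. (\<forall>i<m. v i = v' i) \<Longrightarrow> sat M v w p = sat M v' w p" using p by blast
    obtain n where n: "\<And>v v' w. (\<forall>i<n. v i = v' i) \<Longrightarrow> sat M v w q = sat M v' w q" using q by blast
    show ?thesis by (rule exI[of _ "max m n"]) (intro allI impI conjI m n; simp)
  qed
  have bind: "\<exists>n. \<forall>v v' w. (\<forall>i<n. v i = v' i) \<longrightarrow>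
      (\<forall>x. sat M (case_nat x v) w p = sat M (case_nat x v') w p)"
    if p: "\<exists>n. \<forall>v v' w. (\<forall>i<n. v i = v' i) \<longrightarrow> sat M v w p = sat M v' w p" for p
  proof -
    obtain n where n: "\<And>v v' w. (\<forall>i<n. v i = v' i) \<Longrightarrow> sat M v w p = sat M v' w p"
      using p by blast
    have "sat M (case_nat x v) w p = sat M (case_nat x v') w p" if "\<forall>i<n. v i = v' i" for x v v' w
      by (rule n) (use that in \<open>simp split: nat.split\<close>)
    then show ?thesis by blast
  qed
  show ?thesis
  proof (induction p)
    case (Eq s t) show ?case using two[of s t] by (simp, metis)
  next
    case (Less s t) show ?case using two[of s t] by (simp, metis)
  next
    case (Mem t X) show ?case using two[of t t] by (simp, metis)
  next
    case (Conj p q) from both[OF this] show ?case by (elim ex_forward all_forward imp_forward) simp_all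
  next
    case (Disj p q) from both[OF this] show ?case by (elim ex_forward all_forward imp_forward) simp_all
  next
    case (Imp p q) from both[OF this] show ?case by (elim ex_forward all_forward imp_forward) simp_all
  next
    case (Iff p q) from both[OF this] show ?case by (elim ex_forward all_forward imp_forward) simp_all
  next
    case (AllN p) from bind[OF this] show ?case by (elim ex_forward all_forward imp_forward) simp_all
  next
    case (ExN p) from bind[OF this] show ?case by (elim ex_forward all_forward imp_forward) simp_all
  next
    case (AllS p)
    then obtain n where n: "\<And>v v' w. (\<forall>i<n. v i = v' i) \<Longrightarrow> sat M v w p = sat M v' w p" by blast
    show ?case by (rule exI[of _ n], intro allI impI, subst sat.simps, subst sat.simps,
          intro ball_cong bex_cong refl n)
  next
    case (ExS p)
    then obtain n where n: "\<And>v v' w. (\<forall>i<n. v i = v' i) \<Longrightarrow> sat M v w p = sat M v' w p" by blast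
    show ?case by (rule exI[of _ n], intro allI impI, subst sat.simps, subst sat.simps,
          intro ball_cong bex_cong refl n)
  qed simp_all
qed

context rca0 begin

lemma definable_support: assumes "definable P"
  shows "\<exists>n. \<forall>v v'. (\<forall>i<n. v i = v' i) \<longrightarrow> P v = P v'"
proof -
  obtain p f w where p: "bounded_fm p" "range w \<subseteq> S" "\<And>v. P v \<longleftrightarrow> sat M (val f v) w p"
    by (rule definableE[OF assms(1)]) (rule that)
  obtain n where n: "\<And>v v'. (\<forall>i<n. v i = v' i) \<Longrightarrow> sat M v w p = sat M v' w p"
    using sat_support[of M p] by blast
  \<comment> \<open>The sum exceeds every environment position as which one of the first
    \<open>n\<close> variables is read.\<close>
  define N where "N = (\<Sum>i<n. case f i of Inl c \<Rightarrow> 0 | Inr j \<Rightarrow> Suc j)"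
  have N: "j < N" if "i < n" "f i = Inr j" for i j
    using member_le_sum[of i "{..<n}" "\<lambda>i. case f i of Inl c \<Rightarrow> 0 | Inr j \<Rightarrow> Suc j"] that
    by (simp add: N_def)
  have "P v = P v'" if v: "\<forall>i<N. v i = v' i" for v v'
    unfolding p(3) by (rule n) (use N v in \<open>auto simp: val_def split: sum.split\<close>)
  then show ?thesis by blast
qed

primrec tuple :: "nat \<Rightarrow> (nat \<Rightarrow> 'a) \<Rightarrow> 'a" where
  "tuple 0 v = \<zero>"
| "tuple (Suc n) v = \<langle>v n, tuple n v\<rangle>"

lemma term_definable_tuple: "term_definable (\<lambda>v. tuple n v)"
  by (induction n) (auto intro: bounded_intros)

lemma tuple_eq_iff: "tuple n v = tuple n v' \<longleftrightarrow> (\<forall>i<n. v i = v' i)"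
  by (induction n) (auto simp: less_Suc_eq)

text \<open>Since \<open>k\<close> is a standard number, this is plain iteration of
  \<open>sigma1_ex\<close>. Quantifying over a whole environment \<open>u\<close>, of which
  \<open>k\<close> positions matter, treats all witnesses at once.\<close>

lemma sigma1_ex_many:
  assumes "sigma1 Q" shows "sigma1 (\<lambda>v. \<exists>u. Q (\<lambda>i. if i < k then u i else v (i - k)))"
proof (induction k)
  case 0
  then show ?case using assms by simp
next
  case (Suc k)
  let ?R = "\<lambda>v. \<exists>u. Q (\<lambda>i. if i < k then u i else v (i - k))"
  have eta: "case_nat (v 0) (\<lambda>i. v (Suc i)) = v" for v :: "nat \<Rightarrow> 'a"
    by (rule ext) (simp split: nat.split)
  have "sigma1 (\<lambda>v. \<exists>x. ?R (case_nat x v))"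
    by (rule sigma1_ex) (simp only: eta Suc)
  then show ?case
  proof (rule sigma1_cong)
    fix v :: "nat \<Rightarrow> 'a"
    have *: "(\<lambda>i. if i < k then u i else case_nat (u k) v (i - k)) =
        (\<lambda>i. if i < Suc k then u i else v (i - Suc k))" for u
      by (rule ext) (auto split: nat.split simp: less_Suc_eq diff_Suc)
    show "(\<exists>u. Q (\<lambda>i. if i < Suc k then u i else v (i - Suc k))) \<longleftrightarrow> (\<exists>x. ?R (case_nat x v))"
    proof
      assume "\<exists>u. Q (\<lambda>i. if i < Suc k then u i else v (i - Suc k))"
      then show "\<exists>x. ?R (case_nat x v)" unfolding *[symmetric] by blast
    next
      assume "\<exists>x. ?R (case_nat x v)"
      then obtain x u where "Q (\<lambda>i. if i < k then u i else case_nat x v (i - k))" by blast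
      moreover have "(\<lambda>i. if i < k then u i else case_nat x v (i - k)) =
          (\<lambda>i. if i < Suc k then (u(k := x)) i else v (i - Suc k))"
        unfolding *[symmetric] by (rule ext) (simp split: nat.split)
      ultimately have "Q (\<lambda>i. if i < Suc k then (u(k := x)) i else v (i - Suc k))" by (simp only:)
      then show "\<exists>u. Q (\<lambda>i. if i < Suc k then u i else v (i - Suc k))" by (rule exI[of _ "u(k := x)"])
    qed
  qed
qed

end

context rca0_rt begin

text \<open>A definable predicate depends on finitely many positions only, so these can be coded by one
  number and the projection is a set by arithmetical comprehension: from here on, \<open>definable\<close> is
  arithmetical definability.\<close>

lemma definable_ex:
  assumes "definable (\<lambda>v. P (v 0) (\<lambda>i. v (Suc i)))" shows "definable (\<lambda>v. \<exists>x. P x v)"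
proof -
  obtain n where n: "\<And>v v'. (\<forall>i<n. v i = v' i) \<Longrightarrow>
      P (v 0) (\<lambda>i. v (Suc i)) = P (v' 0) (\<lambda>i. v' (Suc i))" using definable_support[OF assms] by blast
  have P: "P x v = P x v'" if v: "\<forall>i<n. v i = v' i" for x v v'
  proof -
    have "\<forall>i<n. case_nat x v i = case_nat x v' i" using v by (simp split: nat.split)
    from n[OF this] show ?thesis by simp
  qed
  define A where "A = {z. \<exists>u. z = tuple n u \<and> (\<exists>x. P x u)}"
  \<comment> \<open>Position \<open>n\<close> holds the code of the first \<open>n\<close> positions
    and becomes position 0 once these are quantified away.\<close>
  have "sigma1 (\<lambda>v. v n = tuple n v \<and> (\<exists>x. P x v))"
    by (rule sigma1_conj, rule sigma1_definable, intro bounded_intros term_definable_tuple, rule sigma1_ex_definable, rule assms)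
  from sigma1_ex_many[OF this, of n]
  have "sigma1 (\<lambda>v. \<exists>u. v 0 = tuple n (\<lambda>i. if i < n then u i else v (i - n)) \<and>
      (\<exists>x. P x (\<lambda>i. if i < n then u i else v (i - n))))" by simp
  then have "sigma1 (\<lambda>v. v 0 \<in> A)"
  proof (rule sigma1_cong)
    fix v :: "nat \<Rightarrow> 'a"
    have "tuple n (\<lambda>i. if i < n then u i else v (i - n)) = tuple n u" for u by (simp add: tuple_eq_iff)
    moreover have "P x (\<lambda>i. if i < n then u i else v (i - n)) = P x u" for x u by (rule P) simp
    ultimately show "v 0 \<in> A \<longleftrightarrow> (\<exists>u. v 0 = tuple n (\<lambda>i. if i < n then u i else v (i - n)) \<and>
      (\<exists>x. P x (\<lambda>i. if i < n then u i else v (i - n))))" unfolding A_def by simp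
  qed
  then obtain \<theta> where \<theta>: "\<And>s t. term_definable s \<Longrightarrow> term_definable t \<Longrightarrow> definable (\<lambda>v. \<theta> (s v) (t v))"
    "\<And>i. i \<in> A \<longleftrightarrow> (\<exists>y. \<theta> i y)" by (rule sigma1E2) (rule that)
  have "A = {x. \<exists>y. \<theta> x y}" using \<theta>(2) by blast
  then have "A \<in> S" using arithmetical_comprehension[of \<theta>] \<theta>(1) by (simp add: bounded_intros)
  then have "definable (\<lambda>v. tuple n v \<in> A)" by (intro bounded_intros term_definable_tuple)
  then show ?thesis
  proof (rule definable_cong)
    show "(\<exists>x. P x v) \<longleftrightarrow> tuple n v \<in> A" for v
      unfolding A_def mem_Collect_eq tuple_eq_iff using P by blast
  qed
qed

lemma definable_all:
  assumes "definable (\<lambda>v. P (v 0) (\<lambda>i. v (Suc i)))" shows "definable (\<lambda>v. \<forall>x. P x v)"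
  by (rule definable_cong[of "\<lambda>v. \<not> (\<exists>x. \<not> P x v)"]) (intro definable_not definable_ex assms, blast)

text \<open>Stated through the graph, since minimisation and recursion lead to functions that are
  not terms of the language.\<close>

definition definable_fun :: "((nat \<Rightarrow> 'a) \<Rightarrow> 'a) \<Rightarrow> bool" where
  "definable_fun f \<longleftrightarrow> definable (\<lambda>v. v 0 = f (\<lambda>i. v (Suc i)))"

named_theorems arith_intros

lemmas [arith_intros] = definable_not definable_conj definable_disj definable_imp definable_iff definable_ex definable_all definable_bool

lemma definable_fun_ren: assumes "definable_fun t" shows "definable_fun (\<lambda>v. t (\<lambda>i. v (g i)))"
  using definable_ren[of _ "case_nat 0 (\<lambda>i. Suc (g i))", OF assms[unfolded definable_fun_def]] by (simp add: definable_fun_def)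

lemma definable_fun_term_definable: assumes "term_definable t" shows "definable_fun t"
  unfolding definable_fun_def by (intro bounded_intros term_definable_ren[OF assms])

lemma definable_fun_var [arith_intros]: "definable_fun (\<lambda>v. v i)" and definable_fun_const [arith_intros]: "definable_fun (\<lambda>v. c)"
  by (intro definable_fun_term_definable bounded_intros)+

lemma definable_subst_fun:
  assumes "definable (\<lambda>v. P (v 0) (\<lambda>i. v (Suc i)))" "definable_fun t" shows "definable (\<lambda>v. P (t v) v)"
proof -
  have "definable (\<lambda>v. \<exists>x. x = t v \<and> P x v)"
    by (intro arith_intros assms assms(2)[unfolded definable_fun_def])
  then show ?thesis by simp
qed

lemma definable_subst_fun1: assumes "definable (\<lambda>v. R (v 0))" "definable_fun s" shows "definable (\<lambda>v. R (s v))"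
  using definable_subst_fun[of "\<lambda>x v. R x"] assms by simp

lemma definable_subst_fun2:
  assumes "definable (\<lambda>v. R (v 0) (v 1))" "definable_fun s" "definable_fun t" shows "definable (\<lambda>v. R (s v) (t v))"
proof -
  have "definable (\<lambda>v. R (s (\<lambda>i. v (Suc i))) (v 0))"
    by (rule definable_subst_fun[where P = "\<lambda>x v. R x (v 0)"])
      (use assms(1) definable_fun_ren[OF assms(2)] in simp_all)
  from definable_subst_fun[where P = "\<lambda>x v. R (s v) x", OF this assms(3)] show ?thesis .
qed

lemma definable_subst_fun3:
  assumes "definable (\<lambda>v. R (v 0) (v 1) (v 2))" "definable_fun s" "definable_fun t" "definable_fun u"
  shows "definable (\<lambda>v. R (s v) (t v) (u v))"
proof -
  have "definable (\<lambda>v. R (s (\<lambda>i. v (Suc (Suc i)))) (v 0) (v 1))"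
    by (rule definable_subst_fun[where P = "\<lambda>x v. R x (v 0) (v 1)"])
      (use assms(1) definable_fun_ren[OF assms(2)] in \<open>simp_all add: numeral_2_eq_2\<close>)
  then have "definable (\<lambda>v. R (s (\<lambda>i. v (Suc i))) (t (\<lambda>i. v (Suc i))) (v 0))"
    by (intro definable_subst_fun[where P = "\<lambda>x v. R (s (\<lambda>i. v (Suc i))) x (v 0)"])
      (use definable_fun_ren[OF assms(3)] in simp_all)
  from definable_subst_fun[where P = "\<lambda>x v. R (s v) (t v) x", OF this assms(4)] show ?thesis .
qed

lemma definable_fun_subst1: assumes "definable_fun (\<lambda>v. F (v 0))" "definable_fun s" shows "definable_fun (\<lambda>v. F (s v))"
proof -
  have "definable (\<lambda>v. v 1 = F (v 0))"
    using definable_ren[of _ "case_nat 1 (\<lambda>_. 0)", OF assms(1)[unfolded definable_fun_def]] by simp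
  from definable_subst_fun2[where R = "\<lambda>x y. y = F x", OF this definable_fun_ren[OF assms(2), of Suc] definable_fun_var[of 0]]
  show ?thesis by (simp only: definable_fun_def)
qed

lemma definable_fun_subst2:
  assumes "definable_fun (\<lambda>v. F (v 0) (v 1))" "definable_fun s" "definable_fun t" shows "definable_fun (\<lambda>v. F (s v) (t v))"
proof -
  have "definable (\<lambda>v. v 2 = F (v 0) (v 1))"
    using definable_ren[of _ "case_nat 2 (case_nat 0 (\<lambda>_. 1))", OF assms(1)[unfolded definable_fun_def]] by simp
  from definable_subst_fun3[where R = "\<lambda>x y z. z = F x y", OF this definable_fun_ren[OF assms(2), of Suc]
      definable_fun_ren[OF assms(3), of Suc] definable_fun_var[of 0]]
  show ?thesis by (simp only: definable_fun_def)
qed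

lemma definable_eq_fun [arith_intros]: "definable_fun s \<Longrightarrow> definable_fun t \<Longrightarrow> definable (\<lambda>v. s v = t v)"
  and definable_less_fun [arith_intros]: "definable_fun s \<Longrightarrow> definable_fun t \<Longrightarrow> definable (\<lambda>v. s v \<prec> t v)"
  and definable_D_fun [arith_intros]: "definable_fun s \<Longrightarrow> definable_fun t \<Longrightarrow> definable (\<lambda>v. s v \<in> D (t v))"
  by (rule definable_subst_fun2, intro bounded_intros, assumption+)+

lemma definable_le_fun [arith_intros]: "definable_fun s \<Longrightarrow> definable_fun t \<Longrightarrow> definable (\<lambda>v. s v \<preceq> t v)"
  unfolding le_def by (intro arith_intros)

lemma definable_mem_fun [arith_intros]: "A \<in> S \<Longrightarrow> definable_fun s \<Longrightarrow> definable (\<lambda>v. s v \<in> A)"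
  by (rule definable_subst_fun1, intro bounded_intros, assumption+)

lemma definable_fun_add [arith_intros]: "definable_fun s \<Longrightarrow> definable_fun t \<Longrightarrow> definable_fun (\<lambda>v. s v \<oplus> t v)"
  by (rule definable_fun_subst2[where F = "(\<oplus>)"], rule definable_fun_term_definable, intro bounded_intros)

lemma definable_fun_pair [arith_intros]: "definable_fun s \<Longrightarrow> definable_fun t \<Longrightarrow> definable_fun (\<lambda>v. \<langle>s v, t v\<rangle>)"
  by (rule definable_fun_subst2[where F = "pair_in M"], rule definable_fun_term_definable, intro bounded_intros)

text \<open>With the value 0 where no least element exists, the graph of a minimisation is definable without
  any assumption on the predicate.\<close>

definition mu :: "('a \<Rightarrow> bool) \<Rightarrow> 'a" where
  "mu P = (if \<exists>x. P x \<and> (\<forall>y. y \<prec> x \<longrightarrow> \<not> P y)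
    then THE x. P x \<and> (\<forall>y. y \<prec> x \<longrightarrow> \<not> P y) else \<zero>)"

lemma mu_eq: "P x \<Longrightarrow> (\<And>y. y \<prec> x \<Longrightarrow> \<not> P y) \<Longrightarrow> mu P = x"
proof -
  assume x: "P x" "\<And>y. y \<prec> x \<Longrightarrow> \<not> P y"
  have "(THE x. P x \<and> (\<forall>y. y \<prec> x \<longrightarrow> \<not> P y)) = x"
    by (rule the_equality) (use x less_linear in blast)+
  with x show "mu P = x" unfolding mu_def by auto
qed

lemma mu_unique: "P x \<Longrightarrow> (\<And>y. P y \<Longrightarrow> y = x) \<Longrightarrow> mu P = x"
  using less_irrefl by (intro mu_eq) blast+

lemma mu_least:
  assumes "definable (\<lambda>v. P (v 0))" "P x" shows "P (mu P)" "y \<prec> mu P \<Longrightarrow> \<not> P y"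
proof -
  obtain m where "P m" "\<forall>y. y \<prec> m \<longrightarrow> \<not> P y" using definable_least[OF assms] by blast
  moreover from this have "mu P = m" by (intro mu_eq) blast+
  ultimately show "P (mu P)" "y \<prec> mu P \<Longrightarrow> \<not> P y" by simp_all
qed

lemma definable_fun_mu [arith_intros]:
  assumes "definable (\<lambda>v. P (v 0) (\<lambda>i. v (Suc i)))" shows "definable_fun (\<lambda>v. mu (\<lambda>x. P x v))"
proof -
  have iff: "z = mu Q \<longleftrightarrow> Q z \<and> (\<forall>y. y \<prec> z \<longrightarrow> \<not> Q y) \<or>
      z = \<zero> \<and> \<not> (\<exists>x. Q x \<and> (\<forall>y. y \<prec> x \<longrightarrow> \<not> Q y))" for z Q
  proof (cases "\<exists>x. Q x \<and> (\<forall>y. y \<prec> x \<longrightarrow> \<not> Q y)")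
    case True
    then show ?thesis using mu_eq by metis
  next
    case False
    then show ?thesis by (auto simp: mu_def)
  qed
  have P: "definable (\<lambda>v. P (s v) (\<lambda>i. v (g i)))" if "definable_fun s" for s g
  proof (rule definable_subst_fun[OF _ that])
    have "(\<lambda>v. P (v 0) (\<lambda>i. v (Suc (g i)))) =
      (\<lambda>v. P (v (case_nat 0 (\<lambda>i. Suc (g i)) 0)) (\<lambda>i. v (case_nat 0 (\<lambda>i. Suc (g i)) (Suc i))))" by simp
    then show "definable (\<lambda>v. P (v 0) (\<lambda>i. v (Suc (g i))))"
      using definable_ren[OF assms, of "case_nat 0 (\<lambda>i. Suc (g i))"] by simp
  qed
  show ?thesis unfolding definable_fun_def iff by (intro arith_intros P)
qed

end

section \<open>Recursion and halting computations\<close>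

context rca0_rt begin

lemma definable_if [arith_intros]:
  assumes "definable P" "definable Q" "definable R" shows "definable (\<lambda>v. if P v then Q v else R v)"
  by (rule definable_cong[of "\<lambda>v. P v \<and> Q v \<or> \<not> P v \<and> R v"]) (intro arith_intros assms, simp)

lemma definable_fun_if [arith_intros]:
  assumes "definable P" "definable_fun s" "definable_fun t" shows "definable_fun (\<lambda>v. if P v then s v else t v)"
  unfolding definable_fun_def
  by (rule definable_cong[of "\<lambda>v. P (\<lambda>i. v (Suc i)) \<and> v 0 = s (\<lambda>i. v (Suc i)) \<or>
        \<not> P (\<lambda>i. v (Suc i)) \<and> v 0 = t (\<lambda>i. v (Suc i))"])
    (intro arith_intros definable_ren[OF assms(1)] assms(2,3)[unfolded definable_fun_def], simp)

lemma minus_mu: "x \<ominus> y = mu (\<lambda>z. y \<oplus> z = x)"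
proof (cases "y \<preceq> x")
  case True
  then obtain z where z: "x = y \<oplus> z" using le_iff by metis
  have "mu (\<lambda>z. y \<oplus> z = x) = z" by (rule mu_unique) (use z plus_cancel in blast)+
  with z show ?thesis by (simp add: plus_minus)
next
  case False
  then have "\<not> (\<exists>z. y \<oplus> z = x)" unfolding le_iff .
  then show ?thesis using False by (simp add: minus_zero mu_def)
qed

lemma definable_fun_minus [arith_intros]: "definable_fun s \<Longrightarrow> definable_fun t \<Longrightarrow> definable_fun (\<lambda>v. s v \<ominus> t v)"
  by (rule definable_fun_subst2[where F = "(\<ominus>)"], unfold minus_mu, intro arith_intros)

text \<open>Taking the least code makes the code a function of the set and lets a bound on some code
  carry over to it.\<close>

definition code_below :: "'a \<Rightarrow> ('a \<Rightarrow> bool) \<Rightarrow> 'a" where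
  "code_below b P = mu (\<lambda>c. \<forall>x. x \<in> D c \<longleftrightarrow> x \<prec> b \<and> P x)"

lemma D_code_below:
  assumes "definable (\<lambda>v. P (v 0))" shows "D (code_below b P) = {x. x \<prec> b \<and> P x}"
proof -
  obtain c where "D c = {x. x \<prec> b \<and> P x}" using sigma1_finite_below[OF sigma1_definable[OF assms]] ..
  then have "\<forall>x. x \<in> D c \<longleftrightarrow> x \<prec> b \<and> P x" by auto
  moreover have "definable (\<lambda>v. \<forall>x. x \<in> D (v 0) \<longleftrightarrow> x \<prec> b \<and> P x)"
    by (intro arith_intros definable_subst_fun1[OF assms])
  ultimately have "\<forall>x. x \<in> D (code_below b P) \<longleftrightarrow> x \<prec> b \<and> P x"
    unfolding code_below_def by (intro mu_least(1)[where P = "\<lambda>c. \<forall>x. x \<in> D c \<longleftrightarrow> x \<prec> b \<and> P x"])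
  then show ?thesis by auto
qed

text \<open>Some code of the set lies below the bound of \<open>bounded_comprehension\<close>, which
  does not depend on \<open>P\<close>, so the least one does too. This supplies the bounded range
  for the pigeonhole argument on blocks.\<close>

lemma code_below_bounded: "\<exists>K. \<forall>P. definable (\<lambda>v. P (v 0)) \<longrightarrow> code_below b P \<preceq> K"
proof -
  obtain K where K: "\<And>\<phi>. sigma1 (\<lambda>v. \<phi> (v 0)) \<Longrightarrow> \<exists>c. c \<preceq> K \<and> D c = {i. i \<prec> b \<and> \<phi> i}"
    using bounded_comprehension[of b] by blast
  have "code_below b P \<preceq> K" if P: "definable (\<lambda>v. P (v 0))" for P
  proof -
    obtain c where c: "c \<preceq> K" "D c = {x. x \<prec> b \<and> P x}" using K[OF sigma1_definable[OF P]] by blast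
    then have c': "\<forall>x. x \<in> D c \<longleftrightarrow> x \<prec> b \<and> P x" by auto
    have "definable (\<lambda>v. \<forall>x. x \<in> D (v 0) \<longleftrightarrow> x \<prec> b \<and> P x)"
      by (intro arith_intros definable_subst_fun1[OF P])
    from mu_least(2)[where P = "\<lambda>c. \<forall>x. x \<in> D c \<longleftrightarrow> x \<prec> b \<and> P x", OF this c', of c] c'
    have "\<not> c \<prec> code_below b P" unfolding code_below_def by blast
    with c(1) show ?thesis by order
  qed
  then show ?thesis by blast
qed

lemma definable_fun_code_below [arith_intros]:
  assumes "definable_fun b" "definable (\<lambda>v. P (v 0) (\<lambda>i. v (Suc i)))" shows "definable_fun (\<lambda>v. code_below (b v) (\<lambda>x. P x v))"
proof -
  have "definable (\<lambda>v. P (v 0) (\<lambda>i. v (Suc (g i))))" for g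
    using definable_ren[OF assms(2), of "case_nat 0 (\<lambda>i. Suc (g i))"] by simp
  then have P: "definable_fun s \<Longrightarrow> definable (\<lambda>v. P (s v) (\<lambda>i. v (g i)))" for s g by (rule definable_subst_fun)
  show ?thesis unfolding code_below_def by (intro arith_intros definable_fun_ren[OF assms(1)] P)
qed

section \<open>Primitive recursion by coded traces\<close>

definition trace :: "('a \<Rightarrow> 'a \<Rightarrow> 'a) \<Rightarrow> 'a \<Rightarrow> 'a \<Rightarrow> 'a \<Rightarrow> bool" where
  "trace F a n z \<longleftrightarrow> (\<forall>i u u'. \<langle>i, u\<rangle> \<in> D z \<and> \<langle>i, u'\<rangle> \<in> D z \<longrightarrow> u = u') \<and> \<langle>\<zero>, a\<rangle> \<in> D z \<and>
    (\<forall>i. i \<prec> n \<longrightarrow> (\<exists>u. \<langle>i, u\<rangle> \<in> D z \<and> \<langle>i \<oplus> \<one>, F i u\<rangle> \<in> D z))"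

definition Rec :: "('a \<Rightarrow> 'a \<Rightarrow> 'a) \<Rightarrow> 'a \<Rightarrow> 'a \<Rightarrow> 'a" where
  "Rec F a n = mu (\<lambda>y. \<exists>z. trace F a n z \<and> \<langle>n, y\<rangle> \<in> D z)"

text \<open>The renaming \<open>g\<close> lets \<open>F\<close> be used below the quantifiers hidden
  in \<open>trace\<close>, where the environment is shifted.\<close>

lemma definable_fun_Rec [arith_intros]:
  assumes F: "\<And>g s t. definable_fun s \<Longrightarrow> definable_fun t \<Longrightarrow> definable_fun (\<lambda>v. F (\<lambda>i. v (g i)) (s v) (t v))"
    and "definable_fun a" "definable_fun n"
  shows "definable_fun (\<lambda>v. Rec (F v) (a v) (n v))"
  unfolding Rec_def trace_def by (intro arith_intros F definable_fun_ren[OF assms(2)] definable_fun_ren[OF assms(3)])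

lemma trace_at: "trace F a n z \<Longrightarrow> \<exists>u. \<langle>n, u\<rangle> \<in> D z"
proof (cases "n = \<zero>")
  case False
  then obtain m where "n = m \<oplus> \<one>" using nonzero_Suc by blast
  then show "trace F a n z \<Longrightarrow> ?thesis" using less_Suc unfolding trace_def by blast
qed (auto simp: trace_def)

lemma trace_unique:
  assumes "trace F a n z" "trace F a n' z'" "i \<preceq> n" "i \<preceq> n'" "\<langle>i, u\<rangle> \<in> D z" "\<langle>i, u'\<rangle> \<in> D z'"
  shows "u = u'"
proof -
  have "\<forall>u u'. i \<preceq> n \<and> i \<preceq> n' \<and> \<langle>i, u\<rangle> \<in> D z \<and> \<langle>i, u'\<rangle> \<in> D z' \<longrightarrow> u = u'"
  proof (rule definable_induct[of "\<lambda>i. \<forall>u u'. i \<preceq> n \<and> i \<preceq> n' \<and> \<langle>i, u\<rangle> \<in> D z \<and> \<langle>i, u'\<rangle> \<in> D z' \<longrightarrow> u = u'"])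
    show "\<forall>u u'. \<zero> \<preceq> n \<and> \<zero> \<preceq> n' \<and> \<langle>\<zero>, u\<rangle> \<in> D z \<and> \<langle>\<zero>, u'\<rangle> \<in> D z' \<longrightarrow> u = u'"
      using assms(1,2) unfolding trace_def by metis
    fix i assume IH: "\<forall>u u'. i \<preceq> n \<and> i \<preceq> n' \<and> \<langle>i, u\<rangle> \<in> D z \<and> \<langle>i, u'\<rangle> \<in> D z' \<longrightarrow> u = u'"
    show "\<forall>u u'. i \<oplus> \<one> \<preceq> n \<and> i \<oplus> \<one> \<preceq> n' \<and> \<langle>i \<oplus> \<one>, u\<rangle> \<in> D z \<and> \<langle>i \<oplus> \<one>, u'\<rangle> \<in> D z' \<longrightarrow> u = u'"
    proof (intro allI impI, elim conjE)
      fix u u' assume *: "i \<oplus> \<one> \<preceq> n" "i \<oplus> \<one> \<preceq> n'" "\<langle>i \<oplus> \<one>, u\<rangle> \<in> D z" "\<langle>i \<oplus> \<one>, u'\<rangle> \<in> D z'"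
      then obtain w w' where w: "\<langle>i, w\<rangle> \<in> D z" "\<langle>i \<oplus> \<one>, F i w\<rangle> \<in> D z"
          "\<langle>i, w'\<rangle> \<in> D z'" "\<langle>i \<oplus> \<one>, F i w'\<rangle> \<in> D z'"
        using assms(1,2) unfolding trace_def Suc_le by meson
      have "i \<preceq> n" "i \<preceq> n'" using *(1,2)[unfolded Suc_le] by (simp_all add: le_def)
      with IH w have "w = w'" by blast
      moreover have "u = F i w" "u' = F i w'" using * w assms(1,2) unfolding trace_def by blast+
      ultimately show "u = u'" by simp
    qed
  qed (intro arith_intros)
  with assms show ?thesis by blast
qed

lemma definable_finite_set: "definable (\<lambda>v. \<phi> (v 0)) \<Longrightarrow> (\<And>i. \<phi> i \<Longrightarrow> i \<prec> b) \<Longrightarrow> \<exists>c. D c = {i. \<phi> i}"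
  by (rule sigma1_finite_set[OF sigma1_definable])

lemma trace_exists: assumes "definable_fun (\<lambda>v. F (v 0) (v 1))" shows "\<exists>z. trace F a n z"
proof (rule definable_induct[of "\<lambda>n. \<exists>z. trace F a n z"])
  show "definable (\<lambda>v. \<exists>z. trace F a (v 0) z)" unfolding trace_def by (intro arith_intros definable_fun_subst2[OF assms])
  have "\<exists>z. D z = {p. p = \<langle>\<zero>, a\<rangle>}"
    by (rule definable_finite_set[of _ "\<langle>\<zero>, a\<rangle> \<oplus> \<one>"], intro arith_intros) (simp add: less_Suc)
  then obtain z where "D z = {p. p = \<langle>\<zero>, a\<rangle>}" ..
  then show "\<exists>z. trace F a \<zero> z" unfolding trace_def by (intro exI[of _ z]) auto
  fix n assume "\<exists>z. trace F a n z"
  then obtain z where z: "trace F a n z" by blast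
  then obtain u where u: "\<langle>n, u\<rangle> \<in> D z" using trace_at by blast
  \<comment> \<open>The old \<open>z\<close> may contain a stray value at
    \<open>n \<oplus> \<one>\<close>; cutting it back to indices up to \<open>n\<close> keeps the
    new trace functional.\<close>
  have "\<exists>z'. D z' = {p. (p \<in> D z \<and> (\<exists>i u. p = \<langle>i, u\<rangle> \<and> i \<preceq> n)) \<or> p = \<langle>n \<oplus> \<one>, F n u\<rangle>}"
    by (rule definable_finite_set[of _ "z \<oplus> (\<langle>n \<oplus> \<one>, F n u\<rangle> \<oplus> \<one>)"], intro arith_intros)
      (use D_less_add N.less_le_trans[OF less_Suc le_add(2)] in blast)
  then obtain z' where "D z' = {p. (p \<in> D z \<and> (\<exists>i u. p = \<langle>i, u\<rangle> \<and> i \<preceq> n)) \<or> p = \<langle>n \<oplus> \<one>, F n u\<rangle>}" ..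
  then have z': "\<langle>i, w\<rangle> \<in> D z' \<longleftrightarrow> \<langle>i, w\<rangle> \<in> D z \<and> i \<preceq> n \<or> i = n \<oplus> \<one> \<and> w = F n u" for i w by auto
  have "\<not> n \<oplus> \<one> \<preceq> n" unfolding Suc_le by (rule less_irrefl)
  then have "\<forall>i u u'. \<langle>i, u\<rangle> \<in> D z' \<and> \<langle>i, u'\<rangle> \<in> D z' \<longrightarrow> u = u'"
    using z unfolding z' trace_def by metis
  moreover have "\<langle>\<zero>, a\<rangle> \<in> D z'" using z unfolding z' trace_def by simp
  moreover have "\<exists>u. \<langle>i, u\<rangle> \<in> D z' \<and> \<langle>i \<oplus> \<one>, F i u\<rangle> \<in> D z'" if i: "i \<prec> n \<oplus> \<one>" for i
  proof (cases "i = n")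
    case True
    then show ?thesis using u unfolding z' by auto
  next
    case False
    with i have "i \<prec> n" by (simp add: basic(8))
    then obtain w where "\<langle>i, w\<rangle> \<in> D z" "\<langle>i \<oplus> \<one>, F i w\<rangle> \<in> D z" using z unfolding trace_def by blast
    moreover have "i \<preceq> n" "i \<oplus> \<one> \<preceq> n" using \<open>i \<prec> n\<close> by (simp_all add: Suc_le)
    ultimately show ?thesis unfolding z' by blast
  qed
  ultimately show "\<exists>z. trace F a (n \<oplus> \<one>) z" unfolding trace_def by blast
qed

lemma Rec_trace: assumes "trace F a n z" "m \<preceq> n" "\<langle>m, y\<rangle> \<in> D z" shows "Rec F a m = y"
proof -
  have "trace F a m z" using assms(1,2) unfolding trace_def by (meson N.less_le_trans)
  then show ?thesis unfolding Rec_def using assms(3) trace_unique by (intro mu_unique) blast+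
qed

lemma Rec_0: assumes "definable_fun (\<lambda>v. F (v 0) (v 1))" shows "Rec F a \<zero> = a"
proof -
  obtain z where "trace F a \<zero> z" using trace_exists[OF assms] by blast
  then show ?thesis by (rule Rec_trace) (use \<open>trace F a \<zero> z\<close> in \<open>simp_all add: trace_def\<close>)
qed

lemma Rec_Suc: assumes "definable_fun (\<lambda>v. F (v 0) (v 1))" shows "Rec F a (n \<oplus> \<one>) = F n (Rec F a n)"
proof -
  obtain z where z: "trace F a (n \<oplus> \<one>) z" using trace_exists[OF assms] by blast
  then obtain u where u: "\<langle>n, u\<rangle> \<in> D z" "\<langle>n \<oplus> \<one>, F n u\<rangle> \<in> D z"
    using less_Suc unfolding trace_def by blast
  have "Rec F a n = u" by (rule Rec_trace[OF z _ u(1)]) simp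
  moreover have "Rec F a (n \<oplus> \<one>) = F n u" by (rule Rec_trace[OF z _ u(2)]) simp
  ultimately show ?thesis by simp
qed

section \<open>Halting computations with a bounded history\<close>

definition halts_by :: "'a set \<Rightarrow> 'a \<Rightarrow> 'a \<Rightarrow> bool" where
  "halts_by X e h \<longleftrightarrow> program_in M e \<and>
    (\<exists>t. (\<forall>s a b. \<langle>s, a\<rangle> \<in> D h \<and> \<langle>s, b\<rangle> \<in> D h \<longrightarrow> a = b) \<and>
      (\<exists>d. \<langle>\<zero>, \<langle>\<zero>, d\<rangle>\<rangle> \<in> D h \<and> initial_in M d e) \<and>
      (\<forall>s. s \<prec> t \<longrightarrow> (\<exists>p d p' d'. \<langle>s, \<langle>p, d\<rangle>\<rangle> \<in> D h \<and> \<langle>s \<oplus> \<one>, \<langle>p', d'\<rangle>\<rangle> \<in> D h \<and>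
        step_in M X e p d p' d')) \<and>
      (\<exists>p d. \<langle>t, \<langle>p, d\<rangle>\<rangle> \<in> D h \<and> (\<nexists>i. \<langle>p, i\<rangle> \<in> D e)))"

lemma jump_halts_by: "jump_in M X = {e. \<exists>h. halts_by X e h}"
  unfolding jump_in_def halts_in_def halts_by_def by blast

lemma definable_content [arith_intros]: "definable_fun d \<Longrightarrow> definable_fun r \<Longrightarrow> definable_fun x \<Longrightarrow> definable (\<lambda>v. content_in M (d v) (r v) (x v))"
  by (rule definable_subst_fun3[where R = "content_in M"]) (unfold content_in_def, intro arith_intros)

lemma definable_update [arith_intros]:
  assumes "definable_fun d" "definable_fun r" "definable_fun x" "definable_fun d'" shows "definable (\<lambda>v. update_in M (d v) (r v) (x v) (d' v))"
  unfolding update_in_def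
  by (intro arith_intros definable_fun_ren[OF assms(1)] definable_fun_ren[OF assms(2)] definable_fun_ren[OF assms(3)] definable_fun_ren[OF assms(4)])

lemma definable_step [arith_intros]:
  assumes "definable_fun c" "definable_fun e" "definable_fun p" "definable_fun d" "definable_fun p'" "definable_fun d'"
  shows "definable (\<lambda>v. step_in M (D (c v)) (e v) (p v) (d v) (p' v) (d' v))"
  unfolding step_in_def
  by (intro arith_intros definable_fun_ren[OF assms(1)] definable_fun_ren[OF assms(2)] definable_fun_ren[OF assms(3)] definable_fun_ren[OF assms(4)]
      definable_fun_ren[OF assms(5)] definable_fun_ren[OF assms(6)])

lemma definable_halts_by [arith_intros]: "definable_fun c \<Longrightarrow> definable_fun e \<Longrightarrow> definable_fun h \<Longrightarrow> definable (\<lambda>v. halts_by (D (c v)) (e v) (h v))"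
  by (rule definable_subst_fun3[where R = "\<lambda>c e h. halts_by (D c) e h"])
    (unfold halts_by_def program_in_def initial_in_def, intro arith_intros)

lemma halts_by_use:
  assumes "\<And>x. x \<prec> h \<Longrightarrow> x \<in> X \<longleftrightarrow> x \<in> X'" "halts_by X e h" shows "halts_by X' e h"
proof -
  have step: "step_in M X' e p d p' d'" if "\<langle>s, \<langle>p, d\<rangle>\<rangle> \<in> D h" "step_in M X e p d p' d'" for s p d p' d'
  proof -
    have "d \<prec> h" using that(1) pair_in_D pair_le(2) N.le_less_trans by blast
    \<comment> \<open>A queried content is either listed in \<open>d\<close>, hence below
      \<open>d\<close>, or it is the default \<open>\<zero>\<close>, which lies below
      \<open>h\<close> because \<open>h\<close> exceeds \<open>d\<close>.\<close>
    then have "x \<prec> h" if "content_in M d r x" for r x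
      using that pair_in_D(2) unfolding content_in_def
      by (metis N.less_trans N.le_less_trans zero_le)
    then have "x \<in> X \<longleftrightarrow> x \<in> X'" if "content_in M d r x" for r x using assms(1) that by blast
    with that(2) show ?thesis unfolding step_in_def by (elim ex_forward) auto
  qed
  then have steps: "(\<forall>s. s \<prec> t \<longrightarrow> (\<exists>p d p' d'. \<langle>s, \<langle>p, d\<rangle>\<rangle> \<in> D h \<and> \<langle>s \<oplus> \<one>, \<langle>p', d'\<rangle>\<rangle> \<in> D h \<and>
        step_in M X e p d p' d')) \<longrightarrow>
      (\<forall>s. s \<prec> t \<longrightarrow> (\<exists>p d p' d'. \<langle>s, \<langle>p, d\<rangle>\<rangle> \<in> D h \<and> \<langle>s \<oplus> \<one>, \<langle>p', d'\<rangle>\<rangle> \<in> D h \<and>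
        step_in M X' e p d p' d'))" for t by meson
  from assms(2) show ?thesis unfolding halts_by_def
    by (elim conjE) (erule exE, (erule conjE)+, intro conjI, assumption, rule exI, rule conjI, assumption, rule conjI, assumption, rule conjI,
        rule steps[THEN mp], assumption, assumption)
qed

definition jump_approx :: "'a \<Rightarrow> 'a \<Rightarrow> 'a" where
  "jump_approx c s = code_below s (\<lambda>e. \<exists>h. h \<prec> s \<and> halts_by (D c) e h)"

lemma definable_fun_jump_approx [arith_intros]: "definable_fun c \<Longrightarrow> definable_fun s \<Longrightarrow> definable_fun (\<lambda>v. jump_approx (c v) (s v))"
  by (rule definable_fun_subst2[where F = jump_approx]) (unfold jump_approx_def, intro arith_intros)

lemma D_jump_approx: "D (jump_approx c s) = {e. e \<prec> s \<and> (\<exists>h. h \<prec> s \<and> halts_by (D c) e h)}"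
  unfolding jump_approx_def by (rule D_code_below) (intro arith_intros)

text \<open>The approximation to the \<open>k\<close>-th jump of \<open>X\<close> computed from the block \<open>G (e - k), \<dots>, G (e - 1)\<close>:
  the last entry bounds the computations of the first jump, and so on backwards.\<close>

definition level :: "'a set \<Rightarrow> ('a \<Rightarrow> 'a) \<Rightarrow> 'a \<Rightarrow> 'a \<Rightarrow> 'a" where
  "level X G e k = Rec (\<lambda>j c. jump_approx c (G (e \<ominus> (j \<oplus> \<one>)))) (code_below (G (e \<ominus> \<one>)) (\<lambda>x. x \<in> X)) k"

lemma definable_fun_level [arith_intros]:
  assumes "\<And>g t. definable_fun t \<Longrightarrow> definable_fun (\<lambda>v. G (\<lambda>i. v (g i)) (t v))" "X \<in> S" "definable_fun e" "definable_fun k"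
  shows "definable_fun (\<lambda>v. level X (G v) (e v) (k v))"
proof -
  have G: "definable_fun t \<Longrightarrow> definable_fun (\<lambda>v. G v (t v))" for t using assms(1)[of t "\<lambda>i. i"] by simp
  show ?thesis unfolding level_def
    by (intro arith_intros assms(1,2,4) G definable_fun_ren[OF assms(3)] assms(3))
qed

text \<open>Oracles are coded sets, so \<open>X\<close> enters cut off at the last entry of the
  block. Nothing is lost: the first jump admits only histories below that entry, and these query
  smaller numbers.\<close>

lemma level_0:
  assumes "definable_fun (\<lambda>v. G (v 0))" "X \<in> S" shows "D (level X G e \<zero>) = {x. x \<prec> G (e \<ominus> \<one>) \<and> x \<in> X}"
  unfolding level_def
  by (subst Rec_0, intro arith_intros definable_fun_subst1[OF assms(1)], rule D_code_below, intro arith_intros assms)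

lemma level_Suc:
  assumes "definable_fun (\<lambda>v. G (v 0))"
  shows "level X G e (k \<oplus> \<one>) = jump_approx (level X G e k) (G (e \<ominus> (k \<oplus> \<one>)))"
  unfolding level_def by (rule Rec_Suc) (intro arith_intros definable_fun_subst1[OF assms])

text \<open>Only the \<open>k\<close> entries from \<open>b\<close> on are consulted. At k = 0 the
  cut-off of \<open>X\<close> would instead read the entry just before the block, hence the
  condition on \<open>k\<close>.\<close>

lemma level_shift:
  assumes G: "definable_fun (\<lambda>v. G (v 0))" and G': "definable_fun (\<lambda>v. G' (v 0))" and X: "X \<in> S"
    and eq: "\<And>r. r \<prec> k \<Longrightarrow> G (b \<oplus> r) = G' (b' \<oplus> r)" and "k \<noteq> \<zero>"
  shows "level X G (b \<oplus> k) k = level X G' (b' \<oplus> k) k"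
proof -
  have G1: "definable_fun t \<Longrightarrow> definable_fun (\<lambda>v. G (t v))" and G2: "definable_fun t \<Longrightarrow> definable_fun (\<lambda>v. G' (t v))" for t
    using definable_fun_subst1[OF G] definable_fun_subst1[OF G'] by blast+
  have sub: "b \<oplus> k \<ominus> (j \<oplus> \<one>) = b \<oplus> r" if "k = j \<oplus> \<one> \<oplus> r" for b j r
    unfolding that by (metis plus_minus plus_commute plus_assoc)
  have *: "G (b \<oplus> k \<ominus> (j \<oplus> \<one>)) = G' (b' \<oplus> k \<ominus> (j \<oplus> \<one>))" if j: "j \<prec> k" for j
  proof -
    obtain r where r: "k = j \<oplus> \<one> \<oplus> r" using j unfolding Suc_le[symmetric] le_iff by metis
    then have "r \<prec> k" by (metis less_Suc_le le_add(2) plus_assoc plus_commute)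
    then show ?thesis using eq sub[OF r] by simp
  qed
  have "j \<preceq> k \<longrightarrow> level X G (b \<oplus> k) j = level X G' (b' \<oplus> k) j" for j
  proof (rule definable_induct[of "\<lambda>j. j \<preceq> k \<longrightarrow> level X G (b \<oplus> k) j = level X G' (b' \<oplus> k) j"])
    show "definable (\<lambda>v. v 0 \<preceq> k \<longrightarrow> level X G (b \<oplus> k) (v 0) = level X G' (b' \<oplus> k) (v 0))"
      by (intro arith_intros G1 G2 X)
    have "G (b \<oplus> k \<ominus> \<one>) = G' (b' \<oplus> k \<ominus> \<one>)" using *[of \<zero>] \<open>k \<noteq> \<zero>\<close> by (simp add: pos_iff)
    then show "\<zero> \<preceq> k \<longrightarrow> level X G (b \<oplus> k) \<zero> = level X G' (b' \<oplus> k) \<zero>"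
      unfolding level_def by (subst Rec_0, intro arith_intros G1, subst Rec_0, intro arith_intros G2) simp
    fix j assume IH: "j \<preceq> k \<longrightarrow> level X G (b \<oplus> k) j = level X G' (b' \<oplus> k) j"
    show "j \<oplus> \<one> \<preceq> k \<longrightarrow> level X G (b \<oplus> k) (j \<oplus> \<one>) = level X G' (b' \<oplus> k) (j \<oplus> \<one>)"
      unfolding level_Suc[OF G] level_Suc[OF G'] Suc_le using IH * by (simp add: le_def)
  qed
  then show ?thesis by simp
qed

end

section \<open>The jump hierarchy from a homogeneous set\<close>

context rca0_rt begin

text \<open>The increasing enumeration of \<open>A\<close> from index 0; only indices below the
  number of elements are meaningful.\<close>

definition elt :: "'a set \<Rightarrow> 'a \<Rightarrow> 'a" where
  "elt A = Rec (\<lambda>_ u. mu (\<lambda>y. y \<in> A \<and> u \<prec> y)) (mu (\<lambda>y. y \<in> A))"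

lemma definable_fun_elt_D [arith_intros]: "definable_fun c \<Longrightarrow> definable_fun i \<Longrightarrow> definable_fun (\<lambda>v. elt (D (c v)) (i v))"
proof (rule definable_fun_subst2[where F = "\<lambda>c i. elt (D c) i"])
  have next_definable_fun: "definable_fun c \<Longrightarrow> definable_fun u \<Longrightarrow> definable_fun (\<lambda>v. mu (\<lambda>y. y \<in> D (c v) \<and> u v \<prec> y))" for c u
    by (rule definable_fun_subst2[where F = "\<lambda>c u. mu (\<lambda>y. y \<in> D c \<and> u \<prec> y)"]) (intro arith_intros)
  show "definable_fun (\<lambda>v. elt (D (v 0)) (v 1))" unfolding elt_def
    by (rule definable_fun_Rec, rule next_definable_fun[OF definable_fun_var], assumption, intro arith_intros, intro arith_intros)
qed

lemma definable_fun_elt [arith_intros]: assumes "A \<in> S" "definable_fun i" shows "definable_fun (\<lambda>v. elt A (i v))"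
proof -
  have next_definable_fun: "definable_fun u \<Longrightarrow> definable_fun (\<lambda>v. mu (\<lambda>y. y \<in> A \<and> u v \<prec> y))" for u
    by (rule definable_fun_subst1[where F = "\<lambda>u. mu (\<lambda>y. y \<in> A \<and> u \<prec> y)"]) (intro arith_intros assms)
  show ?thesis unfolding elt_def
    by (rule definable_fun_Rec, rule next_definable_fun, assumption, intro arith_intros assms, rule assms)
qed

lemma elt_0: "A \<in> S \<Longrightarrow> elt A \<zero> = mu (\<lambda>y. y \<in> A)"
  unfolding elt_def by (rule Rec_0) (intro arith_intros)

lemma elt_Suc: "A \<in> S \<Longrightarrow> elt A (i \<oplus> \<one>) = mu (\<lambda>y. y \<in> A \<and> elt A i \<prec> y)"
  unfolding elt_def by (rule Rec_Suc) (intro arith_intros)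

lemma D_in_S: "D c \<in> S"
  using definable_comprehension[of "\<lambda>x. x \<in> D c"] by (simp add: bounded_intros)

lemma elt_infinite:
  assumes "L \<in> S" "infinite_in M L"
  shows "elt L i \<in> L" "elt L i \<prec> elt L (i \<oplus> \<one>)"
proof -
  have ex: "\<exists>y. y \<in> L \<and> u \<prec> y" for u using assms(2) by (auto simp: infinite_in_def)
  have least: "mu (\<lambda>y. y \<in> L \<and> u \<prec> y) \<in> L \<and> u \<prec> mu (\<lambda>y. y \<in> L \<and> u \<prec> y)" for u
  proof -
    obtain y where y: "y \<in> L \<and> u \<prec> y" using ex by blast
    have "definable (\<lambda>v. v 0 \<in> L \<and> u \<prec> v 0)" by (intro arith_intros assms)
    from mu_least(1)[where P = "\<lambda>y. y \<in> L \<and> u \<prec> y", OF this y] show ?thesis .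
  qed
  show "elt L i \<prec> elt L (i \<oplus> \<one>)" unfolding elt_Suc[OF assms(1)] using least by blast
  show "elt L i \<in> L"
  proof (cases "i = \<zero>")
    case True
    obtain y where y: "y \<in> L" using ex by blast
    have "definable (\<lambda>v. v 0 \<in> L)" by (intro arith_intros assms)
    from mu_least(1)[where P = "\<lambda>y. y \<in> L", OF this y] show ?thesis
      unfolding True elt_0[OF assms(1)] .
  next
    case False
    then obtain j where "i = j \<oplus> \<one>" using nonzero_Suc by blast
    then show ?thesis using least by (simp add: elt_Suc[OF assms(1)])
  qed
qed

lemma seq_mono:
  assumes "definable_fun (\<lambda>v. g (v 0))" "\<And>i. i \<prec> a \<Longrightarrow> g i \<prec> g (i \<oplus> \<one>)" "i \<prec> j" "j \<preceq> a"
  shows "g i \<prec> g j"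
proof -
  have "i \<prec> j \<and> j \<preceq> a \<longrightarrow> g i \<prec> g j"
  proof (rule definable_induct[of "\<lambda>j. i \<prec> j \<and> j \<preceq> a \<longrightarrow> g i \<prec> g j"])
    show "definable (\<lambda>v. i \<prec> v 0 \<and> v 0 \<preceq> a \<longrightarrow> g i \<prec> g (v 0))" by (intro arith_intros definable_fun_subst1[OF assms(1)])
    fix j assume IH: "i \<prec> j \<and> j \<preceq> a \<longrightarrow> g i \<prec> g j"
    show "i \<prec> j \<oplus> \<one> \<and> j \<oplus> \<one> \<preceq> a \<longrightarrow> g i \<prec> g (j \<oplus> \<one>)"
      using IH assms(2)[of j] less_trans unfolding Suc_le less_Suc_le by (auto simp: le_def)
  qed simp
  with assms show ?thesis by blast
qed

text \<open>The values up to index \<open>g \<zero>\<close> number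
  \<open>g \<zero> \<oplus> \<one>\<close> and have minimum \<open>g \<zero>\<close>, and the graph
  of \<open>g\<close> is the enumeration required. Exactly large sets can thus be laid out by a
  formula and read back through \<open>elt\<close>.\<close>

lemma large_of_seq:
  assumes g: "definable_fun (\<lambda>v. g (v 0))" and inc: "\<And>i. i \<prec> g \<zero> \<Longrightarrow> g i \<prec> g (i \<oplus> \<one>)"
  obtains c where "exactly_large_in M c" "D c = {g i |i. i \<preceq> g \<zero>}" "\<And>i. i \<preceq> g \<zero> \<Longrightarrow> elt (D c) i = g i"
proof -
  define a where "a = g \<zero>"
  note g1 = definable_fun_subst1[OF g]
  have mono: "g i \<prec> g j" if "i \<prec> j" "j \<preceq> a" for i j
    using seq_mono[of g a i j] g inc that unfolding a_def by blast
  have mono': "g i \<preceq> g j" if "i \<preceq> j" "j \<preceq> a" for i j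
    using mono that by (auto simp: le_def)
  have inj: "i = j" if "g i = g j" "i \<preceq> a" "j \<preceq> a" for i j
    using mono that less_linear less_irrefl by metis
  have "\<exists>z. D z = {y. \<exists>i. i \<preceq> a \<and> y = g i}"
    by (rule definable_finite_set[of _ "g a \<oplus> \<one>"], intro arith_intros g1) (auto simp: less_Suc_le intro: mono')
  then obtain z where "D z = {y. \<exists>i. i \<preceq> a \<and> y = g i}" ..
  then have z: "y \<in> D z \<longleftrightarrow> (\<exists>i. i \<preceq> a \<and> y = g i)" for y by auto
  have "\<exists>f. D f = {p. \<exists>i. i \<preceq> a \<and> p = \<langle>i, g i\<rangle>}"
    by (rule definable_finite_set[of _ "\<langle>a \<oplus> \<one>, g a \<oplus> \<one>\<rangle>"], intro arith_intros g1)
      (auto simp: less_Suc_le intro!: pair_less intro: mono')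
  then obtain f where "D f = {p. \<exists>i. i \<preceq> a \<and> p = \<langle>i, g i\<rangle>}" ..
  then have f: "p \<in> D f \<longleftrightarrow> (\<exists>i. i \<preceq> a \<and> p = \<langle>i, g i\<rangle>)" for p by auto
  have "enumeration f z (a \<oplus> \<one>)" unfolding enumeration_def Ball_def f z less_Suc_le
    using inj by (auto; metis)
  then have "fin_card_in M z (a \<oplus> \<one>)" using fin_card_enumeration by blast
  moreover have "a \<in> D z" unfolding z a_def using zero_le by blast
  moreover have "\<not> y \<prec> a" if "y \<in> D z" for y
    using that mono'[OF zero_le] unfolding z a_def by (metis N.not_less)
  ultimately obtain c where c: "exactly_large_in M c" "D c = D z" using exactly_large_exists by blast
  have "i \<preceq> a \<longrightarrow> elt (D c) i = g i" for i
  proof (rule definable_induct[of "\<lambda>i. i \<preceq> a \<longrightarrow> elt (D c) i = g i"])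
    show "definable (\<lambda>v. v 0 \<preceq> a \<longrightarrow> elt (D c) (v 0) = g (v 0))" by (intro arith_intros g1)
    have "elt (D c) \<zero> = g \<zero>" unfolding elt_0[OF D_in_S]
    proof (rule mu_eq)
      show "g \<zero> \<in> D c" unfolding c z using zero_le by blast
      show "y \<notin> D c" if "y \<prec> g \<zero>" for y
        using that mono'[OF zero_le] unfolding c z by (metis N.not_less)
    qed
    then show "\<zero> \<preceq> a \<longrightarrow> elt (D c) \<zero> = g \<zero>" by blast
    fix i assume IH: "i \<preceq> a \<longrightarrow> elt (D c) i = g i"
    show "i \<oplus> \<one> \<preceq> a \<longrightarrow> elt (D c) (i \<oplus> \<one>) = g (i \<oplus> \<one>)"
    proof
      assume i: "i \<oplus> \<one> \<preceq> a"
      then have "i \<preceq> a" unfolding Suc_le by (rule N.less_imp_le)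
      show "elt (D c) (i \<oplus> \<one>) = g (i \<oplus> \<one>)" unfolding elt_Suc[OF D_in_S] IH[rule_format, OF \<open>i \<preceq> a\<close>]
      proof (rule mu_eq)
        show "g (i \<oplus> \<one>) \<in> D c \<and> g i \<prec> g (i \<oplus> \<one>)"
          unfolding c z using i mono[OF less_Suc i] by blast
        show "\<not> (y \<in> D c \<and> g i \<prec> y)" if y: "y \<prec> g (i \<oplus> \<one>)" for y
        proof
          assume "y \<in> D c \<and> g i \<prec> y"
          then obtain j where j: "j \<preceq> a" "y = g j" "g i \<prec> g j" unfolding c z by blast
          have "\<not> i \<oplus> \<one> \<preceq> j" using mono'[of "i \<oplus> \<one>" j] j y by (metis N.not_less)
          moreover have "\<not> j \<preceq> i" using mono'[of j i] \<open>i \<preceq> a\<close> j by (metis N.not_less)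
          ultimately show False unfolding Suc_le by (metis N.not_less)
        qed
      qed
    qed
  qed
  moreover have "D c = {g i |i. i \<preceq> a}" unfolding c(2) using z by blast
  ultimately show thesis using that c(1) unfolding a_def by blast
qed

section \<open>Halving and repeated values\<close>

lemma half_less: "n \<prec> m \<Longrightarrow> n \<oplus> n \<oplus> \<one> \<prec> m \<oplus> m"
proof -
  assume "n \<prec> m"
  then have "(n \<oplus> \<one>) \<oplus> (n \<oplus> \<one>) \<preceq> m \<oplus> m" by (intro N.add_mono) (simp_all add: Suc_le)
  then have "n \<oplus> n \<oplus> \<one> \<oplus> \<one> \<preceq> m \<oplus> m" by (simp only: N.add_ac)
  then show ?thesis unfolding Suc_le .
qed

lemma half_unique:
  assumes "a = n \<oplus> n \<or> a = n \<oplus> n \<oplus> \<one>" "a = m \<oplus> m \<or> a = m \<oplus> m \<oplus> \<one>"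
  shows "m = n"
proof -
  have "\<not> n \<prec> m" if "a = n \<oplus> n \<or> a = n \<oplus> n \<oplus> \<one>" "a = m \<oplus> m \<or> a = m \<oplus> m \<oplus> \<one>" for n m
  proof
    assume "n \<prec> m"
    have "a \<preceq> n \<oplus> n \<oplus> \<one>" "m \<oplus> m \<preceq> a" using that by auto
    with half_less[OF \<open>n \<prec> m\<close>] show False by order
  qed
  with assms less_linear show ?thesis by blast
qed

lemma half_exists: "\<exists>n. a = n \<oplus> n \<or> a = n \<oplus> n \<oplus> \<one>"
proof (rule definable_induct[of "\<lambda>a. \<exists>n. a = n \<oplus> n \<or> a = n \<oplus> n \<oplus> \<one>"])
  show "\<exists>n. \<zero> = n \<oplus> n \<or> \<zero> = n \<oplus> n \<oplus> \<one>" by (intro exI[of _ \<zero>]) simp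
  fix a assume "\<exists>n. a = n \<oplus> n \<or> a = n \<oplus> n \<oplus> \<one>"
  then obtain n where "a = n \<oplus> n \<or> a = n \<oplus> n \<oplus> \<one>" ..
  moreover have "n \<oplus> n \<oplus> \<one> \<oplus> \<one> = (n \<oplus> \<one>) \<oplus> (n \<oplus> \<one>)" by (simp only: N.add_ac)
  ultimately show "\<exists>n. a \<oplus> \<one> = n \<oplus> n \<or> a \<oplus> \<one> = n \<oplus> n \<oplus> \<one>" by metis
qed (intro arith_intros)

text \<open>If no value recurred at distance \<open>n\<close>, each value would eventually be
  abandoned: once taken at some \<open>p\<close> beyond \<open>i\<close>, it is not taken from
  \<open>p \<oplus> n\<close> on. Induction over the values up to \<open>K\<close> then leaves none.
  The distance is what keeps blocks of length \<open>n\<close> disjoint.\<close>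

lemma bounded_repeats:
  assumes "\<And>t. definable_fun t \<Longrightarrow> definable_fun (\<lambda>v. f (t v))" "\<And>p. f p \<preceq> K"
  shows "\<exists>p q. i \<prec> p \<and> p \<oplus> n \<preceq> q \<and> f p = f q"
proof (rule ccontr)
  assume *: "\<not> ?thesis"
  have "\<exists>b. \<forall>p. b \<preceq> p \<longrightarrow> \<not> f p \<prec> K \<oplus> \<one>"
  proof (rule definable_induct[of "\<lambda>k. \<exists>b. \<forall>p. b \<preceq> p \<longrightarrow> \<not> f p \<prec> k"])
    fix k assume "\<exists>b. \<forall>p. b \<preceq> p \<longrightarrow> \<not> f p \<prec> k"
    then obtain b where b: "\<And>p. b \<preceq> p \<Longrightarrow> \<not> f p \<prec> k" by blast
    show "\<exists>b. \<forall>p. b \<preceq> p \<longrightarrow> \<not> f p \<prec> k \<oplus> \<one>"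
    proof (cases "\<exists>p. i \<prec> p \<and> f p = k")
      case True
      then obtain p where p: "i \<prec> p" "f p = k" by blast
      have "\<not> f q \<prec> k \<oplus> \<one>" if q: "b \<oplus> (p \<oplus> n) \<preceq> q" for q
      proof -
        have "b \<preceq> q" "p \<oplus> n \<preceq> q" using q N.order_trans le_add by blast+
        with * p b show ?thesis unfolding basic(8) by metis
      qed
      then show ?thesis by blast
    next
      case False
      have "\<not> f q \<prec> k \<oplus> \<one>" if q: "b \<oplus> (i \<oplus> \<one>) \<preceq> q" for q
      proof -
        have "b \<preceq> q" "i \<oplus> \<one> \<preceq> q" using q N.order_trans le_add by blast+
        with False b show ?thesis unfolding basic(8) Suc_le by blast
      qed
      then show ?thesis by blast
    qed
  qed (intro arith_intros assms(1), simp)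
  with assms(2) show False unfolding less_Suc_le by blast
qed

theorem omega_jump_exists:
  assumes X: "X \<in> S"
  shows "\<exists>Y\<in>S. projection_in M Y \<zero> = X \<and>
    (\<forall>k. projection_in M Y (k \<oplus> \<one>) = jump_in M (projection_in M Y k))"
proof -
  \<comment> \<open>Position 0 of the set holds a, positions 1 to n and n + 1 to 2n the two blocks;
    n is a div 2, given by its defining equations. As \<open>level\<close> is told where a segment
    ends, \<open>\<one> \<oplus> k\<close> and \<open>\<one> \<oplus> n \<oplus> k\<close> select
    the first \<open>k\<close> entries of each block.\<close>
  define \<psi> where "\<psi> c \<longleftrightarrow> (\<forall>n k x. (elt (D c) \<zero> = n \<oplus> n \<or> elt (D c) \<zero> = n \<oplus> n \<oplus> \<one>) \<longrightarrow>
      k \<noteq> \<zero> \<and> k \<preceq> n \<and> x \<prec> elt (D c) \<zero> \<longrightarrow>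
      (x \<in> D (level X (elt (D c)) (\<one> \<oplus> k) k) \<longleftrightarrow> x \<in> D (level X (elt (D c)) (\<one> \<oplus> n \<oplus> k) k)))" for c
  have "definable (\<lambda>v. \<psi> (v 0))" unfolding \<psi>_def by (intro arith_intros definable_fun_level X)
  then obtain L col where L: "L \<in> S" "infinite_in M L"
    and hom: "\<And>c. exactly_large_in M c \<Longrightarrow> D c \<subseteq> L \<Longrightarrow> \<psi> c \<longleftrightarrow> col" by (rule homogeneous) (rule that)
  define l where "l = elt L"
  have definable_l: "definable_fun t \<Longrightarrow> definable_fun (\<lambda>v. l (t v))" for t unfolding l_def by (intro arith_intros L)
  have l_in: "l i \<in> L" and l_Suc: "l i \<prec> l (i \<oplus> \<one>)" for i
    using elt_infinite[OF L] by (simp_all add: l_def)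
  have l_mono: "l i \<prec> l j" if "i \<prec> j" for i j
    by (rule seq_mono[of l j]) (use definable_l definable_fun_var l_Suc that in auto)
  have l_ge: "i \<preceq> l i" for i
  proof (rule definable_induct[of "\<lambda>i. i \<preceq> l i"])
    show "i \<oplus> \<one> \<preceq> l (i \<oplus> \<one>)" if "i \<preceq> l i" for i
      unfolding Suc_le using that l_Suc[of i] by order
  qed (intro arith_intros definable_l, simp)
  text \<open>The exactly large set consisting of \<open>l i\<close> and two blocks of length \<open>n\<close>, plus one more element if
    \<open>l i\<close> is odd.\<close>
  have blocks: "col \<longleftrightarrow> (\<forall>k x. k \<noteq> \<zero> \<and> k \<preceq> n \<and> x \<prec> l i \<longrightarrow>
      (x \<in> D (level X l (p \<oplus> k) k) \<longleftrightarrow> x \<in> D (level X l (q \<oplus> k) k)))"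
    if n: "l i = n \<oplus> n \<or> l i = n \<oplus> n \<oplus> \<one>" and "n \<noteq> \<zero>" and p: "i \<prec> p" and q: "p \<oplus> n \<preceq> q" for i n p q
  proof -
    \<comment> \<open>Defined and increasing at all indices, the last part simply running on along
      \<open>L\<close>. Whether \<open>l i\<close> is even or odd only decides where
      \<open>large_of_seq\<close> stops.\<close>
    define g where "g j = (if j = \<zero> then l i else if j \<preceq> n then l (p \<oplus> (j \<ominus> \<one>)) else l (q \<oplus> (j \<ominus> (n \<oplus> \<one>))))" for j
    have definable_g: "definable_fun (\<lambda>v. g (v 0))" unfolding g_def by (intro arith_intros definable_l)
    have g0: "g \<zero> = l i" by (simp add: g_def)
    have g1: "g (\<one> \<oplus> r) = l (p \<oplus> r)" if "r \<prec> n" for r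
      using that by (simp add: g_def plus_minus) (simp add: Suc_le plus_commute[of \<one>])
    have g2: "g (\<one> \<oplus> n \<oplus> r) = l (q \<oplus> r)" for r
    proof -
      have "\<not> \<one> \<oplus> n \<oplus> r \<preceq> n" by (metis N.not_le le_add(1) less_Suc N.less_le_trans plus_commute)
      moreover have "\<one> \<oplus> n \<oplus> r \<ominus> (n \<oplus> \<one>) = r" by (metis plus_commute plus_minus)
      ultimately show ?thesis by (simp add: g_def)
    qed
    have g_in: "g j \<in> L" for j unfolding g_def using l_in by simp
    have inc: "g j \<prec> g (j \<oplus> \<one>)" for j
    proof -
      consider "j = \<zero>" | r where "j = \<one> \<oplus> r" "r \<oplus> \<one> \<prec> n" | r where "j = \<one> \<oplus> r" "r \<oplus> \<one> = n" |
          r where "j = \<one> \<oplus> n \<oplus> r"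
      proof (cases "j = \<zero>")
        case False
        then obtain r where r: "j = \<one> \<oplus> r" using nonzero_Suc plus_commute by metis
        show ?thesis
        proof (cases "r \<prec> n")
          case True
          then have "r \<oplus> \<one> \<prec> n \<or> r \<oplus> \<one> = n" using Suc_le[of r n] by (simp add: le_def)
          then show ?thesis using that(2,3) r by blast
        next
          case False
          then obtain s where "r = n \<oplus> s" unfolding N.not_less le_iff by metis
          then show ?thesis using that(4) r by (simp only: plus_assoc)
        qed
      qed
      then show ?thesis
      proof cases
        case 1
        then show ?thesis using g0 g1[of \<zero>] l_mono[OF p] \<open>n \<noteq> \<zero>\<close> by (simp add: pos_iff)
      next
        case 2
        then have "r \<prec> n" using less_Suc less_trans by blast
        then show ?thesis using g1[of r] g1[of "r \<oplus> \<one>"] 2 l_Suc[of "p \<oplus> r"] by (simp add: plus_assoc)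
      next
        case 3
        then have "r \<prec> n" using less_Suc by blast
        have "j \<oplus> \<one> = \<one> \<oplus> n \<oplus> \<zero>" using 3 by (simp add: plus_assoc)
        moreover have "p \<oplus> r \<prec> q" using q 3(2) by (metis Suc_le plus_assoc)
        ultimately show ?thesis using g1[OF \<open>r \<prec> n\<close>] g2[of \<zero>] 3(1) l_mono by simp
      next
        case 4
        then show ?thesis using g2[of r] g2[of "r \<oplus> \<one>"] l_Suc[of "q \<oplus> r"] by (simp add: plus_assoc)
      qed
    qed
    obtain c where c: "exactly_large_in M c" "D c = {g i |i. i \<preceq> g \<zero>}"
      "\<And>i. i \<preceq> g \<zero> \<Longrightarrow> elt (D c) i = g i"
      by (rule large_of_seq[OF definable_g inc]) (rule that)
    have "D c \<subseteq> L" unfolding c(2) using g_in by blast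
    have en0: "elt (D c) \<zero> = l i" using c(3)[of \<zero>] g0 by simp
    \<comment> \<open>The second block ends at index 2n, which is at most \<open>l i\<close>, so
      \<open>elt\<close> still agrees with \<open>g\<close> there.\<close>
    have le: "\<one> \<oplus> n \<oplus> r \<preceq> l i" if "r \<prec> n" for r
    proof -
      have "n \<oplus> (r \<oplus> \<one>) \<preceq> n \<oplus> n" using that by (intro N.add_left_mono) (simp add: Suc_le)
      also have "\<dots> \<preceq> l i" using n by auto
      finally show ?thesis by (simp only: N.add_ac)
    qed
    have 1: "level X (elt (D c)) (\<one> \<oplus> k) k = level X l (p \<oplus> k) k"
      and 2: "level X (elt (D c)) (\<one> \<oplus> n \<oplus> k) k = level X l (q \<oplus> k) k" if "k \<noteq> \<zero>" "k \<preceq> n" for k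
    proof -
      show "level X (elt (D c)) (\<one> \<oplus> k) k = level X l (p \<oplus> k) k"
      proof (rule level_shift[OF _ _ X _ that(1)])
        fix r assume "r \<prec> k"
        then have "r \<prec> n" using that(2) by order
        moreover have "\<one> \<oplus> r \<preceq> \<one> \<oplus> n \<oplus> r" by (metis le_add(1) plus_assoc plus_commute)
        with le[OF \<open>r \<prec> n\<close>] have "\<one> \<oplus> r \<preceq> l i" by order
        ultimately show "elt (D c) (\<one> \<oplus> r) = l (p \<oplus> r)" using c(3) g0 g1 by simp
      qed (intro arith_intros definable_l)+
      show "level X (elt (D c)) (\<one> \<oplus> n \<oplus> k) k = level X l (q \<oplus> k) k"
      proof (rule level_shift[OF _ _ X _ that(1)])
        fix r assume "r \<prec> k"
        then have "r \<prec> n" using that(2) by order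
        then show "elt (D c) (\<one> \<oplus> n \<oplus> r) = l (q \<oplus> r)" using c(3) g0 g2 le by simp
      qed (intro arith_intros definable_l)+
    qed
    have "\<psi> c \<longleftrightarrow> (\<forall>k x. k \<noteq> \<zero> \<and> k \<preceq> n \<and> x \<prec> l i \<longrightarrow>
      (x \<in> D (level X l (p \<oplus> k) k) \<longleftrightarrow> x \<in> D (level X l (q \<oplus> k) k)))" (is "_ \<longleftrightarrow> ?R")
    proof
      assume "\<psi> c"
      from this[unfolded \<psi>_def en0, rule_format, OF n] show ?R using 1 2 by simp
    next
      assume R: ?R
      show "\<psi> c" unfolding \<psi>_def en0
      proof (intro allI impI)
        fix n' k x
        assume "l i = n' \<oplus> n' \<or> l i = n' \<oplus> n' \<oplus> \<one>" and *: "k \<noteq> \<zero> \<and> k \<preceq> n' \<and> x \<prec> l i"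
        then have "n' = n" using half_unique[OF n] by blast
        with R * show "x \<in> D (level X (elt (D c)) (\<one> \<oplus> k) k) \<longleftrightarrow>
            x \<in> D (level X (elt (D c)) (\<one> \<oplus> n' \<oplus> k) k)" by (simp add: 1 2)
      qed
    qed
    with hom[OF c(1) \<open>D c \<subseteq> L\<close>] show ?thesis by simp
  qed
  have col
  proof -
    \<comment> \<open>Since every index is at most its value under \<open>l\<close>, index 2 gives
      an element of at least 2, so the blocks are nonempty.\<close>
    define i where "i = \<one> \<oplus> \<one>"
    obtain n where n: "l i = n \<oplus> n \<or> l i = n \<oplus> n \<oplus> \<one>" using half_exists by blast
    have "n \<noteq> \<zero>"
    proof
      assume "n = \<zero>"
      with n have "l i \<preceq> \<one>" by auto
      with l_ge[of i] less_Suc[of \<one>] show False unfolding i_def by order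
    qed
    \<comment> \<open>The approximations for all \<open>k\<close> up to \<open>n\<close>, restricted
      to numbers below \<open>l i\<close>, are packed into one set of pairs under a bound
      independent of \<open>p\<close>. A single repeated code then makes all of them agree at
      once.\<close>
    let ?P = "\<lambda>p y. \<exists>k x. y = \<langle>k, x\<rangle> \<and> k \<preceq> n \<and> x \<prec> l i \<and> x \<in> D (level X l (p \<oplus> k) k)"
    let ?B = "\<langle>n \<oplus> \<one>, l i\<rangle>"
    have definable_P: "definable (\<lambda>v. ?P p (v 0))" for p by (intro arith_intros definable_fun_level definable_l X)
    obtain K where "\<And>P. definable (\<lambda>v. P (v 0)) \<Longrightarrow> code_below ?B P \<preceq> K" using code_below_bounded by blast
    from this[OF definable_P] have "code_below ?B (?P p) \<preceq> K" for p .
    moreover have "definable_fun t \<Longrightarrow> definable_fun (\<lambda>v. code_below ?B (?P (t v)))" for t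
      by (rule definable_fun_subst1[where F = "\<lambda>p. code_below ?B (?P p)"]) (intro arith_intros definable_fun_level definable_l X)
    ultimately obtain p q where pq: "i \<prec> p" "p \<oplus> n \<preceq> q" "code_below ?B (?P p) = code_below ?B (?P q)"
      using bounded_repeats[of "\<lambda>p. code_below ?B (?P p)" K i n] by blast
    have "x \<in> D (level X l (p \<oplus> k) k) \<longleftrightarrow> \<langle>k, x\<rangle> \<in> D (code_below ?B (?P p))" if "k \<preceq> n" "x \<prec> l i" for k x p
    proof -
      have "\<langle>k, x\<rangle> \<prec> ?B" using that by (intro pair_less) (simp_all add: less_Suc_le)
      then show ?thesis unfolding D_code_below[OF definable_P] using that by simp
    qed
    then show ?thesis using blocks[OF n \<open>n \<noteq> \<zero>\<close> pq(1,2)] pq(3) by simp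
  qed
  \<comment> \<open>Blocks from \<open>p\<close> and \<open>p'\<close> may overlap, so both are
    compared with the block from \<open>p \<oplus> p' \<oplus> n\<close>, which lies beyond each of
    them.\<close>
  have indep: "x \<in> D (level X l (p \<oplus> k) k) \<longleftrightarrow> x \<in> D (level X l (p' \<oplus> k) k)"
    if k: "k \<noteq> \<zero>" "k \<oplus> k \<preceq> l i" and x: "x \<prec> l i" and p: "i \<prec> p" "i \<prec> p'" for i k x p p'
  proof -
    obtain n where n: "l i = n \<oplus> n \<or> l i = n \<oplus> n \<oplus> \<one>" using half_exists by blast
    have "k \<preceq> n"
    proof (rule ccontr)
      assume "\<not> k \<preceq> n"
      then have "n \<oplus> n \<oplus> \<one> \<prec> k \<oplus> k" by (intro half_less) order
      moreover have "l i \<preceq> n \<oplus> n \<oplus> \<one>" using n by auto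
      ultimately show False using k(2) by order
    qed
    moreover from this k(1) have "n \<noteq> \<zero>" by auto
    moreover have "p \<oplus> n \<preceq> p \<oplus> p' \<oplus> n" "p' \<oplus> n \<preceq> p \<oplus> p' \<oplus> n" by (auto simp: plus_assoc)
    ultimately show ?thesis using blocks[OF n] \<open>col\<close> k(1) x p by blast
  qed
  define J where "J p k = D (level X l (p \<oplus> k) k)" for p k
  have l1: "definable_fun (\<lambda>v. l (v 0))" by (intro definable_l arith_intros)
  have J_0: "J p \<zero> = {x. x \<prec> l (p \<ominus> \<one>) \<and> x \<in> X}" for p
    unfolding J_def using level_0[OF l1 X] by simp
  have J_Suc: "J p (k \<oplus> \<one>) = {x. x \<prec> l p \<and> (\<exists>h. h \<prec> l p \<and> halts_by (J (p \<oplus> \<one>) k) x h)}" for p k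
  proof -
    have "p \<oplus> (k \<oplus> \<one>) \<ominus> (k \<oplus> \<one>) = p" by (metis plus_commute plus_minus)
    moreover have "p \<oplus> (k \<oplus> \<one>) = p \<oplus> \<one> \<oplus> k" by (simp only: N.add_ac)
    ultimately show ?thesis unfolding J_def level_Suc[OF l1] D_jump_approx by simp
  qed
  \<comment> \<open>Level 0 is taken from \<open>X\<close> itself, as \<open>J p \<zero>\<close>
    contains only an initial part of it. At higher levels \<open>indep\<close> makes the choice of a
    large enough \<open>i\<close> immaterial.\<close>
  define Y where "Y = {y. \<exists>k x. y = \<langle>k, x\<rangle> \<and> (k = \<zero> \<and> x \<in> X \<or>
    k \<noteq> \<zero> \<and> (\<exists>i. k \<oplus> k \<preceq> l i \<and> x \<prec> l i \<and> x \<in> J (i \<oplus> \<one>) k))}"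
  have "Y \<in> S" unfolding Y_def J_def
    by (rule definable_comprehension) (intro arith_intros definable_fun_level definable_l X)
  define Yk where "Yk = projection_in M Y"
  have Yk: "x \<in> Yk k \<longleftrightarrow> (k = \<zero> \<and> x \<in> X \<or>
      k \<noteq> \<zero> \<and> (\<exists>i. k \<oplus> k \<preceq> l i \<and> x \<prec> l i \<and> x \<in> J (i \<oplus> \<one>) k))" for x k
    unfolding Yk_def projection_in_def Y_def by simp
  have agree: "x \<in> J p k \<longleftrightarrow> x \<in> Yk k" if k: "k \<oplus> k \<preceq> l i" and x: "x \<prec> l i" and p: "i \<prec> p" for i k x p
  proof (cases "k = \<zero>")
    case True
    \<comment> \<open>The cut-off of \<open>X\<close> sits at index p - 1, which is at least
      \<open>i\<close>, so the numbers below \<open>l i\<close> are unaffected.\<close>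
    obtain p' where p': "p = p' \<oplus> \<one>" using p nonzero_Suc by (metis not_less_zero)
    then have "i \<preceq> p'" using p by (simp add: less_Suc_le)
    then have "l i \<preceq> l p'" using l_mono by (auto simp: le_def)
    with x have "x \<prec> l p'" by order
    then show ?thesis unfolding True J_0 Yk p' by (simp add: plus_commute[of p'] plus_minus)
  next
    case False
    show ?thesis
    proof
      assume "x \<in> J p k"
      then have "x \<in> J (i \<oplus> \<one>) k" using indep[OF False k x p less_Suc] unfolding J_def by blast
      with False k x show "x \<in> Yk k" unfolding Yk by blast
    next
      assume "x \<in> Yk k"
      then obtain i' where i': "k \<oplus> k \<preceq> l i'" "x \<prec> l i'" "x \<in> J (i' \<oplus> \<one>) k"
        unfolding Yk using False by blast
      \<comment> \<open>A common starting point beyond both \<open>i\<close> and \<open>i'\<close>: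
        membership is carried there using \<open>i'\<close> and back to \<open>p\<close> using
        \<open>i\<close>.\<close>
      have "i' \<prec> i' \<oplus> \<one> \<oplus> p" "i \<prec> i' \<oplus> \<one> \<oplus> p"
        using less_Suc p N.less_le_trans le_add by blast+
      then have "x \<in> J (i' \<oplus> \<one> \<oplus> p) k" "x \<in> J (i' \<oplus> \<one> \<oplus> p) k \<longleftrightarrow> x \<in> J p k"
        using indep[OF False i'(1,2) less_Suc] i'(3) indep[OF False k x _ p] unfolding J_def by blast+
      then show "x \<in> J p k" by blast
    qed
  qed
  have jump: "Yk (k \<oplus> \<one>) = jump_in M (Yk k)" for k
  proof (rule set_eqI)
    fix x
    show "x \<in> Yk (k \<oplus> \<one>) \<longleftrightarrow> x \<in> jump_in M (Yk k)"
    proof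
      assume "x \<in> Yk (k \<oplus> \<one>)"
      then obtain i where i: "(k \<oplus> \<one>) \<oplus> (k \<oplus> \<one>) \<preceq> l i" "x \<in> J (i \<oplus> \<one>) (k \<oplus> \<one>)"
        unfolding Yk by auto
      then obtain h where h: "h \<prec> l (i \<oplus> \<one>)" "halts_by (J (i \<oplus> \<one> \<oplus> \<one>) k) x h" unfolding J_Suc by blast
      \<comment> \<open>The history lies below \<open>l (i \<oplus> \<one>)\<close>, so all its
        queries fall where \<open>agree\<close> applies at index
        \<open>i \<oplus> \<one>\<close>.\<close>
      have "k \<oplus> k \<preceq> (k \<oplus> \<one>) \<oplus> (k \<oplus> \<one>)" by (intro N.add_mono) simp_all
      with i(1) l_Suc[of i] have "k \<oplus> k \<preceq> l (i \<oplus> \<one>)" by order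
      then have "y \<in> J (i \<oplus> \<one> \<oplus> \<one>) k \<longleftrightarrow> y \<in> Yk k" if "y \<prec> h" for y
        by (rule agree[OF _ _ less_Suc]) (use that h in order)
      with h(2) show "x \<in> jump_in M (Yk k)" unfolding jump_halts_by using halts_by_use by blast
    next
      assume "x \<in> jump_in M (Yk k)"
      then obtain h where h: "halts_by (Yk k) x h" unfolding jump_halts_by by blast
      \<comment> \<open>The sum dominates 2(k + 1) and exceeds \<open>x\<close> and
        \<open>h\<close>; by \<open>l_ge\<close> so does \<open>l i\<close>, leaving room for level
        k + 1, the program and its history.\<close>
      define i where "i = ((k \<oplus> \<one>) \<oplus> (k \<oplus> \<one>)) \<oplus> ((x \<oplus> \<one>) \<oplus> (h \<oplus> \<one>))"
      have "(k \<oplus> \<one>) \<oplus> (k \<oplus> \<one>) \<preceq> i" "x \<oplus> \<one> \<preceq> i" "h \<oplus> \<one> \<preceq> i"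
        unfolding i_def using N.order_trans le_add by blast+
      then have i: "(k \<oplus> \<one>) \<oplus> (k \<oplus> \<one>) \<preceq> l i" "x \<prec> l i" "h \<prec> l i"
        using l_ge[of i] unfolding Suc_le[symmetric] by order+
      have "k \<oplus> k \<preceq> (k \<oplus> \<one>) \<oplus> (k \<oplus> \<one>)" by (intro N.add_mono) simp_all
      with i(1) l_Suc[of i] have "k \<oplus> k \<preceq> l (i \<oplus> \<one>)" by order
      moreover have h': "h \<prec> l (i \<oplus> \<one>)" "x \<prec> l (i \<oplus> \<one>)" using i l_Suc[of i] by order+
      ultimately have "y \<in> Yk k \<longleftrightarrow> y \<in> J (i \<oplus> \<one> \<oplus> \<one>) k" if "y \<prec> h" for y
        using agree[OF _ _ less_Suc, of k "i \<oplus> \<one>" y] that less_trans by blast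
      with h have "halts_by (J (i \<oplus> \<one> \<oplus> \<one>) k) x h" using halts_by_use by blast
      with h' have "x \<in> J (i \<oplus> \<one>) (k \<oplus> \<one>)" unfolding J_Suc by blast
      with i show "x \<in> Yk (k \<oplus> \<one>)" unfolding Yk by auto
    qed
  qed
  have "Yk \<zero> = X" using Yk by auto
  with jump \<open>Y \<in> S\<close> show ?thesis unfolding Yk_def by blast
qed

end

theorem theorem13:
  fixes M :: "'a l2_struct"
  assumes "l2_structure M"
    and "\<forall>p\<in>RCA0. M \<Turnstile> p"
  shows "M \<Turnstile> (RT_excl_omega \<^bold>\<longrightarrow> omega_jumps_exist)"
proof -
  interpret rca0 M by unfold_locales (use assms in auto)
  have "sat M v w omega_jumps_exist" if "sat M v w RT_excl_omega" for v w
  proof -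
    interpret rca0_rt M
      by unfold_locales (use that[unfolded sat_RT_excl_omega] in blast)
    show ?thesis unfolding sat_omega_jumps_exist
    proof
      fix X assume "X \<in> S"
      from omega_jump_exists[OF this] obtain Y where Y: "Y \<in> S" "projection_in M Y \<zero> = X"
        "\<And>k. projection_in M Y (k \<oplus> \<one>) = jump_in M (projection_in M Y k)" by blast
      \<comment> \<open>\<open>Y\<close> itself is the sequence demanded by
        \<open>iter_jump_in\<close>, the same for every \<open>n\<close>, standard or not; it
        remains to see that its projections are sets of the structure.\<close>
      have "projection_in M Y k \<in> S" for k
        unfolding projection_in_def by (rule definable_comprehension) (intro arith_intros Y)
      with Y show "\<exists>Y\<in>S. \<forall>n. \<exists>A\<in>S. A = projection_in M Y n \<and> iter_jump_in M X n A"
        unfolding iter_jump_in_def by (intro bexI[of _ Y]) auto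
    qed
  qed
  then show ?thesis by (simp add: models_def)
qed

end
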